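(* Let $d,m\ge 1$ be integers, $n=d+m$, let $A\in\mathbb{R}^{(d+1)\times m}$ and let $\mathcal{L}=\{(\bm{x},\widetilde{\bm{x}}A)\mid \bm{x}\in\mathbb{R}^d\}\subset\mathbb{R}^n$, where $\widetilde{\bm{x}}=(1,\bm{x})$. Suppose that $\omega(A)=\omega$ and $\sigma(A)=\sigma$. Then for any $\bm{\theta}\in\mathbb{R}^n$ we have $$\sigma(\mathcal{L},\bm{\theta})\le\min\left\{\frac1d\left(1-\frac{m}{\max\{n,\omega\}}\right),\ \frac{m\sigma-d}{n}\right\}.$$ In particular, the following equivalence holds: $$\omega(A)\le n\iff \sigma(\mathcal{L},\bm{\theta})=\frac1n\ \text{ for all }\bm{\theta}\in\mathbb{R}^n.$$
   Context: Vectors are row vectors; $|\cdot|$ is the supremum norm; $\|\bm{y}\|$ is the sup-norm distance of $\bm{y}$ to the nearest integer vector (also for column vectors). The diophantine exponent $\omega(A)$ of a real matrix $A$ with $m$ columns is the supremum (possibly $\infty$) of all $\omega\in\mathbb{R}$ such that $\|A\bm{q}^{\mathrm T}\|<|\bm{q}|^{-\omega}$ holds for infinitely many $\bm{q}\in\mathbb{Z}^m$. Also $\sigma(A):=\omega(A^{\mathrm T})$. If $\omega$ or $\sigma$ is infinite, the usual conventions ($m/\infty=0$, etc.) apply. For $\tau\in\mathbb{R}$, $\bm{\theta}\in\mathbb{R}^n$ let $\mathcal{S}_n(\tau,\bm{\theta})=\{\bm{y}\in\mathbb{R}^n:\|q\bm{y}-\bm{\theta}\|<q^{-\tau}\text{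 for infinitely many }q\in\mathbb{N}\}$. For a submanifold $\mathcal{M}$ of $\mathbb{R}^n$ with induced Lebesgue measure $|\cdot|_{\mathcal{M}}$, put $\sigma(\mathcal{M},\bm{\theta})=\sup\{\tau\in\mathbb{R}: |\mathcal{S}_n(\tau,\bm{\theta})\cap\mathcal{M}|_{\mathcal{M}}>0\}$. *)

theory Defs
  imports "HOL-Analysis.Analysis"
begin

definition int_vecs :: "(real^'k) set" where
  "int_vecs = {z. \<forall>i. z $ i \<in> \<int>}"

definition int_dist :: "real^'k \<Rightarrow> real" where
  "int_dist y = (INF z\<in>int_vecs. infnorm (y - z))"

text \<open>The supremum is taken in the extended reals, so that it may be infinite.\<close>
definition dioph_exponent :: "real^'m^'k \<Rightarrow> ereal" where
  "dioph_exponent A =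
     Sup (ereal ` {w. infinite {q \<in> int_vecs. int_dist (A *v q) < infnorm q powr (- w)}})"

definition dioph_exponent_dual :: "real^'m^'k \<Rightarrow> ereal" where
  "dioph_exponent_dual A = dioph_exponent (transpose A)"

definition approx_set :: "real \<Rightarrow> real^'n \<Rightarrow> (real^'n) set" where
  "approx_set \<tau> \<theta> = {y. infinite {q::nat. int_dist (real q *\<^sub>R y - \<theta>) < real q powr (- \<tau>)}}"

text \<open>
  A local C1 parametrisation of the submanifold \<open>M\<close>: an immersion that is a homeomorphism
  from an open set \<open>U\<close> onto a relatively open subset of \<open>M\<close>.
\<close>
definition local_parametrisation ::
    "(real^'n) set \<Rightarrow> (real^'d) set \<Rightarrow> (real^'d \<Rightarrow> real^'n) \<Rightarrow> bool" where
  "local_parametrisation M U \<phi> \<longleftrightarrow>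
     open U \<and>
     openin (top_of_set M) (\<phi> ` U) \<and>
     (\<exists>\<psi>. homeomorphism U (\<phi> ` U) \<phi> \<psi>) \<and>
     (\<forall>u\<in>U. \<phi> differentiable (at u)) \<and>
     continuous_on U (\<lambda>u. jacobian \<phi> (at u)) \<and>
     (\<forall>u\<in>U. inj ((*v) (jacobian \<phi> (at u))))"

text \<open>
  The Lebesgue (Riemannian volume) measure induced on a submanifold \<open>M\<close> of dimension
  \<open>CARD('d)\<close>: the unique Borel measure on \<open>M\<close> given in every local parametrisation by the
  density \<open>sqrt (det (J\<^sup>T J))\<close>, where \<open>J\<close> is the Jacobian matrix, i.e. the square root of the
  Gram determinant. The type argument only supplies the dimension; the description is
  meaningless if \<open>M\<close> is not a submanifold of that dimension.
\<close>
definition induced_lebesgue :: "'d::finite itself \<Rightarrow> (real^'n) set \<Rightarrow> (real^'n) measure" where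
  "induced_lebesgue (_ :: 'd itself) M =
     (THE \<mu>. sets \<mu> = sets (restrict_space borel M) \<and>
        (\<forall>(U :: (real^'d) set) \<phi>. local_parametrisation M U \<phi> \<longrightarrow>
           (\<forall>E\<in>sets borel. E \<subseteq> U \<longrightarrow>
              emeasure \<mu> (\<phi> ` E) =
                (\<integral>\<^sup>+u\<in>E. ennreal (sqrt (det (transpose (jacobian \<phi> (at u)) ** jacobian \<phi> (at u))))
                   \<partial>lborel))))"

definition manifold_exponent :: "'d::finite itself \<Rightarrow> (real^'n) set \<Rightarrow> real^'n \<Rightarrow> ereal" where
  "manifold_exponent D M \<theta> =
     Sup (ereal ` {\<tau>. emeasure (induced_lebesgue D M) (approx_set \<tau> \<theta> \<inter> M) > 0})"

definition tilde :: "real^'d::finite \<Rightarrow> real^('d option)" where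
  "tilde x = (\<chi> i. case i of None \<Rightarrow> 1 | Some k \<Rightarrow> x $ k)"

text \<open>
  The rows of \<open>A\<close> are indexed by \<open>'d option\<close>, with \<open>None\<close> the row multiplied by the leading 1
  of \<open>tilde x\<close>; the coordinates of the ambient space are indexed by \<open>'d + 'm\<close>.
\<close>
definition affine_subspace :: "real^'m::finite^('d::finite option) \<Rightarrow> (real^('d + 'm)) set" where
  "affine_subspace A =
     range (\<lambda>x :: real^'d. \<chi> k. case k of Inl i \<Rightarrow> x $ i | Inr j \<Rightarrow> (tilde x v* A) $ j)"

end

theory Submission
  imports Defs
begin

text \<open>
  In the global chart \<open>x \<mapsto> (x, x~ A)\<close> of the subspace the induced measure is a positive
  constant times Lebesgue measure of \<open>\<real>\<^sup>d\<close>, so the exponent of the subspace is the supremum of the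
  \<open>\<tau>\<close> for which the parameters \<open>x\<close> of \<open>\<tau>\<close>-approximable points form a set that is not null.

  \<^bold>\<open>Upper bounds.\<close> If \<open>(x, x~ A)\<close> is approximated with denominator \<open>q\<close>, rounding the first \<open>d\<close>
  coordinates produces an integer vector \<open>z\<close> with leading entry \<open>q\<close> for which \<open>z A\<close> lies within
  a constant times \<open>q\<^bsup>-\<tau>\<^esup>\<close> of a fixed point modulo integers, and \<open>x\<close> lies within a constant times
  \<open>q\<^bsup>-\<tau>-1\<^esup>\<close> of a point determined by \<open>z\<close>. Hence Borel-Cantelli over dyadic ranges of \<open>q\<close>
  reduces everything to counting such \<open>z\<close> with \<open>|z| \<le> Q\<close>; taking differences removes \<open>\<theta>\<close>
  (\<open>null_set_of_near_vecs_count\<close>). There are two ways to count. The exponent \<open>\<sigma>\<close> says that the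
  points \<open>z A\<close> are well separated modulo integers, and a packing argument gives the bound with
  \<open>\<sigma>\<close> (\<open>near_vecs_count_of_dual_exponent\<close>). The exponent \<open>\<omega>\<close> says that the points \<open>A h\<close>, for
  \<open>h\<close> in a box in \<open>\<int>\<^sup>m\<close>, are well separated. Every counted \<open>z\<close> makes the phases \<open>z \<bullet> A h\<close> nearly
  integral for all \<open>h\<close> at once, while orthogonality of characters bounds how many \<open>z\<close> can do so.
  This large sieve in its dual form gives the bound with \<open>\<omega>\<close>
  (\<open>card_near_vecs_duality\<close>, \<open>near_vecs_count_of_exponent\<close>).

  \<^bold>\<open>The equivalence.\<close> If \<open>\<omega>(A) \<le> n\<close>, the first bound is \<open>1/n\<close>. For \<open>\<theta> = 0\<close> it says that almost
  every point of the subspace is not very well approximable, and a point \<open>y\<close> of this kind admits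
  inhomogeneous approximations of every order below \<open>1/n\<close>, to every \<open>\<theta>\<close>: its multiples are so
  well spread modulo integers that any point can be reached from \<open>0\<close> by few short steps
  (\<open>mem_approx_set_of_not_well_approximable\<close>). If \<open>\<omega>(A) > n\<close>, all points of the subspace are very
  close to infinitely many rational hyperplanes. The multiples of such a point are confined to thin
  slabs, so by the pigeonhole principle two of them come closer than they generically would
  (\<open>mem_approx_set_of_near_rational_hyperplanes\<close>, one half of Khintchine's transference principle).
  Therefore the exponent at \<open>\<theta> = 0\<close> exceeds \<open>1/n\<close>.
\<close>

section \<open>Change of variables for an arbitrary finite index type\<close>

text \<open>
  The change of variables formula \<open>has_measure_differentiable_image\<close> is stated for well-ordered index
  types. Giving a copy of an arbitrary type some well-order makes it applicable to \<open>real^'n\<close> for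
  every finite \<open>'n\<close>, after relabelling coordinates.
\<close>

typedef 'a well_ordered_copy = "UNIV :: 'a set"
  by auto

instantiation well_ordered_copy :: (type) wellorder
begin

definition less_eq_well_ordered_copy :: "'a well_ordered_copy \<Rightarrow> 'a well_ordered_copy \<Rightarrow> bool" where
  "(x :: 'a well_ordered_copy) \<le> y \<longleftrightarrow> (Rep_well_ordered_copy x, Rep_well_ordered_copy y) \<in> (SOME r. well_order_on UNIV r)"

definition less_well_ordered_copy :: "'a well_ordered_copy \<Rightarrow> 'a well_ordered_copy \<Rightarrow> bool" where
  "(x :: 'a well_ordered_copy) < y \<longleftrightarrow> x \<le> y \<and> x \<noteq> y"

instance
proof -
  define r :: "'a rel" where "r = (SOME r. well_order_on UNIV r)"
  have wo: "well_order_on UNIV r"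
    unfolding r_def by (rule someI_ex) (rule well_order_on)
  have refl: "refl r" and tr: "trans r" and asym: "antisym r" and tot: "total r" and wf: "wf (r - Id)"
    using wo unfolding well_order_on_def linear_order_on_def partial_order_on_def preorder_on_def by auto
  have le: "(x :: 'a well_ordered_copy) \<le> y \<longleftrightarrow> (Rep_well_ordered_copy x, Rep_well_ordered_copy y) \<in> r" for x y :: "'a well_ordered_copy"
    by (simp add: less_eq_well_ordered_copy_def r_def)
  have lt: "x < y \<longleftrightarrow> (Rep_well_ordered_copy x, Rep_well_ordered_copy y) \<in> r - Id" for x y :: "'a well_ordered_copy"
    by (auto simp: less_well_ordered_copy_def le Rep_well_ordered_copy_inject)
  show "OFCLASS('a well_ordered_copy, wellorder_class)"
  proof
    fix x y z :: "'a well_ordered_copy"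
    show "x < y \<longleftrightarrow> x \<le> y \<and> \<not> y \<le> x"
      using asym by (simp add: less_well_ordered_copy_def le) (metis antisymD Rep_well_ordered_copy_inject)
    show "x \<le> x"
      using refl by (simp add: le refl_on_def)
    show "x \<le> y \<Longrightarrow> y \<le> z \<Longrightarrow> x \<le> z"
      using tr by (auto simp: le elim: transE)
    show "x \<le> y \<Longrightarrow> y \<le> x \<Longrightarrow> x = y"
      using asym by (simp add: le) (metis antisymD Rep_well_ordered_copy_inject)
    show "x \<le> y \<or> y \<le> x"
      using tot refl by (cases "x = y") (auto simp: le total_on_def refl_on_def Rep_well_ordered_copy_inject)
  next
    fix P :: "'a well_ordered_copy \<Rightarrow> bool" and a :: "'a well_ordered_copy"
    assume step: "\<And>x. (\<And>y. y < x \<Longrightarrow> P y) \<Longrightarrow> P x"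
    have "P (Abs_well_ordered_copy u)" for u
      using wf
    proof (induction u rule: wf_induct_rule)
      case (less u)
      show ?case
        by (rule step) (metis less lt Abs_well_ordered_copy_inverse Rep_well_ordered_copy_inverse UNIV_I)
    qed
    then show "P a"
      by (metis Rep_well_ordered_copy_inverse)
  qed
qed

end

lemma bij_Rep_well_ordered_copy: "bij Rep_well_ordered_copy"
  by (rule bij_betw_byWitness[where f' = Abs_well_ordered_copy])
    (simp_all add: Rep_well_ordered_copy_inverse Abs_well_ordered_copy_inverse)

instance well_ordered_copy :: (finite) finite
proof
  show "finite (UNIV :: 'a well_ordered_copy set)"
    by (rule iffD2[OF bij_betw_finite[OF bij_Rep_well_ordered_copy] finite[of UNIV]])
qed

text \<open>
  Conjugation by \<open>r\<close> is a sign-preserving bijection between the permutations of the two index types.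
\<close>

lemma det_reindex:
  fixes M :: "'k::comm_ring_1^'a::finite^'a" and r :: "'b::finite \<Rightarrow> 'a"
  assumes "bij r"
  shows "det (\<chi> i j. M $ r i $ r j) = det M"
proof -
  have inj: "inj r" and surj: "surj r" using assms by (auto simp: bij_def)
  have mp: "map_permutation UNIV r q = r \<circ> q \<circ> inv r" for q
    using surj by (auto simp: map_permutation_def fun_eq_iff)
  have bb: "bij_betw (map_permutation UNIV r) {q. q permutes UNIV} {p. p permutes UNIV}"
  proof (rule bij_betwI[where g = "\<lambda>p. inv r \<circ> p \<circ> r"])
    show "map_permutation UNIV r \<in> {q. q permutes UNIV} \<rightarrow> {p. p permutes UNIV}"
      using map_permutation_permutes[of r UNIV] assms by (auto simp: bij_def)
    show "(\<lambda>p. inv r \<circ> p \<circ> r) \<in> {p. p permutes UNIV} \<rightarrow> {q. q permutes UNIV}"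
      using assms by (auto simp: permutes_bij bij_imp_permutes intro!: bij_imp_permutes bij_comp bij_imp_bij_inv)
  qed (use inj surj in \<open>auto simp: mp fun_eq_iff surj_f_inv_f\<close>)
  have "det M = (\<Sum>q | q permutes UNIV. of_int (sign (map_permutation UNIV r q)) *
            (\<Prod>i\<in>UNIV. M $ i $ map_permutation UNIV r q i))"
    unfolding det_def by (rule sum.reindex_bij_betw[OF bb, symmetric])
  also have "\<dots> = (\<Sum>q | q permutes UNIV. of_int (sign q) * (\<Prod>i\<in>UNIV. M $ r i $ r (q i)))"
  proof (rule sum.cong[OF refl])
    fix q assume "q \<in> {q. q permutes (UNIV :: 'b set)}"
    then have "sign (map_permutation UNIV r q) = sign q"
      using inj by (intro sign_map_permutation) auto
    moreover have "(\<Prod>i\<in>UNIV. M $ i $ map_permutation UNIV r q i) = (\<Prod>i\<in>UNIV. M $ r i $ r (q i))"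
      using prod.reindex_bij_betw[OF assms, of "\<lambda>i. M $ i $ map_permutation UNIV r q i"] inj
      by (simp add: mp)
    ultimately show "of_int (sign (map_permutation UNIV r q)) * (\<Prod>i\<in>UNIV. M $ i $ map_permutation UNIV r q i)
        = of_int (sign q) * (\<Prod>i\<in>UNIV. M $ r i $ r (q i))" by simp
  qed
  also have "\<dots> = det (\<chi> i j. M $ r i $ r j)"
    by (simp add: det_def)
  finally show ?thesis by simp
qed

lemma lborel_reindex:
  fixes r :: "'b::finite \<Rightarrow> 'a::finite"
  assumes "bij r"
  shows "distr lborel borel (\<lambda>x :: real^'a. (\<chi> i. x $ r i) :: real^'b) = lborel"
proof (rule lborel_eqI[symmetric])
  fix l u :: "real^'b"
  assume lu: "\<And>b. b \<in> Basis \<Longrightarrow> l \<bullet> b \<le> u \<bullet> b"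
  have le: "l $ i \<le> u $ i" for i using lu[of "axis i 1"] by (auto simp: Basis_vec_def inner_axis)
  let ?R = "\<lambda>x :: real^'a. (\<chi> i. x $ r i) :: real^'b"
  let ?l = "(\<chi> k. l $ inv r k) :: real^'a" and ?u = "(\<chi> k. u $ inv r k) :: real^'a"
  have [measurable]: "?R \<in> borel_measurable borel"
    by (intro borel_measurable_continuous_onI continuous_intros)
  have inv: "inv r (r i) = i" "r (inv r k) = k" for i k
    using assms by (simp_all add: bij_is_inj bij_is_surj surj_f_inv_f)
  have "(\<forall>i. P i (x $ r i)) \<longleftrightarrow> (\<forall>k. P (inv r k) (x $ k))" for P and x :: "real^'a"
    using inv by metis
  from this[of "\<lambda>i t. l $ i < t \<and> t < u $ i"] have "?R -` box l u = box ?l ?u"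
    by (simp add: set_eq_iff mem_box_cart)
  then have "emeasure (distr lborel borel ?R) (box l u) = emeasure lborel (box ?l ?u)"
    by (simp add: emeasure_distr)
  also have "\<dots> = (\<Prod>b\<in>Basis. (?u - ?l) \<bullet> b)"
    using le by (subst emeasure_lborel_box_eq) (auto simp: Basis_vec_def inner_axis)
  also have "(\<Prod>b\<in>Basis. (?u - ?l) \<bullet> b) = (\<Prod>k\<in>UNIV. u $ inv r k - l $ inv r k)"
    by (simp add: Basis_vec_def UNION_singleton_eq_range prod.reindex inj_on_def axis_eq_axis inner_axis)
  also have "\<dots> = (\<Prod>k\<in>UNIV. u $ k - l $ k)"
    using prod.reindex_bij_betw[of "inv r" UNIV UNIV "\<lambda>k. u $ k - l $ k"] assms bij_imp_bij_inv by blast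
  also have "\<dots> = (\<Prod>b\<in>Basis. (u - l) \<bullet> b)"
    by (simp add: Basis_vec_def UNION_singleton_eq_range prod.reindex inj_on_def axis_eq_axis inner_axis)
  finally show "emeasure (distr lborel borel ?R) (box l u) = (\<Prod>b\<in>Basis. (u - l) \<bullet> b)" .
qed auto

text \<open>
  The formula \<open>has_measure_differentiable_image\<close> speaks about finite measures. As it is an equivalence, infinite measure on one
  side forces an infinite integral on the other, and the formula holds without a finiteness
  assumption.
\<close>

lemma emeasure_differentiable_image_wellorder:
  fixes g :: "real^'n::{finite,wellorder} \<Rightarrow> real^'n::_"
  assumes S: "S \<in> sets borel"
    and der: "\<And>x. x \<in> S \<Longrightarrow> (g has_derivative (*v) (J x)) (at x)"
    and inj: "inj_on g S" and gS: "g ` S \<in> sets borel"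
    and J: "set_borel_measurable borel S (\<lambda>x. \<bar>det (J x)\<bar>)"
  shows "emeasure lborel (g ` S) = (\<integral>\<^sup>+x\<in>S. ennreal \<bar>det (J x)\<bar> \<partial>lborel)"
proof -
  have Sl: "S \<in> sets lebesgue" using S by auto
  have der': "(g has_derivative (*v) (J x)) (at x within S)" if "x \<in> S" for x
    using der[OF that] by (rule has_derivative_at_withinI)
  note * = has_measure_differentiable_image[OF Sl der' inj, simplified matrix_of_matrix_vector_mul]
  have eq: "(\<integral>\<^sup>+x\<in>S. ennreal \<bar>det (J x)\<bar> \<partial>lborel) = (\<integral>\<^sup>+x. ennreal (indicator S x * \<bar>det (J x)\<bar>) \<partial>lborel)"
    by (intro nn_integral_cong) (auto simp: indicator_def)
  show ?thesis
  proof (cases "(\<integral>\<^sup>+x\<in>S. ennreal \<bar>det (J x)\<bar> \<partial>lborel) < \<infinity>")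
    case True
    obtain r where r: "(\<integral>\<^sup>+x\<in>S. ennreal \<bar>det (J x)\<bar> \<partial>lborel) = ennreal r" "0 \<le> r"
      using True by (cases "\<integral>\<^sup>+x\<in>S. ennreal \<bar>det (J x)\<bar> \<partial>lborel" rule: ennreal_cases) (simp_all del: nn_integral_set_ennreal)
    have "((\<lambda>x. indicator S x * \<bar>det (J x)\<bar>) has_integral r) UNIV"
    proof (rule nn_integral_has_integral)
      show "(\<lambda>x. indicat_real S x * \<bar>det (J x)\<bar>) \<in> borel_measurable borel"
        using J by (simp add: set_borel_measurable_def)
    qed (use r eq in simp_all)
    then have "((\<lambda>x. if x \<in> S then \<bar>det (J x)\<bar> else 0) has_integral r) UNIV"
      by (rule has_integral_eq[rotated]) (auto simp: indicator_def)
    then have "((\<lambda>x. \<bar>det (J x)\<bar>) has_integral r) S"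
      by (simp only: has_integral_restrict_UNIV)
    with * have "g ` S \<in> lmeasurable" "measure lebesgue (g ` S) = r" by auto
    then have "emeasure lebesgue (g ` S) = ennreal r"
      by (simp add: emeasure_eq_measure2)
    then show ?thesis using r gS by simp
  next
    case False
    then have top: "(\<integral>\<^sup>+x\<in>S. ennreal \<bar>det (J x)\<bar> \<partial>lborel) = \<infinity>" by (metis infinity_ennreal_def top.not_eq_extremum)
    have "emeasure lborel (g ` S) = \<infinity>"
    proof (rule ccontr)
      assume "emeasure lborel (g ` S) \<noteq> \<infinity>"
      then have "g ` S \<in> lmeasurable"
        using gS by (auto simp: fmeasurable_def top.not_eq_extremum)
      with * have "((\<lambda>x. \<bar>det (J x)\<bar>) has_integral (measure lebesgue (g ` S))) S" by auto
      then have "(\<integral>\<^sup>+x\<in>S. ennreal \<bar>det (J x)\<bar> \<partial>lborel) = ennreal (measure lebesgue (g ` S))"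
        unfolding eq by (intro nn_integral_has_integral_lebesgue) simp
      then show False using top by simp
    qed
    then show ?thesis using top by simp
  qed
qed


lemma emeasure_differentiable_image:
  fixes g :: "real^'n::finite \<Rightarrow> real^'n"
  assumes S: "S \<in> sets borel"
    and der: "\<And>x. x \<in> S \<Longrightarrow> (g has_derivative (*v) (J x)) (at x)"
    and inj: "inj_on g S" and gS: "g ` S \<in> sets borel"
    and J: "set_borel_measurable borel S (\<lambda>x. \<bar>det (J x)\<bar>)"
  shows "emeasure lborel (g ` S) = (\<integral>\<^sup>+x\<in>S. ennreal \<bar>det (J x)\<bar> \<partial>lborel)"
proof -
  define r :: "'n well_ordered_copy \<Rightarrow> 'n" where "r = Rep_well_ordered_copy"
  have bij: "bij r" by (simp add: r_def bij_Rep_well_ordered_copy)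
  have inv: "inv r (r i) = i" "r (inv r k) = k" for i k
    using bij by (simp_all add: bij_is_inj bij_is_surj surj_f_inv_f)
  define R :: "real^'n \<Rightarrow> real^'n well_ordered_copy" where "R = (\<lambda>x. \<chi> i. x $ r i)"
  define R' :: "real^'n well_ordered_copy \<Rightarrow> real^'n" where "R' = (\<lambda>y. \<chi> k. y $ inv r k)"
  have RR: "R' (R x) = x" "R (R' y) = y" for x y
    by (simp_all add: R_def R'_def vec_eq_iff inv)
  have lin: "linear R" "linear R'"
    by (auto simp: R_def R'_def linear_iff vec_eq_iff)
  have Rm [measurable]: "R \<in> borel_measurable borel" "R' \<in> borel_measurable borel"
    unfolding R_def R'_def by (intro borel_measurable_continuous_onI continuous_intros)+
  have distr: "distr lborel borel R = lborel"
    unfolding R_def by (rule lborel_reindex[OF bij])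
  have Rimg: "R ` T = R' -` T" for T
    using RR by (auto simp: image_iff) metis
  have Rsets: "R ` T \<in> sets borel" if "T \<in> sets borel" for T
    unfolding Rimg using measurable_sets[OF Rm(2) that] by simp
  define J' where "J' = (\<lambda>y. \<chi> i j. J (R' y) $ r i $ r j)"
  have det: "det (J' y) = det (J (R' y))" for y
    unfolding J'_def by (rule det_reindex[OF bij])
  have J'R: "R (J (R' y) *v R' h) = J' y *v h" for y h
  proof -
    have "(\<Sum>k\<in>UNIV. J (R' y) $ r i $ k * h $ inv r k) = (\<Sum>j\<in>UNIV. J (R' y) $ r i $ r j * h $ j)" for i
      using sum.reindex_bij_betw[OF bij, of "\<lambda>k. J (R' y) $ r i $ k * h $ inv r k"] by (simp add: inv)
    then show ?thesis
      by (simp add: R_def R'_def J'_def matrix_vector_mult_def vec_eq_iff)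
  qed
  \<comment> \<open>Relabelling coordinates preserves Lebesgue measure and conjugates \<open>g\<close> to \<open>R \<circ> g \<circ> R'\<close>.\<close>
  have "emeasure lborel (g ` S) = emeasure (distr lborel borel R) (R ` g ` S)"
    using Rsets[OF gS] RR by (subst emeasure_distr) (auto simp: Rimg[of "g ` S"] vimage_def)
  also have "\<dots> = emeasure lborel ((R \<circ> g \<circ> R') ` (R ` S))"
    unfolding distr by (simp add: image_comp comp_def RR)
  also have "\<dots> = (\<integral>\<^sup>+y\<in>R ` S. ennreal \<bar>det (J' y)\<bar> \<partial>lborel)"
  proof (rule emeasure_differentiable_image_wellorder)
    show "R ` S \<in> sets borel" by (rule Rsets[OF S])
    show "(R \<circ> g \<circ> R') ` R ` S \<in> sets borel"
      using Rsets[OF gS] by (simp add: image_comp comp_def RR)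
    show "inj_on (R \<circ> g \<circ> R') (R ` S)"
      using inj by (auto simp: inj_on_def RR) (metis RR(1) inj_onD)
    show "(R \<circ> g \<circ> R' has_derivative (*v) (J' y)) (at y)" if "y \<in> R ` S" for y
    proof -
      have "R' y \<in> S" using that RR by auto
      from der[OF this] have d: "(g has_derivative (*v) (J (R' y))) (at (R' y))" .
      have "(R' has_derivative R') (at y)"
        using lin(2) by (intro linear_imp_has_derivative)
      from diff_chain_at[OF this d] have "(g \<circ> R' has_derivative (*v) (J (R' y)) \<circ> R') (at y)" .
      from diff_chain_at[OF this linear_imp_has_derivative[OF lin(1)]]
      have "(R \<circ> (g \<circ> R') has_derivative R \<circ> ((*v) (J (R' y)) \<circ> R')) (at y)" .
      moreover have "R \<circ> ((*v) (J (R' y)) \<circ> R') = (*v) (J' y)"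
        by (auto simp: J'R)
      ultimately show ?thesis by (simp add: comp_assoc)
    qed
    have "(\<lambda>y. (indicator S (R' y) *\<^sub>R \<bar>det (J (R' y))\<bar>) :: real) \<in> borel_measurable borel"
      by (rule measurable_compose[OF Rm(2) J[unfolded set_borel_measurable_def]])
    moreover have "indicator (R ` S) y = (indicator S (R' y) :: real)" for y
      by (auto simp: Rimg indicator_def)
    ultimately show "set_borel_measurable borel (R ` S) (\<lambda>y. \<bar>det (J' y)\<bar>)"
      by (simp add: set_borel_measurable_def det)
  qed
  also have "\<dots> = (\<integral>\<^sup>+y. ennreal (indicator S (R' y) *\<^sub>R \<bar>det (J (R' y))\<bar>) \<partial>distr lborel borel R)"
    unfolding distr by (intro nn_integral_cong) (auto simp: Rimg indicator_def det)
  also have "\<dots> = (\<integral>\<^sup>+x. ennreal (indicator S (R' (R x)) *\<^sub>R \<bar>det (J (R' (R x)))\<bar>) \<partial>lborel)"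
  proof (rule nn_integral_distr)
    have "(\<lambda>y. ennreal (indicator S (R' y) *\<^sub>R \<bar>det (J (R' y))\<bar>)) \<in> borel_measurable borel"
      by (intro measurable_compose[OF _ measurable_ennreal]
          measurable_compose[OF Rm(2) J[unfolded set_borel_measurable_def]])
    then show "(\<lambda>y. ennreal (indicator S (R' y) *\<^sub>R \<bar>det (J (R' y))\<bar>)) \<in> borel_measurable (distr lborel borel R)"
      by simp
  qed simp
  also have "\<dots> = (\<integral>\<^sup>+x\<in>S. ennreal \<bar>det (J x)\<bar> \<partial>lborel)"
    by (intro nn_integral_cong) (auto simp: RR indicator_def)
  finally show ?thesis .
qed

section \<open>The induced measure of the affine subspace\<close>

text \<open>
  Along the segment from the identity to \<open>G\<close> the form stays positive, so the determinant never
  vanishes and keeps the sign it has at the identity.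
\<close>

lemma det_pos_of_quadratic_form:
  fixes G :: "real^'d^'d"
  assumes pos: "\<And>x. x \<noteq> 0 \<Longrightarrow> x \<bullet> (G *v x) > 0"
  shows "det G > 0"
proof (rule ccontr)
  assume neg: "\<not> det G > 0"
  define H where "H = (\<lambda>t::real. (1 - t) *\<^sub>R mat 1 + t *\<^sub>R G)"
  have cont: "continuous_on {0..1} (\<lambda>t. det (H t))"
    unfolding det_def H_def by (auto intro!: continuous_intros)
  have "\<exists>t. 0 \<le> t \<and> t \<le> 1 \<and> det (H t) = 0"
    using neg by (intro IVT2'[OF _ _ _ cont]) (auto simp: H_def)
  then obtain t where t: "0 \<le> t" "t \<le> 1" "det (H t) = 0" by auto
  then have "\<not> invertible (H t)" by (simp add: invertible_det_nz)
  then obtain x where x: "x \<noteq> 0" "H t *v x = 0"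
    by (metis invertible_left_inverse matrix_left_invertible_ker)
  have "x \<bullet> (H t *v x) = (1 - t) * (x \<bullet> x) + t * (x \<bullet> (G *v x))"
    by (simp add: H_def matrix_vector_mult_add_rdistrib inner_add_right scaleR_matrix_vector_assoc[symmetric])
  moreover have "\<dots> > 0"
  proof (cases "t = 0")
    case True with x show ?thesis by simp
  next
    case False
    then have "t * (x \<bullet> (G *v x)) > 0" "(1 - t) * (x \<bullet> x) \<ge> 0"
      using t pos[OF x(1)] by auto
    then show ?thesis by linarith
  qed
  ultimately show False using x by simp
qed

definition affine_chart :: "real^'m::finite^('d::finite option) \<Rightarrow> real^'d \<Rightarrow> real^('d + 'm)" where
  "affine_chart A x = (\<chi> k. case k of Inl i \<Rightarrow> x $ i | Inr j \<Rightarrow> (tilde x v* A) $ j)"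

lemma affine_subspace_eq_range: "affine_subspace A = range (affine_chart A)"
  by (simp add: affine_subspace_def affine_chart_def[abs_def])

lemma sum_option: "(\<Sum>k\<in>UNIV. f k) = f None + (\<Sum>k\<in>UNIV. f (Some k))"
  for f :: "'a::finite option \<Rightarrow> 'b::comm_monoid_add"
  by (simp add: UNIV_option_conv sum.reindex)

lemma affine_chart_Inl [simp]: "affine_chart A x $ Inl i = x $ i"
  and affine_chart_Inr: "affine_chart A x $ Inr j = A $ None $ j + (\<Sum>k\<in>UNIV. A $ Some k $ j * x $ k)"
  by (simp_all add: affine_chart_def vector_matrix_mult_def sum_option tilde_def mult.commute)

text \<open>
  The Jacobian matrix of \<open>affine_chart A\<close>, which is the same at every point.
\<close>

definition chart_matrix :: "real^'m::finite^('d::finite option) \<Rightarrow> real^'d^('d + 'm)" where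
  "chart_matrix A = (\<chi> k l. case k of Inl i \<Rightarrow> (if i = l then 1 else 0) | Inr j \<Rightarrow> A $ Some l $ j)"

lemma affine_chart_eq: "affine_chart A x = affine_chart A 0 + chart_matrix A *v x"
proof (unfold vec_eq_iff, rule allI)
  fix k show "affine_chart A x $ k = (affine_chart A 0 + chart_matrix A *v x) $ k"
    by (cases k) (simp_all add: affine_chart_Inr chart_matrix_def matrix_vector_mult_def if_distrib[of "\<lambda>c. c * _"] cong: if_cong)
qed

definition fst_block :: "real^('d::finite + 'm::finite) \<Rightarrow> real^'d" where
  "fst_block y = (\<chi> i. y $ Inl i)"

lemma fst_block_affine_chart [simp]: "fst_block (affine_chart A x) = x"
  by (simp add: fst_block_def vec_eq_iff)

lemma linear_fst_block: "linear fst_block"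
  by (auto simp: linear_iff fst_block_def vec_eq_iff)

lemma continuous_on_fst_block [continuous_intros]: "continuous_on S fst_block"
  using linear_fst_block linear_continuous_on linear_conv_bounded_linear by blast

lemma affine_chart_has_derivative: "(affine_chart A has_derivative (*v) (chart_matrix A)) (at x)"
proof -
  have "((\<lambda>x. affine_chart A 0 + chart_matrix A *v x) has_derivative (*v) (chart_matrix A)) (at x)"
    by (auto intro!: derivative_eq_intros linear_imp_has_derivative)
  then show ?thesis by (simp add: affine_chart_eq[symmetric])
qed

lemma continuous_on_affine_chart [continuous_intros]: "continuous_on S (affine_chart A)"
  by (rule has_derivative_continuous_on, rule has_derivative_at_withinI, rule affine_chart_has_derivative)

lemma fst_block_chart_matrix: "fst_block (chart_matrix A *v x) = x"
  by (simp add: fst_block_def chart_matrix_def matrix_vector_mult_def vec_eq_iff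
        if_distrib[of "\<lambda>c. c * _"] cong: if_cong)

lemma chart_gram_det_pos:
  fixes A :: "real^'m::finite^('d::finite option)"
  shows "det (transpose (chart_matrix A) ** chart_matrix A) > 0"
proof (rule det_pos_of_quadratic_form)
  fix x :: "real^'d" assume "x \<noteq> 0"
  then have "chart_matrix A *v x \<noteq> 0"
    using fst_block_chart_matrix[of A x] linear_0[OF linear_fst_block] by metis
  moreover have "x \<bullet> ((transpose (chart_matrix A) ** chart_matrix A) *v x) = (chart_matrix A *v x) \<bullet> (chart_matrix A *v x)"
    by (simp add: matrix_vector_mul_assoc[symmetric] dot_lmul_matrix[symmetric] vector_transpose_matrix inner_commute)
  ultimately show "x \<bullet> ((transpose (chart_matrix A) ** chart_matrix A) *v x) > 0"
    by simp
qed

lemma local_parametrisation_affine_chart: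
  "local_parametrisation (affine_subspace A) UNIV (affine_chart A)"
proof -
  have jac: "jacobian (affine_chart A) (at u) = chart_matrix A" for u
    by (metis frechet_derivative_at[OF affine_chart_has_derivative] jacobian_def matrix_of_matrix_vector_mul)
  have "homeomorphism UNIV (range (affine_chart A)) (affine_chart A) fst_block"
    by (simp add: homeomorphism_def image_image continuous_on_fst_block continuous_on_affine_chart)
  moreover have "inj ((*v) (chart_matrix A))"
    by (metis fst_block_chart_matrix injI)
  ultimately show ?thesis
    using affine_chart_has_derivative[of A]
    by (auto simp: local_parametrisation_def affine_subspace_eq_range jac differentiable_def)
qed

text \<open>
  Any local parametrisation \<open>\<phi>\<close> factors as \<open>\<phi> = affine_chart A \<circ> g\<close> with \<open>g = fst_block \<circ> \<phi>\<close>. The Gram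
  determinant of \<open>\<phi>\<close> is then the constant Gram determinant of the chart times \<open>(det g')\<^sup>2\<close>, and the
  integral is an instance of the change of variables for \<open>g\<close>.
\<close>

lemma emeasure_parametrised_affine_subspace:
  fixes A :: "real^'m::finite^('d::finite option)" and \<phi> :: "real^'d \<Rightarrow> real^('d + 'm)"
  assumes par: "local_parametrisation (affine_subspace A) U \<phi>"
    and E: "E \<in> sets borel" "E \<subseteq> U"
  defines "c \<equiv> sqrt (det (transpose (chart_matrix A) ** chart_matrix A))"
  shows "\<phi> ` E = affine_chart A ` (fst_block ` \<phi> ` E)"
    and "fst_block ` \<phi> ` E \<in> sets borel"
    and "(\<integral>\<^sup>+u\<in>E. ennreal (sqrt (det (transpose (jacobian \<phi> (at u)) ** jacobian \<phi> (at u)))) \<partial>lborel)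
           = ennreal c * emeasure lborel (fst_block ` \<phi> ` E)"
proof -
  from par obtain \<psi> where U: "open U" and op: "openin (top_of_set (affine_subspace A)) (\<phi> ` U)"
    and hom: "homeomorphism U (\<phi> ` U) \<phi> \<psi>" and diff: "\<And>u. u \<in> U \<Longrightarrow> \<phi> differentiable (at u)"
    and contJ: "continuous_on U (\<lambda>u. jacobian \<phi> (at u))"
    unfolding local_parametrisation_def by auto
  define g where "g = (\<lambda>u. fst_block (\<phi> u))"
  have sub: "\<phi> ` U \<subseteq> affine_subspace A" using op openin_imp_subset by blast
  have \<phi>g: "\<phi> u = affine_chart A (g u)" if "u \<in> U" for u
  proof -
    have "\<phi> u \<in> range (affine_chart A)"
      using that sub by (auto simp: affine_subspace_eq_range)
    then obtain x where "\<phi> u = affine_chart A x" by blast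
    then show ?thesis by (simp add: g_def)
  qed
  show "\<phi> ` E = affine_chart A ` (fst_block ` \<phi> ` E)"
    unfolding image_image using E(2) by (intro image_cong refl \<phi>g[unfolded g_def]) auto
  have gE: "fst_block ` \<phi> ` E = g ` E" by (simp add: g_def image_image)
  have gU: "open (g ` U)"
  proof -
    obtain T where T: "open T" "\<phi> ` U = affine_subspace A \<inter> T"
      using op by (auto simp: openin_open)
    have "g ` U = affine_chart A -` T"
    proof safe
      fix u assume "u \<in> U" then show "g u \<in> affine_chart A -` T"
        using T(2) \<phi>g[of u] by (metis IntD2 imageI vimageI)
    next
      fix x assume "affine_chart A x \<in> T"
      then have "affine_chart A x \<in> \<phi> ` U" using T by (auto simp: affine_subspace_eq_range)
      then obtain u where "u \<in> U" "affine_chart A x = \<phi> u" by auto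
      then show "x \<in> g ` U" by (metis g_def fst_block_affine_chart imageI)
    qed
    then show ?thesis
      by (simp add: open_vimage[OF T(1)] continuous_on_affine_chart)
  qed
  have homg: "\<psi> (affine_chart A (g u)) = u" if "u \<in> U" for u
    using hom \<phi>g[OF that] that unfolding homeomorphism_def by metis
  have cont_inv: "continuous_on (g ` U) (\<lambda>x. \<psi> (affine_chart A x))"
  proof (rule continuous_on_compose2[OF _ continuous_on_affine_chart])
    show "continuous_on (\<phi> ` U) \<psi>" using hom by (simp add: homeomorphism_def)
    show "affine_chart A ` g ` U \<subseteq> \<phi> ` U" using \<phi>g by auto
  qed
  have "(\<lambda>x. \<psi> (affine_chart A x)) \<in> borel_measurable (restrict_space borel (g ` U))"
    using cont_inv by (rule borel_measurable_continuous_on_restrict)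
  from measurable_sets[OF this E(1)] gU
  have "(\<lambda>x. \<psi> (affine_chart A x)) -` E \<inter> g ` U \<in> sets borel"
    by (simp add: sets_restrict_space_iff space_restrict_space)
  also have "(\<lambda>x. \<psi> (affine_chart A x)) -` E \<inter> g ` U = g ` E"
  proof safe
    fix u assume u: "u \<in> U" "\<psi> (affine_chart A (g u)) \<in> E"
    then show "g u \<in> g ` E" using homg[OF u(1)] by simp
  next
    fix u assume "u \<in> E"
    with E(2) have "u \<in> U" by auto
    with \<open>u \<in> E\<close> homg show "g u \<in> (\<lambda>x. \<psi> (affine_chart A x)) -` E" "g u \<in> g ` U" by auto
  qed
  finally have gE_sets: "g ` E \<in> sets borel" .
  then show "fst_block ` \<phi> ` E \<in> sets borel" by (simp add: gE)
  define J where "J = (\<lambda>u. \<chi> i j. jacobian \<phi> (at u) $ Inl i $ j)"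
  have der\<phi>: "(\<phi> has_derivative (*v) (jacobian \<phi> (at u))) (at u)" if "u \<in> U" for u
    using diff[OF that] jacobian_works by blast
  have derg: "(g has_derivative (*v) (J u)) (at u)" if "u \<in> U" for u
  proof -
    have "(fst_block \<circ> \<phi> has_derivative fst_block \<circ> (*v) (jacobian \<phi> (at u))) (at u)"
      by (rule diff_chain_at[OF der\<phi>[OF that] linear_imp_has_derivative[OF linear_fst_block]])
    moreover have "fst_block \<circ> (*v) (jacobian \<phi> (at u)) = (*v) (J u)"
      by (auto simp: fst_block_def J_def matrix_vector_mult_def vec_eq_iff)
    ultimately show ?thesis by (simp add: g_def comp_def)
  qed
  have jac: "jacobian \<phi> (at u) = chart_matrix A ** J u" if "u \<in> U" for u
  proof -
    have "(affine_chart A \<circ> g has_derivative (*v) (chart_matrix A) \<circ> (*v) (J u)) (at u)"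
      by (rule diff_chain_at[OF derg[OF that] affine_chart_has_derivative])
    then have "(\<phi> has_derivative (*v) (chart_matrix A) \<circ> (*v) (J u)) (at u)"
      by (rule has_derivative_transform_within_open[OF _ U that]) (simp add: \<phi>g)
    with der\<phi>[OF that] have "(*v) (jacobian \<phi> (at u)) = (*v) (chart_matrix A) \<circ> (*v) (J u)"
      by (rule has_derivative_unique)
    then have "(*v) (jacobian \<phi> (at u)) = (*v) (chart_matrix A ** J u)"
      by (simp add: comp_def matrix_vector_mul_assoc)
    then show ?thesis by (metis matrix_of_matrix_vector_mul)
  qed
  have gram: "sqrt (det (transpose (jacobian \<phi> (at u)) ** jacobian \<phi> (at u))) = c * \<bar>det (J u)\<bar>" if "u \<in> U" for u
  proof -
    have "transpose (jacobian \<phi> (at u)) ** jacobian \<phi> (at u)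
        = transpose (J u) ** (transpose (chart_matrix A) ** chart_matrix A) ** J u"
      by (simp add: jac[OF that] matrix_transpose_mul matrix_mul_assoc)
    then have "det (transpose (jacobian \<phi> (at u)) ** jacobian \<phi> (at u))
        = det (transpose (chart_matrix A) ** chart_matrix A) * (det (J u))\<^sup>2"
      by (simp only: det_mul det_transpose[of "J u"] power2_eq_square mult_ac)
    then show ?thesis
      by (simp only: c_def real_sqrt_mult real_sqrt_abs)
  qed
  have contdet: "continuous_on U (\<lambda>u. \<bar>det (J u)\<bar>)"
    unfolding det_def by (simp add: J_def, intro continuous_intros contJ)
  have mJ: "set_borel_measurable borel E (\<lambda>u. \<bar>det (J u)\<bar>)"
    unfolding set_borel_measurable_def
    using E contdet by (intro borel_measurable_continuous_on_indicator) (auto intro: continuous_on_subset)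
  have inj: "inj_on g E"
    by (rule inj_on_inverseI[where g = "\<lambda>x. \<psi> (affine_chart A x)"]) (use homg E(2) in auto)
  have "(\<integral>\<^sup>+u\<in>E. ennreal (sqrt (det (transpose (jacobian \<phi> (at u)) ** jacobian \<phi> (at u)))) \<partial>lborel)
      = (\<integral>\<^sup>+u. ennreal c * ennreal (indicator E u *\<^sub>R \<bar>det (J u)\<bar>) \<partial>lborel)"
  proof (intro nn_integral_cong)
    fix u :: "real^'d"
    have "c \<ge> 0" using chart_gram_det_pos[of A] by (simp add: c_def)
    then show "ennreal (sqrt (det (transpose (jacobian \<phi> (at u)) ** jacobian \<phi> (at u)))) * indicator E u
      = ennreal c * ennreal (indicator E u *\<^sub>R \<bar>det (J u)\<bar>)"
      using E(2) gram[of u] by (auto simp: indicator_def ennreal_mult)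
  qed
  also have "\<dots> = ennreal c * (\<integral>\<^sup>+u. ennreal (indicator E u *\<^sub>R \<bar>det (J u)\<bar>) \<partial>lborel)"
    using mJ unfolding set_borel_measurable_def by (intro nn_integral_cmult) auto
  also have "(\<integral>\<^sup>+u. ennreal (indicator E u *\<^sub>R \<bar>det (J u)\<bar>) \<partial>lborel) = (\<integral>\<^sup>+u\<in>E. ennreal \<bar>det (J u)\<bar> \<partial>lborel)"
    by (intro nn_integral_cong) (auto simp: indicator_def)
  also have "\<dots> = emeasure lborel (g ` E)"
    using E(2) by (intro emeasure_differentiable_image[symmetric] E derg inj gE_sets mJ) auto
  finally show "(\<integral>\<^sup>+u\<in>E. ennreal (sqrt (det (transpose (jacobian \<phi> (at u)) ** jacobian \<phi> (at u)))) \<partial>lborel)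
           = ennreal c * emeasure lborel (fst_block ` \<phi> ` E)"
    by (simp add: gE)
qed

text \<open>
  Existence: by the previous lemma a constant multiple of the push-forward of Lebesgue measure has
  the characteristic property in all local parametrisations. Uniqueness: the chart is itself a local
  parametrisation and covers the whole subspace, so the property for the chart alone determines the
  measure of every Borel set.
\<close>

lemma emeasure_induced_lebesgue_affine_subspace:
  fixes A :: "real^'m::finite^('d::finite option)"
  defines "c \<equiv> sqrt (det (transpose (chart_matrix A) ** chart_matrix A))"
  assumes S: "S \<in> sets borel"
  shows "emeasure (induced_lebesgue TYPE('d) (affine_subspace A)) (S \<inter> affine_subspace A)
           = ennreal c * emeasure lborel {x. affine_chart A x \<in> S}"
proof -
  let ?M = "affine_subspace A"
  define \<mu> where "\<mu> = scale_measure (ennreal c) (distr lborel (restrict_space borel ?M) (affine_chart A))"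
  define char where "char = (\<lambda>\<mu>. sets \<mu> = sets (restrict_space borel ?M) \<and>
        (\<forall>(U :: (real^'d) set) \<phi>. local_parametrisation ?M U \<phi> \<longrightarrow>
           (\<forall>E\<in>sets borel. E \<subseteq> U \<longrightarrow>
              emeasure \<mu> (\<phi> ` E) =
                (\<integral>\<^sup>+u\<in>E. ennreal (sqrt (det (transpose (jacobian \<phi> (at u)) ** jacobian \<phi> (at u))))
                   \<partial>lborel))))"
  have chart_meas: "affine_chart A \<in> borel_measurable lborel"
    by (simp add: borel_measurable_continuous_onI continuous_on_affine_chart)
  have fst_meas: "fst_block \<in> borel_measurable borel"
    by (simp add: borel_measurable_continuous_onI continuous_on_fst_block)
  have meas: "affine_chart A \<in> measurable lborel (restrict_space borel ?M)"
    by (intro measurable_restrict_space2 chart_meas) (auto simp: affine_subspace_eq_range)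
  have sets_image: "affine_chart A ` T \<in> sets (restrict_space borel ?M)" if "T \<in> sets borel" for T
  proof -
    have "fst_block -` T \<in> sets borel" using measurable_sets[OF fst_meas that] by simp
    moreover have "affine_chart A ` T = ?M \<inter> fst_block -` T"
      by (auto simp: affine_subspace_eq_range)
    ultimately show ?thesis unfolding sets_restrict_space by (rule image_eqI[rotated])
  qed
  have vimage_image: "affine_chart A -` affine_chart A ` T = T" for T
    by (rule inj_vimage_image_eq) (metis fst_block_affine_chart injI)
  have emu: "emeasure \<mu> (affine_chart A ` T) = ennreal c * emeasure lborel T" if "T \<in> sets borel" for T
    using emeasure_distr[OF meas sets_image[OF that]] by (simp add: \<mu>_def vimage_image)
  have "char \<mu>"
    unfolding char_def
  proof (intro conjI allI impI ballI)
    show "sets \<mu> = sets (restrict_space borel ?M)" by (simp add: \<mu>_def)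
  next
    fix U :: "(real^'d) set" and \<phi> E
    assume "local_parametrisation ?M U \<phi>" "E \<in> sets borel" "E \<subseteq> U"
    note * = emeasure_parametrised_affine_subspace[OF this]
    show "emeasure \<mu> (\<phi> ` E) = (\<integral>\<^sup>+u\<in>E. ennreal (sqrt (det (transpose (jacobian \<phi> (at u)) ** jacobian \<phi> (at u)))) \<partial>lborel)"
      unfolding *(3) c_def[symmetric] emu[OF *(2), symmetric] using *(1) by simp
  qed
  moreover have "\<nu> = \<mu>" if "char \<nu>" for \<nu>
  proof (rule measure_eqI)
    show sets: "sets \<nu> = sets \<mu>" using \<open>char \<mu>\<close> \<open>char \<nu>\<close> by (simp add: char_def)
    fix F assume "F \<in> sets \<nu>"
    then obtain B where B: "B \<in> sets borel" "F = ?M \<inter> B"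
      using \<open>char \<nu>\<close> by (auto simp: char_def sets_restrict_space)
    define T where "T = affine_chart A -` B"
    have T: "T \<in> sets borel" using measurable_sets[OF chart_meas B(1)] by (simp add: T_def)
    have F: "F = affine_chart A ` T" by (auto simp: B T_def affine_subspace_eq_range)
    have "emeasure \<rho> (affine_chart A ` T) = (\<integral>\<^sup>+u\<in>T. ennreal (sqrt (det (transpose (jacobian (affine_chart A) (at u)) ** jacobian (affine_chart A) (at u)))) \<partial>lborel)"
      if "char \<rho>" for \<rho>
      using that local_parametrisation_affine_chart[of A] T unfolding char_def by blast
    then show "emeasure \<nu> F = emeasure \<mu> F"
      using \<open>char \<mu>\<close> \<open>char \<nu>\<close> F by simp
  qed
  ultimately have "(THE \<mu>. char \<mu>) = \<mu>" by (rule the_equality)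
  then have "induced_lebesgue TYPE('d) ?M = \<mu>"
    by (simp add: induced_lebesgue_def char_def)
  moreover have "S \<inter> ?M = affine_chart A ` (affine_chart A -` S)"
    by (auto simp: affine_subspace_eq_range)
  moreover have "affine_chart A -` S \<in> sets borel"
    using measurable_sets[OF chart_meas S] by simp
  ultimately show ?thesis
    using emu by (simp add: vimage_def)
qed

section \<open>Distance to the integer vectors\<close>

lemma infnorm_le_iff: "infnorm (x :: real^'k) \<le> c \<longleftrightarrow> (\<forall>i. \<bar>x $ i\<bar> \<le> c)"
proof
  assume "infnorm x \<le> c"
  then show "\<forall>i. \<bar>x $ i\<bar> \<le> c" using component_le_infnorm_cart order_trans by blast
next
  assume *: "\<forall>i. \<bar>x $ i\<bar> \<le> c"
  show "infnorm x \<le> c"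
    unfolding infnorm_cart by (rule cSup_least) (use * in auto)
qed

lemma infnorm_less_iff: "infnorm (x :: real^'k) < c \<longleftrightarrow> (\<forall>i. \<bar>x $ i\<bar> < c)"
proof
  assume "infnorm x < c"
  then show "\<forall>i. \<bar>x $ i\<bar> < c" using component_le_infnorm_cart le_less_trans by blast
next
  assume *: "\<forall>i. \<bar>x $ i\<bar> < c"
  have "finite (range (\<lambda>i. \<bar>x $ i\<bar>))" by simp
  then have "Max (range (\<lambda>i. \<bar>x $ i\<bar>)) < c" using * by (subst Max_less_iff) auto
  moreover have "infnorm x \<le> Max (range (\<lambda>i. \<bar>x $ i\<bar>))"
    unfolding infnorm_le_iff by (intro allI Max_ge) auto
  ultimately show "infnorm x < c" by linarith
qed

lemma infnorm_diff_le: "infnorm (x - y) \<le> infnorm x + infnorm y"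
  for x y :: "'a::euclidean_space"
  using infnorm_triangle[of x "- y"] by (simp add: infnorm_neg)

lemma int_vecs_iff: "z \<in> int_vecs \<longleftrightarrow> (\<forall>i. z $ i \<in> \<int>)"
  by (simp add: int_vecs_def)

lemma int_vecs_0 [simp]: "0 \<in> int_vecs"
  and int_vecs_add: "z \<in> int_vecs \<Longrightarrow> w \<in> int_vecs \<Longrightarrow> z + w \<in> int_vecs"
  and int_vecs_diff: "z \<in> int_vecs \<Longrightarrow> w \<in> int_vecs \<Longrightarrow> z - w \<in> int_vecs"
  and int_vecs_minus: "z \<in> int_vecs \<Longrightarrow> - z \<in> int_vecs"
  and int_vecs_scaleR: "c \<in> \<int> \<Longrightarrow> z \<in> int_vecs \<Longrightarrow> c *\<^sub>R z \<in> int_vecs"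
  by (auto simp: int_vecs_iff)

lemma infnorm_int_vec_ge_1:
  fixes z :: "real^'k"
  assumes "z \<in> int_vecs" "z \<noteq> 0"
  shows "infnorm z \<ge> 1"
proof -
  obtain i where "z $ i \<noteq> 0" using assms(2) by (auto simp: vec_eq_iff)
  then have "\<bar>z $ i\<bar> \<ge> 1" using assms(1) Ints_nonzero_abs_ge1 by (auto simp: int_vecs_iff)
  then show ?thesis using component_le_infnorm_cart[of z i] by linarith
qed

lemma finite_int_vecs_bounded: "finite {z \<in> int_vecs :: (real^'k) set. infnorm z \<le> N}"
proof -
  have "{z \<in> int_vecs :: (real^'k) set. infnorm z \<le> N}
      \<subseteq> vec_lambda ` (PiE UNIV (\<lambda>_. {k \<in> \<int>. \<bar>k\<bar> \<le> N}))"
  proof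
    fix z :: "real^'k" assume "z \<in> {z \<in> int_vecs. infnorm z \<le> N}"
    then have "(\<lambda>i. z $ i) \<in> PiE UNIV (\<lambda>_. {k \<in> \<int>. \<bar>k\<bar> \<le> N})"
      by (auto simp: int_vecs_iff infnorm_le_iff)
    then show "z \<in> vec_lambda ` (PiE UNIV (\<lambda>_. {k \<in> \<int>. \<bar>k\<bar> \<le> N}))"
      by (rule image_eqI[rotated]) simp
  qed
  moreover have "finite (PiE UNIV (\<lambda>_ :: 'k. {k \<in> \<int> :: real set. \<bar>k\<bar> \<le> N}))"
    using finite_abs_int_segment by (intro finite_PiE) auto
  ultimately show ?thesis using finite_surj by blast
qed

lemma infinite_int_vecs: "infinite (int_vecs :: (real^'k) set)"
proof -
  have "inj (\<lambda>n::nat. (\<chi> i. real n) :: real^'k)" by (auto simp: inj_def vec_eq_iff)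
  moreover have "range (\<lambda>n::nat. (\<chi> i. real n) :: real^'k) \<subseteq> int_vecs" by (auto simp: int_vecs_iff)
  ultimately show ?thesis using finite_subset range_inj_infinite by blast
qed

lemma bdd_below_int_dist: "bdd_below ((\<lambda>z. infnorm (y - z)) ` int_vecs)"
  by (rule bdd_belowI[of _ 0]) (auto simp: infnorm_pos_le)

lemma int_dist_le: "z \<in> int_vecs \<Longrightarrow> int_dist y \<le> infnorm (y - z)"
  unfolding int_dist_def by (rule cINF_lower[OF bdd_below_int_dist])

lemma int_dist_round: "int_dist y = infnorm (y - (\<chi> i. of_int (round (y $ i))))"
proof (rule antisym)
  show "int_dist y \<le> infnorm (y - (\<chi> i. of_int (round (y $ i))))"
    by (rule int_dist_le) (simp add: int_vecs_iff)
  show "infnorm (y - (\<chi> i. of_int (round (y $ i)))) \<le> int_dist y"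
    unfolding int_dist_def
  proof (rule cINF_greatest)
    fix z :: "real^'a" assume "z \<in> int_vecs"
    show "infnorm (y - (\<chi> i. of_int (round (y $ i)))) \<le> infnorm (y - z)"
      unfolding infnorm_le_iff
    proof
      fix i
      obtain k where "z $ i = of_int k" using \<open>z \<in> int_vecs\<close> by (auto simp: int_vecs_iff elim: Ints_cases)
      then have "\<bar>y $ i - of_int (round (y $ i))\<bar> \<le> \<bar>y $ i - z $ i\<bar>"
        using round_diff_minimal by simp
      then show "\<bar>(y - (\<chi> i. of_int (round (y $ i)))) $ i\<bar> \<le> infnorm (y - z)"
        using component_le_infnorm_cart[of "y - z" i] by simp
    qed
  qed (use int_vecs_0 in blast)
qed

lemma int_dist_attained: obtains z where "z \<in> int_vecs" "infnorm (y - z) = int_dist y"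
  using that[of "\<chi> i. of_int (round (y $ i))"] by (simp add: int_dist_round int_vecs_iff)

lemma int_dist_nonneg: "int_dist y \<ge> 0"
  by (simp add: int_dist_round infnorm_pos_le)

lemma int_dist_le_half: "int_dist y \<le> 1 / 2"
  unfolding int_dist_round infnorm_le_iff using of_int_round_abs_le[where 'a = real]
  by (simp add: abs_minus_commute)

lemma int_dist_le_infnorm: "int_dist y \<le> infnorm y"
  using int_dist_le[OF int_vecs_0, of y] by simp

lemma int_dist_add_le: "int_dist (x + y) \<le> int_dist x + int_dist y"
proof -
  obtain z w where zw: "z \<in> int_vecs" "infnorm (x - z) = int_dist x"
      "w \<in> int_vecs" "infnorm (y - w) = int_dist y"
    by (metis int_dist_attained)
  then have "int_dist (x + y) \<le> infnorm ((x + y) - (z + w))"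
    by (intro int_dist_le int_vecs_add)
  also have "(x + y) - (z + w) = (x - z) + (y - w)" by simp
  also have "infnorm \<dots> \<le> int_dist x + int_dist y"
    using infnorm_triangle zw by metis
  finally show ?thesis .
qed

lemma int_dist_int_vec [simp]: "z \<in> int_vecs \<Longrightarrow> int_dist z = 0"
  using int_dist_le[of z z] int_dist_nonneg[of z] by (simp add: infnorm_0)

lemma int_dist_add_int_vec:
  assumes "z \<in> int_vecs"
  shows "int_dist (y + z) = int_dist y"
  using int_dist_add_le[of y z] int_dist_add_le[of "y + z" "- z"] assms
  by (simp add: int_vecs_minus)

lemma int_dist_uminus [simp]: "int_dist (- y) = int_dist y"
proof -
  have "int_dist (- y) \<le> int_dist y" for y :: "real^'a"
  proof -
    obtain z where z: "z \<in> int_vecs" "infnorm (y - z) = int_dist y" by (metis int_dist_attained)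
    then show ?thesis
      using int_dist_le[OF int_vecs_minus[OF z(1)], of "- y"] infnorm_neg[of "y - z"] by simp
  qed
  from this[of y] this[of "- y"] show ?thesis by simp
qed

lemma int_dist_scaleR_int_le:
  assumes "k \<in> \<int>"
  shows "int_dist (k *\<^sub>R y) \<le> \<bar>k\<bar> * int_dist y"
proof -
  obtain z where z: "z \<in> int_vecs" "infnorm (y - z) = int_dist y" by (metis int_dist_attained)
  then have "int_dist (k *\<^sub>R y) \<le> infnorm (k *\<^sub>R y - k *\<^sub>R z)"
    using assms by (intro int_dist_le int_vecs_scaleR)
  also have "\<dots> = \<bar>k\<bar> * int_dist y"
    using z by (simp add: infnorm_mul flip: scaleR_diff_right)
  finally show ?thesis .
qed

lemma lipschitz_int_dist: "\<bar>int_dist x - int_dist y\<bar> \<le> dist x y"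
proof -
  have "int_dist x - int_dist y \<le> norm (x - y)" for x y :: "real^'a"
    using int_dist_add_le[of y "x - y"] int_dist_le_infnorm[of "x - y"] infnorm_le_norm[of "x - y"] by simp
  from this[of x y] this[of y x] show ?thesis
    by (simp add: dist_norm norm_minus_commute abs_le_iff)
qed

lemma continuous_on_int_dist [continuous_intros]:
  assumes "continuous_on S f"
  shows "continuous_on S (\<lambda>x. int_dist (f x))"
proof -
  have "continuous_on UNIV int_dist"
    unfolding continuous_on_iff using lipschitz_int_dist by (metis dist_real_def le_less_trans)
  then show ?thesis using assms continuous_on_compose2 by blast
qed

lemma Borel_approx_set: "approx_set \<tau> \<theta> \<in> sets borel"
proof -
  have [measurable]: "(\<lambda>y. int_dist (real q *\<^sub>R y - \<theta>)) \<in> borel_measurable borel" for q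
    by (intro borel_measurable_continuous_onI continuous_intros)
  have "approx_set \<tau> \<theta> = {y \<in> space borel. \<forall>N. \<exists>q>N. int_dist (real q *\<^sub>R y - \<theta>) < real q powr (- \<tau>)}"
    by (auto simp: approx_set_def infinite_nat_iff_unbounded)
  also have "\<dots> \<in> sets borel" by measurable
  finally show ?thesis .
qed

section \<open>Lower bounds from the diophantine exponent\<close>

text \<open>
  The distance to the integer vectors is at most \<open>1/2\<close>, so the exponent \<open>w = 0\<close> always qualifies.
\<close>

lemma dioph_exponent_nonneg: "dioph_exponent B \<ge> 0"
proof -
  have "int_vecs - {0} \<subseteq> {q \<in> int_vecs. int_dist (B *v q) < infnorm q powr (- 0)}"
    using le_less_trans[OF int_dist_le_half] infnorm_eq_0 by (auto simp: powr_def)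
  moreover have "infinite (int_vecs - {0 :: real^'a})" using infinite_int_vecs by simp
  ultimately have "infinite {q \<in> int_vecs. int_dist (B *v q) < infnorm q powr (- 0)}"
    using infinite_super by blast
  then have "ereal 0 \<le> dioph_exponent B"
    unfolding dioph_exponent_def by (intro Sup_upper) auto
  then show ?thesis by (simp add: zero_ereal_def)
qed

text \<open>
  Beyond the exponent the opposite inequality can only fail finitely often. The exceptional vectors
  are absorbed into the constant: none of them has \<open>B z\<close> integral, because otherwise all multiples of
  \<open>z\<close> would be exceptional as well.
\<close>

lemma dioph_exponent_lower_bound:
  assumes less: "dioph_exponent B < ereal w" and w: "w > 0"
  obtains c where "c > 0" "\<And>z. z \<in> int_vecs \<Longrightarrow> z \<noteq> 0 \<Longrightarrow> c * infnorm z powr (- w) \<le> int_dist (B *v z)"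
proof -
  define S where "S = {z \<in> int_vecs. int_dist (B *v z) < infnorm z powr (- w)}"
  have fin: "finite S"
  proof (rule ccontr)
    assume "infinite S"
    then have "ereal w \<le> dioph_exponent B"
      unfolding dioph_exponent_def S_def by (intro Sup_upper) auto
    then show False using less by simp
  qed
  have pos: "int_dist (B *v z) > 0" if z: "z \<in> int_vecs" "z \<noteq> 0" for z
  proof (rule ccontr)
    assume "\<not> int_dist (B *v z) > 0"
    then have 0: "int_dist (B *v z) = 0" using int_dist_nonneg[of "B *v z"] by linarith
    have "inj (\<lambda>k::nat. real (Suc k) *\<^sub>R z)" using z(2) by (auto simp: inj_def)
    moreover have "range (\<lambda>k::nat. real (Suc k) *\<^sub>R z) \<subseteq> S"
    proof safe
      fix k :: nat
      have "int_dist (B *v (real (Suc k) *\<^sub>R z)) \<le> 0"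
        using int_dist_scaleR_int_le[of "real (Suc k)" "B *v z"] 0
        by (simp add: scaleR_matrix_vector_assoc matrix_scaleR_vector_ac)
      also have "0 < infnorm (real (Suc k) *\<^sub>R z) powr (- w)"
        using z(2) infnorm_eq_0[of z] by (simp add: infnorm_mul)
      finally show "real (Suc k) *\<^sub>R z \<in> S"
        using int_vecs_scaleR[of "real (Suc k)" z] z(1) by (simp add: S_def del: of_nat_Suc)
    qed
    ultimately show False using fin finite_subset range_inj_infinite by blast
  qed
  define X where "X = insert 1 ((\<lambda>z. int_dist (B *v z) * infnorm z powr w) ` (S - {0}))"
  have X: "finite X" "X \<noteq> {}" using fin by (auto simp: X_def)
  have "\<forall>x\<in>X. x > 0"
  proof
    fix x assume "x \<in> X"
    then consider "x = 1" | z where "z \<in> S" "z \<noteq> 0" "x = int_dist (B *v z) * infnorm z powr w"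
      by (auto simp: X_def)
    then show "x > 0"
    proof cases
      case 2
      then show ?thesis using pos[of z] infnorm_eq_0[of z] by (simp add: S_def)
    qed simp
  qed
  then have "Min X > 0" using X by simp
  moreover have "Min X * infnorm z powr (- w) \<le> int_dist (B *v z)" if z: "z \<in> int_vecs" "z \<noteq> 0" for z
  proof -
    have nz: "infnorm z > 0" using z(2) by (simp add: infnorm_pos_lt)
    show ?thesis
    proof (cases "z \<in> S")
      case True
      then have "Min X \<le> int_dist (B *v z) * infnorm z powr w"
        using z(2) X by (intro Min_le) (auto simp: X_def)
      then show ?thesis using nz by (simp add: powr_minus field_simps)
    next
      case False
      have "Min X \<le> 1" using X by (intro Min_le) (auto simp: X_def)
      then have "Min X * infnorm z powr (- w) \<le> infnorm z powr (- w)"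
        using mult_right_mono[of "Min X" 1 "infnorm z powr (- w)"] by simp
      then show ?thesis using False z(1) by (auto simp: S_def)
    qed
  qed
  ultimately show ?thesis by (rule that)
qed

text \<open>
  The integer points of a box at which the linear map \<open>z \<mapsto> z A\<close> is almost integral: they are the
  first components of the points of the lattice of all \<open>(z, z A - r)\<close> with \<open>|z| \<le> N\<close> and \<open>|z A - r| \<le> \<delta>\<close>.
\<close>

definition near_vecs :: "real^'m^'k \<Rightarrow> real \<Rightarrow> real \<Rightarrow> (real^'k) set" where
  "near_vecs A N \<delta> = {z \<in> int_vecs. infnorm z \<le> N \<and> int_dist (z v* A) \<le> \<delta>}"

lemma finite_near_vecs [simp]: "finite (near_vecs A N \<delta>)"
  unfolding near_vecs_def by (rule finite_subset[OF _ finite_int_vecs_bounded[of N]]) auto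

lemma abs_inner_le_infnorm: "\<bar>x \<bullet> y\<bar> \<le> real CARD('k) * (infnorm x * infnorm y)" for x y :: "real^'k"
proof -
  have "\<bar>x \<bullet> y\<bar> \<le> (\<Sum>i\<in>UNIV. \<bar>x $ i\<bar> * \<bar>y $ i\<bar>)"
    by (simp add: inner_vec_def flip: abs_mult)
  also have "\<dots> \<le> (\<Sum>i\<in>(UNIV :: 'k set). infnorm x * infnorm y)"
    by (intro sum_mono mult_mono component_le_infnorm_cart) (auto simp: infnorm_pos_le)
  finally show ?thesis by simp
qed

lemma inner_int_vecs: "x \<in> int_vecs \<Longrightarrow> y \<in> int_vecs \<Longrightarrow> x \<bullet> y \<in> \<int>"
  by (auto simp: inner_vec_def int_vecs_iff)

section \<open>Null sets by Borel-Cantelli\<close>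

lemma infnorm_vector_matrix_mult_le:
  fixes A :: "real^'m^'k"
  shows "infnorm (x v* A) \<le> (\<Sum>i\<in>UNIV. \<Sum>j\<in>UNIV. \<bar>A $ i $ j\<bar>) * infnorm x"
  unfolding infnorm_le_iff
proof
  fix j
  have "\<bar>(x v* A) $ j\<bar> \<le> (\<Sum>i\<in>UNIV. \<bar>A $ i $ j * x $ i\<bar>)"
    by (simp add: vector_matrix_mult_def mult.commute)
  also have "\<dots> \<le> (\<Sum>i\<in>UNIV. (\<Sum>j\<in>UNIV. \<bar>A $ i $ j\<bar>) * infnorm x)"
  proof (rule sum_mono)
    fix i
    have "\<bar>A $ i $ j\<bar> \<le> (\<Sum>j\<in>UNIV. \<bar>A $ i $ j\<bar>)" by (rule member_le_sum) auto
    then show "\<bar>A $ i $ j * x $ i\<bar> \<le> (\<Sum>j\<in>UNIV. \<bar>A $ i $ j\<bar>) * infnorm x"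
      unfolding abs_mult by (intro mult_mono component_le_infnorm_cart sum_nonneg) auto
  qed
  finally show "\<bar>(x v* A) $ j\<bar> \<le> (\<Sum>i\<in>UNIV. \<Sum>j\<in>UNIV. \<bar>A $ i $ j\<bar>) * infnorm x"
    by (simp add: sum_distrib_right)
qed

text \<open>
  Subtracting a fixed element embeds a set of solutions of an inhomogeneous problem into the solutions
  of the homogeneous one.
\<close>

lemma card_le_near_vecs:
  assumes P: "P \<subseteq> int_vecs"
    and diff: "\<And>z z'. z \<in> P \<Longrightarrow> z' \<in> P \<Longrightarrow> infnorm (z - z') \<le> N \<and> int_dist ((z - z') v* A) \<le> \<delta>"
  shows "finite P" "card P \<le> card (near_vecs A N \<delta>)"
proof -
  have "finite P \<and> card P \<le> card (near_vecs A N \<delta>)"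
  proof (cases "P = {}")
    case False
    then obtain z0 where z0: "z0 \<in> P" by auto
    have sub: "(\<lambda>z. z - z0) ` P \<subseteq> near_vecs A N \<delta>"
      using P z0 diff by (auto simp: near_vecs_def intro!: int_vecs_diff)
    have inj: "inj_on (\<lambda>z. z - z0) P" by (simp add: inj_on_def)
    from finite_subset[OF sub] inj have "finite P" by (simp add: finite_image_iff)
    then show ?thesis using card_inj_on_le[OF inj sub] by simp
  qed simp
  then show "finite P" "card P \<le> card (near_vecs A N \<delta>)" by auto
qed

lemma measure_inf_cball:
  fixes c :: "real^'d"
  assumes "r \<ge> 0"
  shows "measure lborel (cbox (c - (\<chi> i. r)) (c + (\<chi> i. r))) = (2 * r) ^ CARD('d)"
proof -
  have "c \<in> cbox (c - (\<chi> i. r)) (c + (\<chi> i. r))" using assms by (simp add: mem_box_cart)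
  then have "cbox (c - (\<chi> i. r)) (c + (\<chi> i. r)) \<noteq> {}" by auto
  then show ?thesis by (subst content_cbox_cart) auto
qed

lemma infnorm_tilde_le: "infnorm x \<le> R \<Longrightarrow> 1 \<le> R \<Longrightarrow> infnorm (tilde x) \<le> R"
  unfolding infnorm_le_iff by (auto simp: tilde_def split: option.splits)

text \<open>
  For \<open>2\<^sup>k \<le> q < 2\<^bsup>k+1\<^esup>\<close> the parameters approximated with denominator \<open>q\<close> are covered by cubes of
  side of order \<open>2\<^bsup>-k(\<tau>+1)\<^esup>\<close>, one for each \<open>z = (q, p)\<close> that is close to \<open>q (1, x)\<close> up to a shift and
  for which \<open>z A\<close> is close to a fixed point modulo integers. With at most a constant times
  \<open>2\<^bsup>k\<gamma>\<^esup>\<close> cubes the total measure is of order \<open>2\<^bsup>k(\<gamma> - d(\<tau>+1))\<^esup>\<close>, which is summable.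
\<close>

lemma null_set_of_near_vecs_count:
  fixes A :: "real^'m::finite^('d::finite option)"
  assumes \<tau>: "\<tau> > -1" and \<gamma>: "\<gamma> < real CARD('d) * (\<tau> + 1)"
    and count: "\<And>C. C > 0 \<Longrightarrow> \<exists>M. \<forall>Q\<ge>1. real (card (near_vecs A (C * Q) (C * Q powr (- \<tau>)))) \<le> M * Q powr \<gamma>"
  shows "{x. affine_chart A x \<in> approx_set \<tau> \<theta>} \<in> null_sets lborel"
proof -
  let ?d = "CARD('d)"
  define \<theta>\<^sub>1 :: "real^('d option)" where "\<theta>\<^sub>1 = (\<chi> i. case i of None \<Rightarrow> 0 | Some i \<Rightarrow> \<theta> $ Inl i)"
  define \<theta>\<^sub>2 :: "real^'m" where "\<theta>\<^sub>2 = (\<chi> j. \<theta> $ Inr j)"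
  define K where "K = (\<Sum>i\<in>UNIV. \<Sum>j\<in>UNIV. \<bar>A $ i $ j\<bar>)"
  have K: "infnorm (v v* A) \<le> K * infnorm v" for v
    unfolding K_def by (rule infnorm_vector_matrix_mult_le)
  have K0: "K \<ge> 0" by (auto simp: K_def intro!: sum_nonneg)
  \<comment> \<open>The factor \<open>C\<^sub>0\<close> makes \<open>\<delta> k\<close> a bound for \<open>q powr (- \<tau>)\<close> on the whole dyadic range,
    whatever the sign of \<open>\<tau>\<close>.\<close>
  define C\<^sub>0 where "C\<^sub>0 = 2 powr \<bar>\<tau>\<bar>"
  have C0: "C\<^sub>0 > 0" by (simp add: C\<^sub>0_def)
  define \<delta> where "\<delta> = (\<lambda>k::nat. C\<^sub>0 * (2 ^ k) powr (- \<tau>))"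
  have \<delta>0: "\<delta> k > 0" for k using C0 by (simp add: \<delta>_def)
  have \<delta>_le: "\<delta> k \<le> C\<^sub>0 * 2 ^ k" for k
  proof -
    have "(2 ^ k) powr (- \<tau>) \<le> (2 ^ k :: real) powr 1" using \<tau> by (intro powr_mono) auto
    then show ?thesis using C0 by (simp add: \<delta>_def)
  qed
  have q_bound: "real q powr (- \<tau>) \<le> \<delta> k" if q: "2 ^ k \<le> q" "q < 2 ^ Suc k" for q k :: nat
  proof -
    have q': "2 ^ k \<le> real q" "real q \<le> 2 * 2 ^ k"
      using q by (metis of_nat_le_iff of_nat_numeral of_nat_power, metis less_imp_le of_nat_le_iff of_nat_numeral of_nat_power power_Suc)
    have "real q / 2 ^ k \<ge> 1" "real q / 2 ^ k \<le> 2" using q' by (auto simp: field_simps)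
    then have "(real q / 2 ^ k) powr (- \<tau>) \<le> (real q / 2 ^ k) powr \<bar>\<tau>\<bar>"
      by (intro powr_mono) auto
    also have "\<dots> \<le> C\<^sub>0"
      unfolding C\<^sub>0_def using \<open>real q / 2 ^ k \<ge> 1\<close> \<open>real q / 2 ^ k \<le> 2\<close> by (intro powr_mono2) auto
    finally have "(real q / 2 ^ k) powr (- \<tau>) * (2 ^ k) powr (- \<tau>) \<le> \<delta> k"
      unfolding \<delta>_def by (intro mult_right_mono) auto
    then show ?thesis by (simp flip: powr_mult)
  qed
  have null: "{x. infnorm x \<le> R \<and> affine_chart A x \<in> approx_set \<tau> \<theta>} \<in> null_sets lborel" if R: "R \<ge> 1" for R
  proof -
    \<comment> \<open>\<open>P k\<close> collects the vectors \<open>z\<close> of level \<open>k\<close>; \<open>e\<close> and \<open>f\<close> are the errors in the first \<open>d\<close> and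
      the last \<open>m\<close> coordinates, and \<open>r\<close> is the integer vector near the last coordinates.\<close>
    define P where "P = (\<lambda>k. {z \<in> int_vecs. 2 ^ k \<le> z $ None \<and> z $ None < 2 * 2 ^ k \<and>
        (\<exists>x e f r. infnorm x \<le> R \<and> infnorm e \<le> \<delta> k \<and> infnorm f \<le> \<delta> k \<and> r \<in> int_vecs \<and>
           z = z $ None *\<^sub>R tilde x - \<theta>\<^sub>1 + e \<and> z v* A = f + \<theta>\<^sub>2 + r + (e - \<theta>\<^sub>1) v* A)})"
    define center where "center = (\<lambda>z :: real^('d option). \<chi> i. (z $ Some i + \<theta> $ Inl i) / z $ None)"
    define \<rho> where "\<rho> = (\<lambda>k. \<delta> k / 2 ^ k)"
    have \<rho>0: "\<rho> k \<ge> 0" for k using \<delta>0[of k] by (simp add: \<rho>_def)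
    define G where "G = (\<lambda>k. \<Union>z\<in>P k. cbox (center z - (\<chi> i. \<rho> k)) (center z + (\<chi> i. \<rho> k)))"
    define C where "C = 4 * R + 2 * C\<^sub>0 + 2 * C\<^sub>0 * (1 + K)"
    have C: "C > 0" "2 * C\<^sub>0 * (1 + K) \<le> C" "4 * R + 2 * C\<^sub>0 \<le> C"
      using R C0 K0 by (auto simp: C_def intro!: add_pos_nonneg)
    \<comment> \<open>In differences of elements of \<open>P k\<close> the shifts \<open>\<theta>\<^sub>1\<close> and \<open>\<theta>\<^sub>2\<close> cancel.\<close>
    have diff: "infnorm (z - z') \<le> C * 2 ^ k \<and> int_dist ((z - z') v* A) \<le> C * (2 ^ k) powr (- \<tau>)"
      if z: "z \<in> P k" and z': "z' \<in> P k" for z z' k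
    proof -
      from z obtain x e f r where 1: "infnorm x \<le> R" "infnorm e \<le> \<delta> k" "infnorm f \<le> \<delta> k" "r \<in> int_vecs"
        "z = z $ None *\<^sub>R tilde x - \<theta>\<^sub>1 + e" "z v* A = f + \<theta>\<^sub>2 + r + (e - \<theta>\<^sub>1) v* A"
        "0 \<le> z $ None" "z $ None \<le> 2 * 2 ^ k"
        unfolding P_def by (auto intro: order_trans[rotated])
      from z' obtain x' e' f' r' where 2: "infnorm x' \<le> R" "infnorm e' \<le> \<delta> k" "infnorm f' \<le> \<delta> k" "r' \<in> int_vecs"
        "z' = z' $ None *\<^sub>R tilde x' - \<theta>\<^sub>1 + e'" "z' v* A = f' + \<theta>\<^sub>2 + r' + (e' - \<theta>\<^sub>1) v* A"
        "0 \<le> z' $ None" "z' $ None \<le> 2 * 2 ^ k"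
        unfolding P_def by (auto intro: order_trans[rotated])
      have b: "infnorm (z $ None *\<^sub>R tilde x) \<le> 2 * 2 ^ k * R"
        using 1 R infnorm_tilde_le[of x R] by (auto simp: infnorm_mul infnorm_pos_le intro!: mult_mono)
      have b': "infnorm (z' $ None *\<^sub>R tilde x') \<le> 2 * 2 ^ k * R"
        using 2 R infnorm_tilde_le[of x' R] by (auto simp: infnorm_mul infnorm_pos_le intro!: mult_mono)
      have "z - z' = (z $ None *\<^sub>R tilde x - z' $ None *\<^sub>R tilde x') + (e - e')"
        by (subst 1(5), subst 2(5)) simp
      also have "infnorm \<dots> \<le> infnorm (z $ None *\<^sub>R tilde x) + infnorm (z' $ None *\<^sub>R tilde x') + (infnorm e + infnorm e')"
        by (rule order_trans[OF infnorm_triangle add_mono[OF infnorm_diff_le infnorm_diff_le]])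
      also have "\<dots> \<le> 2 * 2 ^ k * R + 2 * 2 ^ k * R + (C\<^sub>0 * 2 ^ k + C\<^sub>0 * 2 ^ k)"
        using b b' 1 2 \<delta>_le[of k] by (intro add_mono) auto
      also have "\<dots> = (4 * R + 2 * C\<^sub>0) * 2 ^ k" by (simp add: algebra_simps)
      also have "\<dots> \<le> C * 2 ^ k" using C by (intro mult_right_mono) auto
      finally have first: "infnorm (z - z') \<le> C * 2 ^ k" .
      have "(z - z') v* A = ((f - f') + (e - e') v* A) + (r - r')"
        by (simp add: vector_matrix_mult_diff_distrib 1(6) 2(6))
      then have "int_dist ((z - z') v* A) = int_dist ((f - f') + (e - e') v* A)"
        using 1 2 by (simp add: int_dist_add_int_vec int_vecs_diff)
      also have "\<dots> \<le> infnorm (f - f') + infnorm ((e - e') v* A)"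
        using int_dist_le_infnorm infnorm_triangle order_trans by blast
      also have "\<dots> \<le> (\<delta> k + \<delta> k) + K * (\<delta> k + \<delta> k)"
      proof (intro add_mono)
        show "infnorm (f - f') \<le> \<delta> k + \<delta> k" using infnorm_diff_le[of f f'] 1 2 by linarith
        have "infnorm (e - e') \<le> \<delta> k + \<delta> k" using infnorm_diff_le[of e e'] 1 2 by linarith
        then show "infnorm ((e - e') v* A) \<le> K * (\<delta> k + \<delta> k)"
          using K[of "e - e'"] K0 mult_left_mono order_trans by blast
      qed
      also have "\<dots> = (2 * C\<^sub>0 * (1 + K)) * (2 ^ k) powr (- \<tau>)" by (simp add: \<delta>_def algebra_simps)
      also have "\<dots> \<le> C * (2 ^ k) powr (- \<tau>)" using C by (intro mult_right_mono) auto
      finally show ?thesis using first by simp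
    qed
    from count[OF C(1)] obtain M where M: "\<And>Q. Q \<ge> 1 \<Longrightarrow> real (card (near_vecs A (C * Q) (C * Q powr (- \<tau>)))) \<le> M * Q powr \<gamma>"
      by blast
    have P_sub: "P k \<subseteq> int_vecs" for k by (auto simp: P_def)
    have finP: "finite (P k)" for k by (rule card_le_near_vecs(1)[OF P_sub diff])
    have cardP: "real (card (P k)) \<le> M * (2 ^ k) powr \<gamma>" for k
    proof -
      have "card (P k) \<le> card (near_vecs A (C * 2 ^ k) (C * (2 ^ k) powr (- \<tau>)))"
        by (rule card_le_near_vecs(2)[OF P_sub diff])
      then show ?thesis using M[of "2 ^ k"] by (meson of_nat_le_iff one_le_power one_le_numeral order_trans)
    qed
    have Gm: "G k \<in> sets lborel" for k
      unfolding G_def using finP by (intro sets.finite_UN) auto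
    have Gfin: "emeasure lborel (G k) < \<infinity>" for k
    proof -
      have "bounded (G k)" unfolding G_def using finP by (intro bounded_UN) auto
      then show ?thesis by (rule emeasure_bounded_finite)
    qed
    define s where "s = 2 powr (\<gamma> - real ?d * (\<tau> + 1))"
    have s: "0 < s" "s < 1" using \<gamma> by (auto simp: s_def powr_less_one)
    have meas: "measure lborel (G k) \<le> M * (2 * C\<^sub>0) ^ ?d * s ^ k" for k
    proof -
      have "measure lborel (G k) \<le> (\<Sum>z\<in>P k. measure lborel (cbox (center z - (\<chi> i. \<rho> k)) (center z + (\<chi> i. \<rho> k))))"
        unfolding G_def using finP by (intro measure_UNION_le) auto
      also have "\<dots> = real (card (P k)) * (2 * \<rho> k) ^ ?d"
        using \<rho>0[of k] by (simp add: measure_inf_cball)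
      also have "\<dots> \<le> M * (2 ^ k) powr \<gamma> * (2 * \<rho> k) ^ ?d"
        using cardP \<rho>0[of k] by (intro mult_right_mono) auto
      also have "\<rho> k = C\<^sub>0 * (2 ^ k) powr (- (\<tau> + 1))"
        by (simp add: \<rho>_def \<delta>_def powr_diff powr_minus field_simps powr_add)
      also have "(2 * (C\<^sub>0 * (2 ^ k) powr (- (\<tau> + 1)))) ^ ?d = (2 * C\<^sub>0) ^ ?d * (2 ^ k) powr (- (\<tau> + 1) * real ?d)"
        by (simp add: power_mult_distrib powr_powr[symmetric] powr_realpow)
      also have "M * (2 ^ k) powr \<gamma> * ((2 * C\<^sub>0) ^ ?d * (2 ^ k) powr (- (\<tau> + 1) * real ?d))
          = M * (2 * C\<^sub>0) ^ ?d * ((2 ^ k) powr \<gamma> * (2 ^ k) powr (- (\<tau> + 1) * real ?d))"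
        by (simp add: mult_ac)
      also have "(2 ^ k) powr \<gamma> * (2 ^ k) powr (- (\<tau> + 1) * real ?d) = s ^ k"
      proof -
        have "(2 ^ k :: real) = 2 powr real k" by (simp add: powr_realpow)
        then have "(2 ^ k) powr \<gamma> * (2 ^ k) powr (- (\<tau> + 1) * real ?d) = 2 powr (real k * (\<gamma> - real ?d * (\<tau> + 1)))"
          by (simp add: powr_powr flip: powr_add) (simp add: algebra_simps)
        also have "\<dots> = s powr real k" by (simp add: s_def powr_powr mult.commute)
        also have "\<dots> = s ^ k" using s by (simp add: powr_realpow)
        finally show ?thesis .
      qed
      finally show ?thesis .
    qed
    have "summable (\<lambda>k. measure lborel (G k))"
    proof (rule summable_comparison_test')
      show "summable (\<lambda>k. M * (2 * C\<^sub>0) ^ ?d * s ^ k)" using s by (intro summable_mult summable_geometric) auto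
      show "norm (measure lborel (G k)) \<le> M * (2 * C\<^sub>0) ^ ?d * s ^ k" if "k \<ge> 0" for k
        using meas by simp
    qed
    with Gm Gfin have lim: "limsup G \<in> null_sets lborel" by (intro borel_cantelli_limsup1)
    have "{x. infnorm x \<le> R \<and> affine_chart A x \<in> approx_set \<tau> \<theta>} \<subseteq> limsup G"
    proof clarify
      fix x :: "real^'d" assume x: "infnorm x \<le> R" "affine_chart A x \<in> approx_set \<tau> \<theta>"
      have "\<exists>k\<ge>n. x \<in> G k" for n
      proof -
        obtain q where q: "q > 2 ^ n" "int_dist (real q *\<^sub>R affine_chart A x - \<theta>) < real q powr (- \<tau>)"
          using x(2) by (auto simp: approx_set_def infinite_nat_iff_unbounded)
        obtain k where k: "2 ^ k \<le> q" "q < 2 ^ Suc k"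
          using ex_power_ivl1[of 2 q] q(1) by (auto)
        have "k \<ge> n"
        proof (rule ccontr)
          assume "\<not> k \<ge> n"
          then have "(2::nat) ^ Suc k \<le> 2 ^ n" by (intro power_increasing) auto
          then show False using k q by linarith
        qed
        obtain v where v: "v \<in> int_vecs" "infnorm (real q *\<^sub>R affine_chart A x - \<theta> - v) = int_dist (real q *\<^sub>R affine_chart A x - \<theta>)"
          by (rule int_dist_attained)
        have v_le: "\<bar>(real q *\<^sub>R affine_chart A x - \<theta> - v) $ l\<bar> \<le> \<delta> k" for l
          using component_le_infnorm_cart[of "real q *\<^sub>R affine_chart A x - \<theta> - v" l] v q q_bound[OF k] by linarith
        define z :: "real^('d option)" where "z = (\<chi> i. case i of None \<Rightarrow> real q | Some i \<Rightarrow> v $ Inl i)"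
        define e where "e = z - real q *\<^sub>R tilde x + \<theta>\<^sub>1"
        define r :: "real^'m" where "r = (\<chi> j. v $ Inr j)"
        define f where "f = real q *\<^sub>R (tilde x v* A) - \<theta>\<^sub>2 - r"
        have zN: "z $ None = real q" by (simp add: z_def)
        have e_Some: "e $ Some i = - (real q *\<^sub>R affine_chart A x - \<theta> - v) $ Inl i" for i
          by (simp add: e_def z_def \<theta>\<^sub>1_def tilde_def)
        have e: "infnorm e \<le> \<delta> k"
          unfolding infnorm_le_iff
        proof
          fix i show "\<bar>e $ i\<bar> \<le> \<delta> k"
          proof (cases i)
            case None
            then show ?thesis using \<delta>0[of k] by (simp add: e_def z_def \<theta>\<^sub>1_def tilde_def)
          next
            case (Some i)
            then show ?thesis using v_le[of "Inl i"] e_Some[of i] by (simp add: abs_minus_commute)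
          qed
        qed
        have f: "infnorm f \<le> \<delta> k"
          unfolding infnorm_le_iff
        proof
          fix j
          have "f $ j = (real q *\<^sub>R affine_chart A x - \<theta> - v) $ Inr j"
            by (simp add: f_def \<theta>\<^sub>2_def r_def affine_chart_def)
          then show "\<bar>f $ j\<bar> \<le> \<delta> k" using v_le[of "Inr j"] by simp
        qed
        have zint: "z \<in> int_vecs" and r: "r \<in> int_vecs"
          using v(1) by (auto simp: int_vecs_iff z_def r_def split: option.splits)
        have "z v* A = (real q *\<^sub>R tilde x) v* A + (e - \<theta>\<^sub>1) v* A"
          by (simp add: e_def flip: vector_matrix_left_distrib)
        also have "(real q *\<^sub>R tilde x) v* A = f + \<theta>\<^sub>2 + r"
          by (simp add: f_def vector_matrix_mult_def vec_eq_iff sum_distrib_left mult_ac)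
        finally have zA: "z v* A = f + \<theta>\<^sub>2 + r + (e - \<theta>\<^sub>1) v* A" .
        have "z = z $ None *\<^sub>R tilde x - \<theta>\<^sub>1 + e" by (simp add: zN e_def)
        moreover have "2 ^ k \<le> z $ None \<and> z $ None < 2 * 2 ^ k"
          unfolding zN using k by (metis of_nat_le_iff of_nat_less_iff of_nat_numeral of_nat_power power_Suc)
        ultimately have zP: "z \<in> P k"
          unfolding P_def using x(1) e f r zint zA by blast
        have "\<bar>x $ i - center z $ i\<bar> \<le> \<rho> k" for i
        proof -
          have q0: "real q \<ge> 2 ^ k" using k by (metis of_nat_le_iff of_nat_numeral of_nat_power)
          then have qpos: "real q > 0" by (meson less_le_trans zero_less_numeral zero_less_power)
          have "x $ i - center z $ i = - (e $ Some i) / real q"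
            using qpos by (simp add: center_def zN e_def z_def \<theta>\<^sub>1_def tilde_def field_simps)
          then have "\<bar>x $ i - center z $ i\<bar> = \<bar>e $ Some i\<bar> / real q" using qpos by simp
          also have "\<dots> \<le> \<delta> k / 2 ^ k"
            using e q0 \<delta>0[of k] by (intro frac_le) (auto simp: infnorm_le_iff)
          finally show ?thesis by (simp add: \<rho>_def)
        qed
        then have "x \<in> cbox (center z - (\<chi> i. \<rho> k)) (center z + (\<chi> i. \<rho> k))"
          by (auto simp: mem_box_cart abs_le_iff algebra_simps)
        then have "x \<in> G k" using zP by (auto simp: G_def)
        then show ?thesis using \<open>k \<ge> n\<close> by blast
      qed
      then show "x \<in> limsup G" by (auto simp: limsup_INF_SUP)
    qed
    moreover have "{x. infnorm x \<le> R \<and> affine_chart A x \<in> approx_set \<tau> \<theta>} \<in> sets lborel"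
    proof -
      have [measurable]: "affine_chart A \<in> borel_measurable borel" "infnorm \<in> borel_measurable (borel :: (real^'d) measure)"
        by (intro borel_measurable_continuous_onI continuous_intros)+
      note Borel_approx_set[measurable]
      have "{x \<in> space borel. infnorm x \<le> R \<and> affine_chart A x \<in> approx_set \<tau> \<theta>} \<in> sets borel"
        by measurable
      then show ?thesis by simp
    qed
    ultimately show ?thesis using lim null_sets_subset by blast
  qed
  have "{x. affine_chart A x \<in> approx_set \<tau> \<theta>} = (\<Union>n::nat. {x. infnorm x \<le> real (Suc n) \<and> affine_chart A x \<in> approx_set \<tau> \<theta>})"
  proof safe
    fix x :: "real^'d" assume "affine_chart A x \<in> approx_set \<tau> \<theta>"
    moreover obtain n where "infnorm x \<le> real n" using real_arch_simple by blast
    ultimately show "x \<in> (\<Union>n. {x. infnorm x \<le> real (Suc n) \<and> affine_chart A x \<in> approx_set \<tau> \<theta>})"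
      by (intro UN_I[of n]) auto
  qed
  also have "\<dots> \<in> null_sets lborel"
    by (intro null_sets_UN null) auto
  finally show ?thesis .
qed

section \<open>Counting by the box and by packing\<close>

lemma card_near_vecs_le_box:
  fixes A :: "real^'m^'k"
  assumes "N \<ge> 0"
  shows "real (card (near_vecs A N \<delta>)) \<le> (2 * N + 1) ^ CARD('k)"
proof -
  let ?key = "\<lambda>(z :: real^'k) i. \<lfloor>z $ i\<rfloor>"
  let ?T = "PiE (UNIV :: 'k set) (\<lambda>_. {-\<lfloor>N\<rfloor>..\<lfloor>N\<rfloor>})"
  have inj: "inj_on ?key (near_vecs A N \<delta>)"
  proof (rule inj_onI)
    fix z z' assume "z \<in> near_vecs A N \<delta>" "z' \<in> near_vecs A N \<delta>" and eq: "?key z = ?key z'"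
    then have "z $ i = of_int \<lfloor>z $ i\<rfloor>" "z' $ i = of_int \<lfloor>z' $ i\<rfloor>" for i
      by (auto simp: near_vecs_def int_vecs_iff)
    then show "z = z'" using eq by (metis vec_eq_iff)
  qed
  have "?key ` near_vecs A N \<delta> \<subseteq> ?T"
  proof (rule image_subsetI)
    fix z assume z: "z \<in> near_vecs A N \<delta>"
    have "\<lfloor>z $ i\<rfloor> \<in> {-\<lfloor>N\<rfloor>..\<lfloor>N\<rfloor>}" for i
    proof -
      have "z $ i = of_int \<lfloor>z $ i\<rfloor>" "\<bar>z $ i\<bar> \<le> N"
        using z by (auto simp: near_vecs_def int_vecs_iff infnorm_le_iff)
      then have "of_int \<lfloor>z $ i\<rfloor> \<le> N" "of_int (- \<lfloor>z $ i\<rfloor>) \<le> N" by (auto simp: abs_le_iff)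
      then have "\<lfloor>z $ i\<rfloor> \<le> \<lfloor>N\<rfloor>" "- \<lfloor>z $ i\<rfloor> \<le> \<lfloor>N\<rfloor>" by (simp_all only: le_floor_iff)
      then show ?thesis by auto
    qed
    then show "?key z \<in> ?T" by auto
  qed
  then have "card (near_vecs A N \<delta>) \<le> card ?T"
    by (intro card_inj_on_le[OF inj]) (auto intro: finite_PiE)
  also have "card ?T = nat (2 * \<lfloor>N\<rfloor> + 1) ^ CARD('k)"
    by (simp add: card_PiE)
  finally have "real (card (near_vecs A N \<delta>)) \<le> real (nat (2 * \<lfloor>N\<rfloor> + 1)) ^ CARD('k)"
    by (metis of_nat_le_iff of_nat_power)
  also have "\<dots> \<le> (2 * N + 1) ^ CARD('k)"
  proof (rule power_mono)
    have "real (nat (2 * \<lfloor>N\<rfloor> + 1)) = 2 * of_int \<lfloor>N\<rfloor> + 1" using assms by simp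
    then show "real (nat (2 * \<lfloor>N\<rfloor> + 1)) \<le> 2 * N + 1" using of_int_floor_le[of N] by linarith
  qed simp
  finally show ?thesis .
qed

lemma near_vecs_count_trivial:
  fixes A :: "real^'m^'k"
  assumes C: "C > 0"
  shows "\<exists>M. \<forall>Q\<ge>1. real (card (near_vecs A (C * Q) (C * Q powr (- \<tau>)))) \<le> M * Q powr real CARD('k)"
proof (intro exI allI impI)
  fix Q :: real assume Q: "Q \<ge> 1"
  have "real (card (near_vecs A (C * Q) (C * Q powr (- \<tau>)))) \<le> (2 * (C * Q) + 1) ^ CARD('k)"
    using C Q by (intro card_near_vecs_le_box) auto
  also have "\<dots> \<le> ((2 * C + 1) * Q) ^ CARD('k)"
    using C Q by (intro power_mono) (auto simp: algebra_simps)
  also have "\<dots> = (2 * C + 1) ^ CARD('k) * Q powr real CARD('k)"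
    using Q by (simp add: power_mult_distrib powr_realpow)
  finally show "real (card (near_vecs A (C * Q) (C * Q powr (- \<tau>)))) \<le> (2 * C + 1) ^ CARD('k) * Q powr real CARD('k)" .
qed

text \<open>
  Reduced modulo integers, the vectors \<open>z A\<close> lie in a cube of side \<open>2 \<delta>\<close> and have mutual distance
  at least \<open>s\<close>, so each cell of side \<open>s\<close> contains at most one of them.
\<close>

lemma card_near_vecs_packing:
  fixes A :: "real^'m^'k"
  assumes s: "s > 0" and \<delta>: "\<delta> \<ge> 0"
    and sep: "\<And>z. z \<in> int_vecs \<Longrightarrow> z \<noteq> 0 \<Longrightarrow> infnorm z \<le> 2 * N \<Longrightarrow> s \<le> int_dist (z v* A)"
  shows "real (card (near_vecs A N \<delta>)) \<le> (2 * (\<delta> / s) + 2) ^ CARD('m)"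
proof -
  define y where "y = (\<lambda>z. z v* A - (\<chi> j. of_int (round ((z v* A) $ j))))"
  let ?key = "\<lambda>z j. \<lfloor>y z $ j / s\<rfloor>"
  let ?T = "PiE (UNIV :: 'm set) (\<lambda>_. {\<lfloor>- (\<delta> / s)\<rfloor>..\<lfloor>\<delta> / s\<rfloor>})"
  have inj: "inj_on ?key (near_vecs A N \<delta>)"
  proof (rule inj_onI, rule ccontr)
    fix z z' assume z: "z \<in> near_vecs A N \<delta>" "z' \<in> near_vecs A N \<delta>" and eq: "?key z = ?key z'" and ne: "z \<noteq> z'"
    have "infnorm (z - z') \<le> 2 * N"
      using z infnorm_diff_le[of z z'] by (auto simp: near_vecs_def)
    then have "s \<le> int_dist ((z - z') v* A)"
      using z ne by (intro sep) (auto simp: near_vecs_def intro: int_vecs_diff)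
    also have "(z - z') v* A = (y z - y z') + ((\<chi> j. of_int (round ((z v* A) $ j))) - (\<chi> j. of_int (round ((z' v* A) $ j))))"
      by (simp add: y_def vector_matrix_mult_diff_distrib)
    also have "int_dist \<dots> = int_dist (y z - y z')"
      by (rule int_dist_add_int_vec) (simp add: int_vecs_iff)
    also have "\<dots> \<le> infnorm (y z - y z')" by (rule int_dist_le_infnorm)
    also have "\<dots> < s"
      unfolding infnorm_less_iff
    proof
      fix j
      have "\<lfloor>y z $ j / s\<rfloor> = \<lfloor>y z' $ j / s\<rfloor>" using eq by meson
      then have "\<bar>y z $ j / s - y z' $ j / s\<bar> < 1" by linarith
      then have "\<bar>(y z $ j - y z' $ j) / s\<bar> < 1" by (simp add: diff_divide_distrib)
      then show "\<bar>(y z - y z') $ j\<bar> < s" using s by (simp add: abs_divide)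
    qed
    finally show False by simp
  qed
  have "?key ` near_vecs A N \<delta> \<subseteq> ?T"
  proof (rule image_subsetI)
    fix z assume z: "z \<in> near_vecs A N \<delta>"
    have "\<lfloor>y z $ j / s\<rfloor> \<in> {\<lfloor>- (\<delta> / s)\<rfloor>..\<lfloor>\<delta> / s\<rfloor>}" for j
    proof -
      have "infnorm (y z) \<le> \<delta>" using z by (simp add: y_def near_vecs_def int_dist_round)
      then have "\<bar>y z $ j\<bar> \<le> \<delta>" by (simp add: infnorm_le_iff)
      then have "- (\<delta> / s) \<le> y z $ j / s" "y z $ j / s \<le> \<delta> / s"
        using s by (auto simp: abs_le_iff divide_right_mono field_simps)
      then show ?thesis by (simp add: floor_mono)
    qed
    then show "?key z \<in> ?T" by auto
  qed
  then have "card (near_vecs A N \<delta>) \<le> card ?T"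
    by (intro card_inj_on_le[OF inj]) (auto intro: finite_PiE)
  also have "card ?T = nat (\<lfloor>\<delta> / s\<rfloor> + 1 - \<lfloor>- (\<delta> / s)\<rfloor>) ^ CARD('m)"
    by (simp add: card_PiE algebra_simps)
  finally have "real (card (near_vecs A N \<delta>)) \<le> real (nat (\<lfloor>\<delta> / s\<rfloor> + 1 - \<lfloor>- (\<delta> / s)\<rfloor>)) ^ CARD('m)"
    by (metis of_nat_le_iff of_nat_power)
  also have "\<dots> \<le> (2 * (\<delta> / s) + 2) ^ CARD('m)"
  proof (rule power_mono)
    have "\<delta> / s \<ge> 0" using s \<delta> by simp
    then show "real (nat (\<lfloor>\<delta> / s\<rfloor> + 1 - \<lfloor>- (\<delta> / s)\<rfloor>)) \<le> 2 * (\<delta> / s) + 2" by linarith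
  qed simp
  finally show ?thesis .
qed

lemma near_vecs_count_of_dual_exponent:
  fixes A :: "real^'m^'k"
  assumes less: "dioph_exponent (transpose A) < ereal w" and w: "w > 0" and C: "C > 0"
  shows "\<exists>M. \<forall>Q\<ge>1. real (card (near_vecs A (C * Q) (C * Q powr (- \<tau>))))
           \<le> M * Q powr (max 0 (w - \<tau>) * real CARD('m))"
proof -
  from dioph_exponent_lower_bound[OF less w] obtain c where c: "c > 0"
    and lower: "\<And>z. z \<in> int_vecs \<Longrightarrow> z \<noteq> 0 \<Longrightarrow> c * infnorm z powr (- w) \<le> int_dist (z v* A)"
    by (auto simp: transpose_matrix_vector)
  define C' where "C' = C * (2 * C) powr w / c"
  have C': "C' > 0" using C c by (simp add: C'_def)
  show ?thesis
  proof (intro exI allI impI)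
    fix Q :: real assume Q: "Q \<ge> 1"
    define s where "s = c * (2 * (C * Q)) powr (- w)"
    have s: "s > 0" using c C Q by (simp add: s_def)
    have "real (card (near_vecs A (C * Q) (C * Q powr (- \<tau>)))) \<le> (2 * (C * Q powr (- \<tau>) / s) + 2) ^ CARD('m)"
    proof (rule card_near_vecs_packing[OF s])
      show "C * Q powr (- \<tau>) \<ge> 0" using C by simp
      fix z :: "real^'k" assume z: "z \<in> int_vecs" "z \<noteq> 0" "infnorm z \<le> 2 * (C * Q)"
      have "(2 * (C * Q)) powr (- w) \<le> infnorm z powr (- w)"
        using z w by (intro powr_mono2') (auto simp: infnorm_pos_lt)
      then have "s \<le> c * infnorm z powr (- w)" unfolding s_def using c by (intro mult_left_mono) auto
      with lower[OF z(1,2)] show "s \<le> int_dist (z v* A)" by linarith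
    qed
    also have "C * Q powr (- \<tau>) / s = C' * Q powr (w - \<tau>)"
      using Q C c by (simp add: s_def C'_def powr_minus powr_diff powr_mult field_simps)
    also have "(2 * (C' * Q powr (w - \<tau>)) + 2) ^ CARD('m) \<le> ((2 * C' + 2) * Q powr max 0 (w - \<tau>)) ^ CARD('m)"
    proof (rule power_mono)
      have "C' * Q powr (w - \<tau>) \<le> C' * Q powr max 0 (w - \<tau>)"
        using Q C' by (intro mult_left_mono powr_mono) auto
      moreover have "1 \<le> Q powr max 0 (w - \<tau>)" using Q by (intro ge_one_powr_ge_zero) auto
      ultimately show "2 * (C' * Q powr (w - \<tau>)) + 2 \<le> (2 * C' + 2) * Q powr max 0 (w - \<tau>)"
        by (simp add: algebra_simps)
    qed (use C' in auto)
    also have "\<dots> = (2 * C' + 2) ^ CARD('m) * Q powr (max 0 (w - \<tau>) * real CARD('m))"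
      using Q by (simp add: power_mult_distrib powr_powr[symmetric] powr_realpow)
    finally show "real (card (near_vecs A (C * Q) (C * Q powr (- \<tau>))))
        \<le> (2 * C' + 2) ^ CARD('m) * Q powr (max 0 (w - \<tau>) * real CARD('m))" .
  qed
qed

section \<open>Counting by duality\<close>

text \<open>
  Orthogonality of the characters of \<open>\<int>/P\<close>, summed over an arbitrary complete system of residues
  so that a box centred at the origin can be used below.
\<close>

lemma sum_cis_complete_residues:
  fixes a k :: int
  assumes P: "P > 0" and k: "\<bar>k\<bar> < int P"
  shows "(\<Sum>t\<in>{a..<a + int P}. cis (2 * pi * (of_int t * of_int k / real P))) = (if k = 0 then of_nat P else 0)"
proof (cases "k = 0")
  case False
  define x where "x = cis (2 * pi * (of_int k / real P))"
  have x1: "x \<noteq> 1"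
  proof
    assume "x = 1"
    then have "cos (2 * pi * (of_int k / real P)) = 1" by (simp add: x_def complex_eq_iff)
    then obtain n :: int where "2 * pi * (of_int k / real P) = of_int n * 2 * pi"
      using cos_one_2pi_int by blast
    then have "2 * pi * (of_int k / real P) = 2 * pi * of_int n" by (simp only: mult_ac)
    then have "of_int k / real P = of_int n" by (simp only: mult_cancel_left) simp
    then have "(of_int k :: real) = of_int (n * int P)" using P by (simp add: field_simps)
    then have "k = n * int P" by (simp only: of_int_eq_iff)
    then have "int P dvd k" by simp
    with False k show False using dvd_imp_le_int[of k "int P"] by auto
  qed
  have xP: "x ^ P = 1"
  proof -
    have "x ^ P = cis (real P * (2 * pi * (of_int k / real P)))" unfolding x_def by (rule Complex.DeMoivre)
    also have "real P * (2 * pi * (of_int k / real P)) = 2 * pi * of_int k" using P by simp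
    also have "cis \<dots> = 1" by (simp add: cis_multiple_2pi)
    finally show ?thesis .
  qed
  have "(\<Sum>t\<in>{a..<a + int P}. cis (2 * pi * (of_int t * of_int k / real P)))
      = (\<Sum>s<P. cis (2 * pi * (of_int (a + int s) * of_int k / real P)))"
    by (rule sum.reindex_bij_witness[of _ "\<lambda>s. a + int s" "\<lambda>t. nat (t - a)"]) auto
  also have "\<dots> = (\<Sum>s<P. cis (2 * pi * (of_int a * of_int k / real P)) * x ^ s)"
    by (intro sum.cong) (auto simp: x_def Complex.DeMoivre cis_mult algebra_simps add_divide_distrib)
  also have "\<dots> = 0"
    using x1 xP by (simp add: geometric_sum flip: sum_distrib_left)
  finally show ?thesis using False by simp
qed simp

lemma cis_sum: "finite A \<Longrightarrow> cis (\<Sum>i\<in>A. f i) = (\<Prod>i\<in>A. cis (f i))"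
  by (induction A rule: finite_induct) (simp_all flip: cis_mult)

lemma parseval_residues:
  fixes \<kappa> :: "'h \<Rightarrow> 'k::finite \<Rightarrow> int"
  assumes P: "P > 0" and S: "finite S" and range: "\<And>h i. h \<in> S \<Longrightarrow> 0 \<le> \<kappa> h i \<and> \<kappa> h i < int P"
    and inj: "inj_on \<kappa> S"
  shows "(\<Sum>z\<in>PiE UNIV (\<lambda>_. {a..<a + int P}).
           (norm (\<Sum>h\<in>S. cis (2 * pi * ((\<Sum>i\<in>UNIV. of_int (z i) * of_int (\<kappa> h i)) / real P))))\<^sup>2)
         = real (card S) * real P ^ CARD('k)"
proof -
  define E where "E = (\<lambda>(z :: 'k \<Rightarrow> int) h. cis (2 * pi * ((\<Sum>i\<in>UNIV. of_int (z i) * of_int (\<kappa> h i)) / real P)))"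
  let ?B = "PiE (UNIV :: 'k set) (\<lambda>_. {a..<a + int P})"
  have E: "E z h * cnj (E z h') = (\<Prod>i\<in>UNIV. cis (2 * pi * (of_int (z i) * of_int (\<kappa> h i - \<kappa> h' i) / real P)))" for z h h'
  proof -
    have "E z h * cnj (E z h') = cis (\<Sum>i\<in>UNIV. 2 * pi * (of_int (z i) * of_int (\<kappa> h i - \<kappa> h' i) / real P))"
      unfolding E_def cis_cnj cis_mult
      by (rule arg_cong[where f = cis])
        (simp add: sum_divide_distrib sum_distrib_left algebra_simps diff_divide_distrib sum_subtractf)
    then show ?thesis by (simp add: cis_sum)
  qed
  have "complex_of_real (\<Sum>z\<in>?B. (norm (\<Sum>h\<in>S. E z h))\<^sup>2) = (\<Sum>z\<in>?B. (\<Sum>h\<in>S. E z h) * cnj (\<Sum>h\<in>S. E z h))"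
    by (simp only: of_real_sum complex_norm_square)
  also have "\<dots> = (\<Sum>z\<in>?B. \<Sum>h\<in>S. \<Sum>h'\<in>S. E z h * cnj (E z h'))"
    by (simp add: sum_product)
  also have "\<dots> = (\<Sum>h\<in>S. \<Sum>z\<in>?B. \<Sum>h'\<in>S. E z h * cnj (E z h'))"
    by (rule sum.swap)
  also have "\<dots> = (\<Sum>h\<in>S. \<Sum>h'\<in>S. \<Sum>z\<in>?B. E z h * cnj (E z h'))"
    by (intro sum.cong refl sum.swap)
  also have "\<dots> = (\<Sum>h\<in>S. \<Sum>h'\<in>S. if h' = h then of_nat P ^ CARD('k) else 0)"
  proof (intro sum.cong refl)
    fix h h' assume h: "h \<in> S" "h' \<in> S"
    have "(\<Sum>z\<in>?B. E z h * cnj (E z h')) = (\<Prod>i\<in>UNIV. \<Sum>t\<in>{a..<a + int P}. cis (2 * pi * (of_int t * of_int (\<kappa> h i - \<kappa> h' i) / real P)))"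
      unfolding E by (rule prod_sum_PiE[symmetric]) auto
    also have "\<dots> = (\<Prod>i\<in>UNIV. if \<kappa> h i - \<kappa> h' i = 0 then of_nat P else 0)"
    proof (intro prod.cong refl sum_cis_complete_residues[OF P])
      fix i show "\<bar>\<kappa> h i - \<kappa> h' i\<bar> < int P" using range[OF h(1), of i] range[OF h(2), of i] by linarith
    qed
    also have "\<dots> = (if h' = h then of_nat P ^ CARD('k) else 0)"
    proof (cases "h' = h")
      case False
      then have "\<kappa> h \<noteq> \<kappa> h'" using inj h by (auto simp: inj_on_def)
      then obtain i where "\<kappa> h i \<noteq> \<kappa> h' i" by auto
      then have "\<exists>i\<in>UNIV. (if \<kappa> h i - \<kappa> h' i = 0 then of_nat P else 0) = (0::complex)" by auto
      then show ?thesis using False by (simp add: prod_zero)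
    qed simp
    finally show "(\<Sum>z\<in>?B. E z h * cnj (E z h')) = (if h' = h then of_nat P ^ CARD('k) else 0)" .
  qed
  also have "\<dots> = complex_of_real (real (card S) * real P ^ CARD('k))"
    using S by (simp add: sum.delta)
  finally show ?thesis unfolding E_def of_real_eq_iff .
qed


lemma cos_near_int_ge_half:
  assumes "n \<in> \<int>" "\<bar>x - n\<bar> \<le> 1 / 6"
  shows "cos (2 * pi * x) \<ge> 1 / 2"
proof -
  obtain k where k: "n = of_int k" using assms(1) by (auto elim: Ints_cases)
  have "cos (2 * pi * x) = cos (2 * pi * (x - n) + of_int k * (2 * pi))"
    by (simp add: k algebra_simps)
  also have "\<dots> = cos (2 * pi * (x - n))"
    by (simp add: cos_add mult.commute[of "of_int k"])
  also have "\<dots> = cos \<bar>2 * pi * (x - n)\<bar>" by simp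
  also have "\<dots> \<ge> cos (pi / 3)"
  proof (rule cos_monotone_0_pi_le)
    show "\<bar>2 * pi * (x - n)\<bar> \<le> pi / 3"
      using mult_left_mono[OF assms(2), of "2 * pi"] by (simp add: abs_mult)
  qed (auto simp: pi_gt_zero less_imp_le)
  finally show ?thesis by (simp add: cos_60)
qed

text \<open>
  The dual form of the large sieve. Let \<open>h\<close> run through a box of side \<open>H\<close> and round each \<open>A h\<close>
  to the grid \<open>(1/P) \<int>\<^sup>k\<close>. By the separation assumption the rounded points are distinct modulo integers,
  so Parseval's identity gives the mean square over \<open>z\<close> modulo \<open>P\<close> of the exponential sum over \<open>h\<close>.
  For a counted \<open>z\<close> every phase \<open>z \<bullet> A h = (z A) \<bullet> h\<close> is within \<open>1/12\<close> of an integer, and rounding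
  \<open>A h\<close> moves it by at most another \<open>1/12\<close>. Each summand then has real part at least
  \<open>cos (\<pi>/3) = 1/2\<close>, so the exponential sum is at least half of its trivial bound, and this can
  happen only for few \<open>z\<close>.
\<close>

lemma card_near_vecs_duality:
  fixes A :: "real^'m^'k" and P H :: nat
  assumes P: "P > 0" and H: "H > 0" and N: "N \<ge> 0" and \<delta>: "\<delta> \<ge> 0"
    and sep: "\<And>q. q \<in> int_vecs \<Longrightarrow> q \<noteq> 0 \<Longrightarrow> infnorm q \<le> real H - 1 \<Longrightarrow> 1 / real P \<le> int_dist (A *v q)"
    and NP: "12 * real CARD('k) * N \<le> real P"
    and H\<delta>: "12 * real CARD('m) * (real H - 1) * \<delta> \<le> 1"
  shows "real (card (near_vecs A N \<delta>)) * real H ^ CARD('m) \<le> 4 * real P ^ CARD('k)"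
proof -
  let ?B = "PiE (UNIV :: 'k set) (\<lambda>_. {-\<lfloor>N\<rfloor>..<-\<lfloor>N\<rfloor> + int P})"
  define S where "S = PiE (UNIV :: 'm set) (\<lambda>_. {..<H})"
  have cardS: "card S = H ^ CARD('m)" and finS: "finite S"
    by (auto simp: S_def card_PiE intro: finite_PiE)
  define v where "v = (\<lambda>h :: 'm \<Rightarrow> nat. (\<chi> j. real (h j)) :: real^'m)"
  have v_int: "v h \<in> int_vecs" for h by (simp add: v_def int_vecs_iff)
  have v_le: "infnorm (v h) \<le> real H - 1" if "h \<in> S" for h
    unfolding infnorm_le_iff
  proof
    fix j have "h j < H" using that by (auto simp: S_def)
    then show "\<bar>v h $ j\<bar> \<le> real H - 1" by (simp add: v_def)
  qed
  \<comment> \<open>\<open>g h / P\<close> is the rounded point, and \<open>\<kappa> h\<close> is its class modulo \<open>P\<close>.\<close>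
  define g where "g = (\<lambda>h. (\<chi> i. of_int \<lfloor>real P * (A *v v h) $ i\<rfloor>) :: real^'k)"
  define \<kappa> where "\<kappa> = (\<lambda>h i. \<lfloor>real P * (A *v v h) $ i\<rfloor> mod int P)"
  have \<kappa>_range: "0 \<le> \<kappa> h i \<and> \<kappa> h i < int P" for h i
    using P by (simp add: \<kappa>_def)
  have g_frac: "0 \<le> real P * (A *v v h) $ i - g h $ i \<and> real P * (A *v v h) $ i - g h $ i < 1" for h i
    by (simp add: g_def) linarith
  have g_eq: "g h $ i = of_int (\<kappa> h i) + real P * of_int (\<lfloor>real P * (A *v v h) $ i\<rfloor> div int P)" for h i
  proof -
    have "\<lfloor>real P * (A *v v h) $ i\<rfloor> = \<kappa> h i + int P * (\<lfloor>real P * (A *v v h) $ i\<rfloor> div int P)"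
      by (simp add: \<kappa>_def)
    then have "(of_int \<lfloor>real P * (A *v v h) $ i\<rfloor> :: real) = of_int (\<kappa> h i + int P * (\<lfloor>real P * (A *v v h) $ i\<rfloor> div int P))"
      by (simp only:)
    then show ?thesis by (simp add: g_def)
  qed
  have inj: "inj_on \<kappa> S"
  proof (rule inj_onI, rule ccontr)
    fix h h' assume h: "h \<in> S" "h' \<in> S" and eq: "\<kappa> h = \<kappa> h'" and ne: "h \<noteq> h'"
    have "1 / real P \<le> int_dist (A *v (v h - v h'))"
    proof (rule sep)
      show "v h - v h' \<in> int_vecs" using v_int by (intro int_vecs_diff)
      show "v h - v h' \<noteq> 0" using ne by (auto simp: v_def vec_eq_iff fun_eq_iff)
      show "infnorm (v h - v h') \<le> real H - 1"
        unfolding infnorm_le_iff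
      proof
        fix j have "h j < H" "h' j < H" using h by (auto simp: S_def)
        then show "\<bar>(v h - v h') $ j\<bar> \<le> real H - 1" by (auto simp: v_def abs_le_iff)
      qed
    qed
    also have "\<dots> \<le> infnorm (A *v (v h - v h') - (1 / real P) *\<^sub>R (g h - g h'))"
    proof (rule int_dist_le)
      show "(1 / real P) *\<^sub>R (g h - g h') \<in> int_vecs"
        unfolding int_vecs_iff
      proof
        fix i
        have "((1 / real P) *\<^sub>R (g h - g h')) $ i
            = of_int (\<lfloor>real P * (A *v v h) $ i\<rfloor> div int P) - of_int (\<lfloor>real P * (A *v v h') $ i\<rfloor> div int P)"
          using P by (simp add: g_eq eq diff_divide_distrib add_divide_distrib)
        then show "((1 / real P) *\<^sub>R (g h - g h')) $ i \<in> \<int>" by simp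
      qed
    qed
    also have "\<dots> < 1 / real P"
      unfolding infnorm_less_iff
    proof
      fix i
      have "\<bar>(real P * (A *v v h) $ i - g h $ i) - (real P * (A *v v h') $ i - g h' $ i)\<bar> < 1"
        using g_frac[of h i] g_frac[of h' i] by linarith
      moreover have "(A *v (v h - v h') - (1 / real P) *\<^sub>R (g h - g h')) $ i
          = ((real P * (A *v v h) $ i - g h $ i) - (real P * (A *v v h') $ i - g h' $ i)) / real P"
        using P by (simp add: matrix_vector_mult_diff_distrib field_simps)
      ultimately show "\<bar>(A *v (v h - v h') - (1 / real P) *\<^sub>R (g h - g h')) $ i\<bar> < 1 / real P"
        using P by (simp add: abs_divide divide_strict_right_mono)
    qed
    finally show False by simp
  qed
  define E where "E = (\<lambda>(z :: 'k \<Rightarrow> int) h. cis (2 * pi * ((\<Sum>i\<in>UNIV. of_int (z i) * of_int (\<kappa> h i)) / real P)))"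
  have total: "(\<Sum>z\<in>?B. (norm (\<Sum>h\<in>S. E z h))\<^sup>2) = real (card S) * real P ^ CARD('k)"
    unfolding E_def by (rule parseval_residues[OF P finS \<kappa>_range inj])
  let ?key = "\<lambda>(z :: real^'k) i. \<lfloor>z $ i\<rfloor>"
  have key: "z $ i = of_int (?key z i)" if "z \<in> near_vecs A N \<delta>" for z i
    using that by (auto simp: near_vecs_def int_vecs_iff)
  have key_inj: "inj_on ?key (near_vecs A N \<delta>)"
    by (rule inj_onI) (metis key vec_eq_iff)
  \<comment> \<open>Distinct integer vectors of the box of radius \<open>N\<close> are distinct modulo \<open>P\<close>.\<close>
  have NP': "2 * \<lfloor>N\<rfloor> < int P"
  proof -
    have "real CARD('k) \<ge> 1" by (simp add: Suc_leI)
    then have "12 * N \<le> 12 * real CARD('k) * N" using N by (intro mult_right_mono) auto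
    with NP have "12 * N \<le> real P" by (rule order_trans[rotated])
    moreover have "real P > 0" using P by simp
    ultimately have "2 * N < real P" using N by linarith
    then show ?thesis by linarith
  qed
  have key_B: "?key z \<in> ?B" if z: "z \<in> near_vecs A N \<delta>" for z
  proof -
    have "?key z i \<in> {-\<lfloor>N\<rfloor>..<-\<lfloor>N\<rfloor> + int P}" for i
    proof -
      have "\<bar>z $ i\<bar> \<le> N" using z by (auto simp: near_vecs_def infnorm_le_iff)
      then have "of_int (?key z i) \<le> N" "of_int (- ?key z i) \<le> N" using key[OF z, of i] by (auto simp: abs_le_iff)
      then have "?key z i \<le> \<lfloor>N\<rfloor>" "- ?key z i \<le> \<lfloor>N\<rfloor>" by (simp_all only: le_floor_iff)
      then show ?thesis using NP' by auto
    qed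
    then show ?thesis by auto
  qed
  have good: "norm (\<Sum>h\<in>S. E (?key z) h) \<ge> real (card S) / 2" if z: "z \<in> near_vecs A N \<delta>" for z
  proof -
    have z': "z \<in> int_vecs" "infnorm z \<le> N" "int_dist (z v* A) \<le> \<delta>" using z by (auto simp: near_vecs_def)
    obtain r where r: "r \<in> int_vecs" "infnorm (z v* A - r) = int_dist (z v* A)" by (rule int_dist_attained)
    have half: "Re (E (?key z) h) \<ge> 1 / 2" if h: "h \<in> S" for h
    proof -
      have g_int: "g h \<in> int_vecs" by (simp add: g_def int_vecs_iff)
      define u :: "real^'k" where "u = (\<chi> i. of_int (\<lfloor>real P * (A *v v h) $ i\<rfloor> div int P))"
      have u: "u \<in> int_vecs" by (simp add: u_def int_vecs_iff)
      have "(\<Sum>i\<in>UNIV. of_int (?key z i) * of_int (\<kappa> h i)) = (\<Sum>i\<in>UNIV. z $ i * (g h $ i - real P * u $ i))"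
      proof (rule sum.cong[OF refl])
        fix i show "of_int (?key z i) * of_int (\<kappa> h i) = z $ i * (g h $ i - real P * u $ i)"
          using key[OF z, of i] g_eq[of h i] by (simp add: u_def)
      qed
      also have "\<dots> = z \<bullet> (g h - real P *\<^sub>R u)" by (simp add: inner_vec_def)
      finally have arg: "(\<Sum>i\<in>UNIV. of_int (?key z i) * of_int (\<kappa> h i)) / real P = (z \<bullet> g h) / real P - z \<bullet> u"
        using P by (simp add: inner_diff_right diff_divide_distrib)
      have "\<bar>(z \<bullet> g h) / real P - z \<bullet> (A *v v h)\<bar> \<le> 1 / 12"
      proof -
        have "(z \<bullet> g h) / real P - z \<bullet> (A *v v h) = - (z \<bullet> (real P *\<^sub>R (A *v v h) - g h)) / real P"
          using P by (simp add: inner_diff_right field_simps)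
        moreover have "infnorm (real P *\<^sub>R (A *v v h) - g h) \<le> 1"
          unfolding infnorm_le_iff using g_frac[of h] by (auto simp: abs_le_iff intro: less_imp_le)
        then have "\<bar>z \<bullet> (real P *\<^sub>R (A *v v h) - g h)\<bar> \<le> real CARD('k) * (N * 1)"
          using z' by (intro order_trans[OF abs_inner_le_infnorm] mult_left_mono mult_mono N) (auto simp: infnorm_pos_le)
        then have "\<bar>z \<bullet> (real P *\<^sub>R (A *v v h) - g h)\<bar> \<le> real P / 12" using NP by simp
        ultimately have "\<bar>(z \<bullet> g h) / real P - z \<bullet> (A *v v h)\<bar> \<le> (real P / 12) / real P"
          by (simp only: abs_divide abs_minus_cancel abs_of_nat divide_right_mono of_nat_0_le_iff)
        then show ?thesis using P by simp
      qed
      moreover have "\<bar>z \<bullet> (A *v v h) - r \<bullet> v h\<bar> \<le> 1 / 12"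
      proof -
        have "z \<bullet> (A *v v h) - r \<bullet> v h = (z v* A - r) \<bullet> v h"
          by (simp add: dot_lmul_matrix inner_diff_left)
        also have "\<bar>\<dots>\<bar> \<le> real CARD('m) * (infnorm (z v* A - r) * infnorm (v h))"
          by (rule abs_inner_le_infnorm)
        also have "\<dots> \<le> real CARD('m) * (\<delta> * (real H - 1))"
          using z' r v_le[OF h] \<delta> by (intro mult_left_mono mult_mono) (auto simp: infnorm_pos_le)
        also have "\<dots> \<le> 1 / 12" using H\<delta> by (simp add: mult_ac)
        finally show ?thesis .
      qed
      ultimately have "\<bar>((z \<bullet> g h) / real P - z \<bullet> u) - (r \<bullet> v h - z \<bullet> u)\<bar> \<le> 1 / 6" by linarith
      then have "cos (2 * pi * ((z \<bullet> g h) / real P - z \<bullet> u)) \<ge> 1 / 2"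
        using Ints_diff[OF inner_int_vecs[OF r(1) v_int] inner_int_vecs[OF z'(1) u]]
        by (rule cos_near_int_ge_half[rotated])
      then show ?thesis unfolding E_def arg by simp
    qed
    have "real (card S) / 2 = (\<Sum>h\<in>S. 1 / 2)" by simp
    also have "\<dots> \<le> (\<Sum>h\<in>S. Re (E (?key z) h))" using half by (intro sum_mono)
    also have "\<dots> = Re (\<Sum>h\<in>S. E (?key z) h)" by simp
    also have "\<dots> \<le> norm (\<Sum>h\<in>S. E (?key z) h)" by (rule complex_Re_le_cmod)
    finally show ?thesis .
  qed
  have "real (card (near_vecs A N \<delta>)) * (real (card S) / 2)\<^sup>2 = (\<Sum>z\<in>near_vecs A N \<delta>. (real (card S) / 2)\<^sup>2)"
    by simp
  also have "\<dots> \<le> (\<Sum>z\<in>near_vecs A N \<delta>. (norm (\<Sum>h\<in>S. E (?key z) h))\<^sup>2)"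
    using good by (intro sum_mono power_mono) auto
  also have "\<dots> = (\<Sum>z\<in>?key ` near_vecs A N \<delta>. (norm (\<Sum>h\<in>S. E z h))\<^sup>2)"
    by (simp add: sum.reindex[OF key_inj] comp_def)
  also have "\<dots> \<le> (\<Sum>z\<in>?B. (norm (\<Sum>h\<in>S. E z h))\<^sup>2)"
    using key_B by (intro sum_mono2) (auto intro: finite_PiE)
  also note total
  finally have "real (card (near_vecs A N \<delta>)) * real (card S) * real (card S) \<le> 4 * real P ^ CARD('k) * real (card S)"
    by (simp add: power2_eq_square field_simps)
  moreover have "real (card S) > 0" using H by (simp add: cardS)
  ultimately have "real (card (near_vecs A N \<delta>)) * real (card S) \<le> 4 * real P ^ CARD('k)"
    by (rule mult_right_le_imp_le)
  then show ?thesis by (simp add: cardS)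
qed

text \<open>
  With \<open>H\<close> of order \<open>Q\<^bsup>1/w\<^esup>\<close> the separation guaranteed by the exponent is of order \<open>1/Q\<close>, so that
  \<open>P\<close> can be taken of order \<open>Q\<close>, and the duality bound \<open>P\<^sup>k / H\<^sup>m\<close> has the stated order. The
  condition on \<open>\<tau>\<close> ensures that \<open>H\<close> times the distance \<open>C Q\<^bsup>-\<tau>\<^esup>\<close> stays bounded.
\<close>

lemma near_vecs_count_of_exponent:
  fixes A :: "real^'m^'k"
  assumes less: "dioph_exponent A < ereal w" and w: "w > 0" and \<tau>: "\<tau> \<ge> 1 / w" and C: "C > 0"
  shows "\<exists>M. \<forall>Q\<ge>1. real (card (near_vecs A (C * Q) (C * Q powr (- \<tau>))))
           \<le> M * Q powr (real CARD('k) - real CARD('m) / w)"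
proof -
  let ?m = "real CARD('m)" and ?k = "real CARD('k)"
  from dioph_exponent_lower_bound[OF less w] obtain c where c: "c > 0"
    and lower: "\<And>z. z \<in> int_vecs \<Longrightarrow> z \<noteq> 0 \<Longrightarrow> c * infnorm z powr (- w) \<le> int_dist (A *v z)"
    by blast
  \<comment> \<open>Chosen so that \<open>H - 1 < b Q\<^bsup>1/w\<^esup>\<close> gives exactly the smallness of \<open>H \<delta>\<close> required for duality.\<close>
  define b where "b = 1 / (12 * ?m * C)"
  have b: "b > 0" using C by (simp add: b_def)
  define c' where "c' = c * b powr (- w)"
  have c': "c' > 0" using b c by (simp add: c'_def)
  define C' where "C' = 12 * ?k * C + 1 / c' + 1"
  show ?thesis
  proof (intro exI allI impI)
    fix Q :: real assume Q: "Q \<ge> 1"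
    define x where "x = b * Q powr (1 / w)"
    have x: "x > 0" using b Q by (simp add: x_def)
    define H where "H = nat \<lceil>x\<rceil>"
    have H: "H > 0" "x \<le> real H" "real H - 1 < x"
      using x unfolding H_def by linarith+
    define P where "P = nat \<lceil>(12 * ?k * C + 1 / c') * Q\<rceil>"
    have pos: "(12 * ?k * C + 1 / c') * Q > 0"
      using C c' Q by (intro mult_pos_pos add_nonneg_pos) auto
    have P: "P > 0" "(12 * ?k * C + 1 / c') * Q \<le> real P" "real P \<le> (12 * ?k * C + 1 / c') * Q + 1"
      using pos unfolding P_def by linarith+
    have P': "12 * ?k * C * Q \<le> real P" "Q / c' \<le> real P"
    proof -
      have "12 * ?k * C * Q \<ge> 0" "Q / c' \<ge> 0" using C c' Q by auto
      then show "12 * ?k * C * Q \<le> real P" "Q / c' \<le> real P"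
        using P(2) by (auto simp: algebra_simps)
    qed
    have "real (card (near_vecs A (C * Q) (C * Q powr (- \<tau>)))) * real H ^ CARD('m) \<le> 4 * real P ^ CARD('k)"
    proof (rule card_near_vecs_duality[OF P(1) H(1)])
      show "C * Q \<ge> 0" "C * Q powr (- \<tau>) \<ge> 0" using C Q by auto
      show "12 * ?k * (C * Q) \<le> real P" using P' by (simp add: mult_ac)
      have "12 * ?m * (real H - 1) * (C * Q powr (- \<tau>)) \<le> 12 * ?m * x * (C * Q powr (- (1 / w)))"
        using H C Q \<tau> x by (intro mult_mono powr_mono) auto
      also have "\<dots> = 1" using C Q by (simp add: x_def b_def powr_minus field_simps)
      finally show "12 * ?m * (real H - 1) * (C * Q powr (- \<tau>)) \<le> 1" .
      fix q :: "real^'m" assume q: "q \<in> int_vecs" "q \<noteq> 0" "infnorm q \<le> real H - 1"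
      have "1 / real P \<le> c' / Q" using P' P(1) c' Q by (simp add: field_simps)
      also have "c' / Q = c * x powr (- w)"
        using b Q w by (simp add: c'_def x_def powr_mult powr_powr powr_minus field_simps)
      also have "\<dots> \<le> c * infnorm q powr (- w)"
        using c q H w by (intro mult_left_mono powr_mono2') (auto simp: infnorm_pos_lt)
      also have "\<dots> \<le> int_dist (A *v q)" by (rule lower[OF q(1,2)])
      finally show "1 / real P \<le> int_dist (A *v q)" .
    qed
    moreover have "real P ^ CARD('k) \<le> (C' * Q) ^ CARD('k)"
      using P(3) Q by (intro power_mono) (auto simp: C'_def algebra_simps)
    moreover have "x ^ CARD('m) \<le> real H ^ CARD('m)" using H x by (intro power_mono) auto
    then have "real (card (near_vecs A (C * Q) (C * Q powr (- \<tau>)))) * x ^ CARD('m)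
        \<le> real (card (near_vecs A (C * Q) (C * Q powr (- \<tau>)))) * real H ^ CARD('m)"
      by (intro mult_left_mono) auto
    ultimately have "real (card (near_vecs A (C * Q) (C * Q powr (- \<tau>)))) * x ^ CARD('m) \<le> 4 * (C' * Q) ^ CARD('k)"
      by linarith
    then have "real (card (near_vecs A (C * Q) (C * Q powr (- \<tau>)))) \<le> 4 * (C' * Q) ^ CARD('k) / x ^ CARD('m)"
      using x by (simp add: field_simps)
    also have "\<dots> = 4 * C' ^ CARD('k) / b ^ CARD('m) * Q powr (?k - ?m / w)"
    proof -
      have "x ^ CARD('m) = b ^ CARD('m) * Q powr (?m / w)"
        using Q by (simp add: x_def power_mult_distrib powr_powr mult.commute flip: powr_realpow)
      moreover have "Q ^ CARD('k) = Q powr ?k" using Q by (simp add: powr_realpow)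
      ultimately show ?thesis by (simp add: power_mult_distrib powr_diff)
    qed
    finally show "real (card (near_vecs A (C * Q) (C * Q powr (- \<tau>))))
        \<le> 4 * C' ^ CARD('k) / b ^ CARD('m) * Q powr (?k - ?m / w)" .
  qed
qed

section \<open>Inhomogeneous approximation to points that are not well approximable\<close>

lemma int_dist_less_of_same_cells:
  fixes a b :: "real^'n"
  assumes g: "g > 0" and same: "\<And>l. \<lfloor>g * frac (a $ l)\<rfloor> = \<lfloor>g * frac (b $ l)\<rfloor>"
  shows "int_dist (a - b) < 1 / g"
proof -
  let ?z = "(\<chi> l. of_int \<lfloor>a $ l\<rfloor> - of_int \<lfloor>b $ l\<rfloor>) :: real^'n"
  have "int_dist (a - b) \<le> infnorm (a - b - ?z)"
    by (rule int_dist_le) (simp add: int_vecs_iff)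
  also have "\<dots> < 1 / g"
    unfolding infnorm_less_iff
  proof
    fix l
    have "\<bar>g * frac (a $ l) - g * frac (b $ l)\<bar> < 1" using same[of l] by linarith
    then have "g * \<bar>frac (a $ l) - frac (b $ l)\<bar> < 1"
      using g by (simp add: abs_mult flip: right_diff_distrib)
    then have "\<bar>frac (a $ l) - frac (b $ l)\<bar> < 1 / g" using g by (simp add: pos_less_divide_eq mult.commute)
    also have "frac (a $ l) - frac (b $ l) = (a - b - ?z) $ l" by (simp add: frac_def)
    finally show "\<bar>(a - b - ?z) $ l\<bar> < 1 / g" .
  qed
  finally show ?thesis .
qed

text \<open>
  Neighbours modulo integers up to a multiple \<open>q y\<close> with \<open>|q| < X\<close>: the vectors \<open>(q, q y - p)\<close> form a
  lattice in \<open>\<real>\<^bsup>n+1\<^esup>\<close>, and linked points differ by an element of the box \<open>(-X, X) \<times> (-1/g, 1/g)\<^sup>n\<close>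
  modulo this lattice.
\<close>

definition linked :: "real^'n \<Rightarrow> nat \<Rightarrow> real \<Rightarrow> real^'n \<Rightarrow> real^'n \<Rightarrow> bool" where
  "linked y X g u v \<longleftrightarrow> (\<exists>q::int. \<bar>q\<bar> < int X \<and> int_dist (v - u - of_int q *\<^sub>R y) < 1 / g)"

lemma linked_sym: "linked y X g u v \<Longrightarrow> linked y X g v u"
proof -
  assume "linked y X g u v"
  then obtain q :: int where q: "\<bar>q\<bar> < int X" "int_dist (v - u - of_int q *\<^sub>R y) < 1 / g"
    by (auto simp: linked_def)
  have "u - v - of_int (- q) *\<^sub>R y = - (v - u - of_int q *\<^sub>R y)" by simp
  then have "int_dist (u - v - of_int (- q) *\<^sub>R y) < 1 / g" using q by (simp only: int_dist_uminus)
  then show ?thesis using q unfolding linked_def by (intro exI[of _ "- q"]) auto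
qed

text \<open>
  The translates of the multiples \<open>q y\<close>, \<open>0 \<le> q < X\<close>, by pairwise unlinked points all fall into
  different cells of side \<open>1/g\<close>: a coincidence would either link two of the points or produce a
  multiple of \<open>y\<close> that is too close to an integer vector.
\<close>

lemma card_unlinked_le:
  fixes y :: "real^'n" and v :: "'i \<Rightarrow> real^'n" and g :: nat
  assumes g: "g > 0" and I: "finite I"
    and hom: "\<And>q::nat. 0 < q \<Longrightarrow> q < X \<Longrightarrow> 1 / real g \<le> int_dist (real q *\<^sub>R y)"
    and unlinked: "\<And>i j. i \<in> I \<Longrightarrow> j \<in> I \<Longrightarrow> i \<noteq> j \<Longrightarrow> \<not> linked y X g (v i) (v j)"
  shows "card I * X \<le> g ^ CARD('n)"
proof -
  define key where "key = (\<lambda>(i, q::nat) l. \<lfloor>real g * frac ((v i + real q *\<^sub>R y) $ l)\<rfloor>)"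
  have key_range: "key p l \<in> {0..<int g}" for p l
  proof -
    obtain i q where p: "p = (i, q)" by (cases p)
    define f where "f = frac ((v i + real q *\<^sub>R y) $ l)"
    have f: "0 \<le> f" "f < 1" by (auto simp: f_def frac_lt_1)
    have "0 \<le> real g * f" "real g * f < real g" using f g by auto
    then have "\<lfloor>real g * f\<rfloor> \<in> {0..<int g}" by (auto simp: floor_less_iff)
    then show ?thesis by (simp add: key_def p f_def)
  qed
  have "inj_on key (I \<times> {..<X})"
  proof (rule inj_onI, rule ccontr)
    fix p p' assume pp: "p \<in> I \<times> {..<X}" "p' \<in> I \<times> {..<X}" "key p = key p'" "p \<noteq> p'"
    obtain i q j r where p: "p = (i, q)" "p' = (j, r)" by (cases p, cases p')
    have near: "int_dist ((v i + real q *\<^sub>R y) - (v j + real r *\<^sub>R y)) < 1 / real g"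
      using g pp(3) by (intro int_dist_less_of_same_cells) (auto simp: key_def p dest: fun_cong)
    show False
    proof (cases "i = j")
      case False
      have "(v i + real q *\<^sub>R y) - (v j + real r *\<^sub>R y) = v i - v j - of_int (int r - int q) *\<^sub>R y"
        by (simp add: algebra_simps)
      with near have "int_dist (v i - v j - of_int (int r - int q) *\<^sub>R y) < 1 / real g" by (simp only:)
      then have "linked y X g (v j) (v i)"
        unfolding linked_def using pp p by (intro exI[of _ "int r - int q"]) auto
      then show False using unlinked[of j i] False pp p by auto
    next
      case True
      have diff: "int_dist (real k *\<^sub>R y) < 1 / real g \<Longrightarrow> 0 < k \<Longrightarrow> k < X \<Longrightarrow> False" for k
        using hom[of k] by auto
      have "q \<noteq> r" using pp p True by auto
      then consider "q < r" | "r < q" by linarith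
      then show False
      proof cases
        case 1
        have "(v i + real q *\<^sub>R y) - (v j + real r *\<^sub>R y) = - (real (r - q) *\<^sub>R y)"
          using True 1 by (simp add: of_nat_diff algebra_simps)
        with near have "int_dist (real (r - q) *\<^sub>R y) < 1 / real g" by (simp only: int_dist_uminus)
        then show False by (rule diff) (use 1 pp p in auto)
      next
        case 2
        have "(v i + real q *\<^sub>R y) - (v j + real r *\<^sub>R y) = real (q - r) *\<^sub>R y"
          using True 2 by (simp add: of_nat_diff algebra_simps)
        with near have "int_dist (real (q - r) *\<^sub>R y) < 1 / real g" by (simp only:)
        then show False by (rule diff) (use 2 pp p in auto)
      qed
    qed
  qed
  moreover have "key ` (I \<times> {..<X}) \<subseteq> PiE UNIV (\<lambda>_. {0..<int g})"
    using key_range by auto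
  ultimately have "card (I \<times> {..<X}) \<le> card (PiE (UNIV :: 'n set) (\<lambda>_. {0..<int g}))"
    by (intro card_inj_on_le) (auto intro: finite_PiE)
  then show ?thesis by (simp add: card_PiE card_cartesian_product)
qed

text \<open>
  Subdivide the segment from \<open>0\<close> to \<open>\<theta>\<close> so finely that consecutive points are linked. In the breadth-first
  layers starting at \<open>0\<close>, points that are new in the layers \<open>0, 2, 4, \<dots>\<close> are pairwise unlinked if
  one is taken from each layer, so there are at most \<open>g\<^sup>n / X\<close> such layers. Hence \<open>\<theta>\<close> is reached
  after at most \<open>2 g\<^sup>n / X\<close> links, each of which contributes less than \<open>X\<close> to the multiplier and less than \<open>1/g\<close> to the error.
\<close>

lemma inhomogeneous_approximation:
  fixes y \<theta> :: "real^'n" and g X :: nat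
  assumes g: "g > 0" and X: "X > 0"
    and hom: "\<And>q::nat. 0 < q \<Longrightarrow> q < X \<Longrightarrow> 1 / real g \<le> int_dist (real q *\<^sub>R y)"
  obtains q :: int where "real_of_int \<bar>q\<bar> \<le> 2 * real g ^ CARD('n)"
    "int_dist (of_int q *\<^sub>R y - \<theta>) \<le> 2 * real g ^ CARD('n) / (real X * real g)"
proof -
  obtain M :: nat where M: "real M > real g * infnorm \<theta>" using reals_Archimedean2 by blast
  have M0: "real M > 0" using M infnorm_pos_le[of \<theta>] by (smt (verit) mult_nonneg_nonneg of_nat_0_le_iff)
  define s where "s = (\<lambda>j::nat. (real j / real M) *\<^sub>R \<theta>)"
  define step where "step = (\<lambda>S. {j. j \<le> M \<and> (\<exists>i\<in>S. linked y X g (s i) (s j))})"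
  define R where "R = (\<lambda>k. (step ^^ k) {0})"
  have R_Suc: "R (Suc k) = step (R k)" for k by (simp add: R_def)
  have refl: "linked y X g u u" for u
    unfolding linked_def using X g by (intro exI[of _ 0]) auto
  have R_le: "j \<le> M" if "j \<in> R k" for j k
    using that by (cases k) (auto simp: R_def step_def)
  have R_mono1: "R k \<subseteq> R (Suc k)" for k
    using R_le refl by (auto simp: R_Suc step_def)
  have R_mono: "R k \<subseteq> R l" if "k \<le> l" for k l
    using lift_Suc_mono_le[of R, OF R_mono1 that] .
  have path: "linked y X g (s j) (s (Suc j))" for j
  proof -
    have "s (Suc j) - s j - of_int 0 *\<^sub>R y = (1 / real M) *\<^sub>R \<theta>"
      by (simp add: s_def algebra_simps add_divide_distrib flip: scaleR_left_diff_distrib)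
    moreover have "infnorm ((1 / real M) *\<^sub>R \<theta>) < 1 / g"
      using M M0 g by (simp add: infnorm_mul field_simps)
    ultimately have "int_dist (s (Suc j) - s j - of_int 0 *\<^sub>R y) < 1 / g"
      using int_dist_le_infnorm le_less_trans by metis
    then show ?thesis unfolding linked_def using X by (intro exI[of _ 0]) auto
  qed
  \<comment> \<open>A layer that stops growing contains the whole subdivided segment.\<close>
  have closed: "M \<in> R k" if "R (Suc k) = R k" for k
  proof -
    have "j \<le> M \<Longrightarrow> j \<in> R k" for j
    proof (induction j)
      case 0 then show ?case using R_mono[of 0 k] by (auto simp: R_def)
    next
      case (Suc j)
      then have "Suc j \<in> step (R k)" using path[of j] by (auto simp: step_def)
      then show ?case using that by (simp add: R_Suc)
    qed
    then show ?thesis by simp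
  qed
  have reach: "\<exists>q::int. \<bar>q\<bar> \<le> int (k * X) \<and> int_dist (s j - of_int q *\<^sub>R y) \<le> real k / real g" if "j \<in> R k" for k j
    using that
  proof (induction k arbitrary: j)
    case 0
    then show ?case by (intro exI[of _ 0]) (auto simp: R_def s_def)
  next
    case (Suc k)
    then obtain i where i: "i \<in> R k" "linked y X g (s i) (s j)" by (auto simp: R_Suc step_def)
    from Suc.IH[OF i(1)] obtain q where q: "\<bar>q\<bar> \<le> int (k * X)" "int_dist (s i - of_int q *\<^sub>R y) \<le> real k / real g" by auto
    from i(2) obtain q' :: int where q': "\<bar>q'\<bar> < int X" "int_dist (s j - s i - of_int q' *\<^sub>R y) < 1 / g"
      by (auto simp: linked_def)
    have "s j - of_int (q + q') *\<^sub>R y = (s i - of_int q *\<^sub>R y) + (s j - s i - of_int q' *\<^sub>R y)"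
      by (simp add: algebra_simps)
    then have "int_dist (s j - of_int (q + q') *\<^sub>R y)
        \<le> int_dist (s i - of_int q *\<^sub>R y) + int_dist (s j - s i - of_int q' *\<^sub>R y)"
      by (simp only: int_dist_add_le)
    also have "\<dots> \<le> real (Suc k) / real g" using q q' by (simp add: add_divide_distrib)
    finally have "int_dist (s j - of_int (q + q') *\<^sub>R y) \<le> real (Suc k) / real g" .
    moreover have "\<bar>q + q'\<bar> \<le> int (Suc k * X)" using q q' by auto
    ultimately show ?case by blast
  qed
  define K where "K = g ^ CARD('n) div X"
  have "M \<in> R (2 * K)"
  proof (rule ccontr)
    assume notin: "M \<notin> R (2 * K)"
    \<comment> \<open>As long as the end point is not reached, each layer contains a point that is not in the previous ones.\<close>
    have new: "\<exists>j. j \<in> R (2 * i) \<and> (\<forall>l < 2 * i. j \<notin> R l)" if "i \<le> K" for i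
    proof (cases "i = 0")
      case True then show ?thesis by (auto simp: R_def)
    next
      case False
      then obtain l where l: "2 * i = Suc l" by (cases "2 * i") auto
      have "R (Suc l) \<noteq> R l"
      proof
        assume "R (Suc l) = R l"
        then have "M \<in> R l" by (rule closed)
        then show False using notin R_mono[of l "2 * K"] l that by auto
      qed
      then obtain j where j: "j \<in> R (Suc l)" "j \<notin> R l" using R_mono1 by blast
      have "j \<notin> R l'" if "l' < 2 * i" for l' using R_mono[of l' l] j that l by auto
      then show ?thesis using j l by auto
    qed
    then obtain j where j: "\<And>i. i \<le> K \<Longrightarrow> j i \<in> R (2 * i)" "\<And>i l. i \<le> K \<Longrightarrow> l < 2 * i \<Longrightarrow> j i \<notin> R l"
      by metis
    have unl: "\<not> linked y X g (s (j i)) (s (j i'))" if "i < i'" "i' \<le> K" for i i'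
    proof
      assume "linked y X g (s (j i)) (s (j i'))"
      then have "j i' \<in> R (Suc (2 * i))"
        using j(1)[of i] R_le[OF j(1)[of i']] that by (auto simp: R_Suc step_def)
      then show False using j(2)[of i' "Suc (2 * i)"] that by auto
    qed
    have "card {..K} * X \<le> g ^ CARD('n)"
    proof (rule card_unlinked_le[OF g _ hom])
      fix i i' assume "i \<in> {..K}" "i' \<in> {..K}" "i \<noteq> i'"
      then show "\<not> linked y X g (s (j i)) (s (j i'))"
        using unl[of i i'] unl[of i' i] linked_sym by (metis atMost_iff linorder_neqE_nat)
    qed auto
    then have "Suc K * X \<le> g ^ CARD('n)" by simp
    then have "Suc K \<le> g ^ CARD('n) div X" using X by (simp add: less_eq_div_iff_mult_less_eq)
    then show False by (simp add: K_def)
  qed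
  then obtain q where q: "\<bar>q\<bar> \<le> int (2 * K * X)" "int_dist (s M - of_int q *\<^sub>R y) \<le> real (2 * K) / real g"
    using reach by blast
  have KX: "real K * real X \<le> real g ^ CARD('n)"
  proof -
    have "K * X \<le> g ^ CARD('n)" by (simp add: K_def)
    then show ?thesis by (metis of_nat_le_iff of_nat_mult of_nat_power)
  qed
  show ?thesis
  proof (rule that[of q])
    have "real_of_int \<bar>q\<bar> \<le> real_of_int (int (2 * K * X))" using q(1) by (simp only: of_int_le_iff)
    then show "real_of_int \<bar>q\<bar> \<le> 2 * real g ^ CARD('n)" using KX by simp
    have "int_dist (of_int q *\<^sub>R y - \<theta>) = int_dist (s M - of_int q *\<^sub>R y)"
      using M0 int_dist_uminus[of "s M - of_int q *\<^sub>R y"] by (simp add: s_def)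
    also have "\<dots> \<le> 2 * real K / real g" using q by simp
    also have "\<dots> \<le> 2 * real g ^ CARD('n) / (real X * real g)"
      using KX X g by (simp add: field_simps)
    finally show "int_dist (of_int q *\<^sub>R y - \<theta>) \<le> 2 * real g ^ CARD('n) / (real X * real g)" .
  qed
qed

text \<open>
  If \<open>q y\<close> is integral, so are all \<open>k q y\<close>.
\<close>

lemma mem_approx_set_zero_of_integral_multiple:
  assumes "int_dist (real q *\<^sub>R y) = 0" "q > 0"
  shows "y \<in> approx_set \<tau> 0"
proof -
  have "inj (\<lambda>k::nat. Suc k * q)" using assms(2) by (auto simp: inj_def)
  moreover have "range (\<lambda>k::nat. Suc k * q) \<subseteq> {q::nat. int_dist (real q *\<^sub>R y - 0) < real q powr (- \<tau>)}"
  proof safe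
    fix k :: nat
    have "int_dist (real (Suc k * q) *\<^sub>R y) = int_dist (real (Suc k) *\<^sub>R (real q *\<^sub>R y))"
      by (simp only: of_nat_mult scaleR_scaleR)
    also have "\<dots> \<le> \<bar>real (Suc k)\<bar> * 0"
      using int_dist_scaleR_int_le[of "real (Suc k)" "real q *\<^sub>R y"] assms by simp
    also have "\<dots> = 0" by simp
    also have "0 < real (Suc k * q) powr (- \<tau>)"
    proof -
      have "Suc k * q \<noteq> 0" using assms(2) by simp
      then show ?thesis by (simp only: powr_gt_zero of_nat_eq_0_iff) simp
    qed
    finally show "int_dist (real (Suc k * q) *\<^sub>R y - 0) < real (Suc k * q) powr (- \<tau>)" by simp
  qed
  ultimately show ?thesis
    unfolding approx_set_def using finite_subset range_inj_infinite by blast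
qed

lemma homogeneous_lower_bound:
  assumes "y \<notin> approx_set \<tau> 0"
  obtains c where "0 < c" "c \<le> 1" "\<And>q::nat. q > 0 \<Longrightarrow> c * real q powr (- \<tau>) \<le> int_dist (real q *\<^sub>R y)"
proof -
  define F where "F = {q::nat. int_dist (real q *\<^sub>R y - 0) < real q powr (- \<tau>)}"
  have fin: "finite F" using assms by (simp add: approx_set_def F_def)
  have pos: "int_dist (real q *\<^sub>R y) > 0" if "q > 0" for q
    using mem_approx_set_zero_of_integral_multiple[of q y \<tau>] assms that int_dist_nonneg[of "real q *\<^sub>R y"] by fastforce
  define Z where "Z = insert 1 ((\<lambda>q. int_dist (real q *\<^sub>R y) * real q powr \<tau>) ` (F - {0}))"
  have Z: "finite Z" "Z \<noteq> {}" using fin by (auto simp: Z_def)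
  have "\<forall>x\<in>Z. x > 0" using pos by (auto simp: Z_def)
  then have Zpos: "Min Z > 0" using Z by simp
  have Z1: "Min Z \<le> 1" using Z by (intro Min_le) (auto simp: Z_def)
  have "Min Z * real q powr (- \<tau>) \<le> int_dist (real q *\<^sub>R y)" if q: "q > 0" for q
  proof (cases "q \<in> F")
    case True
    then have "Min Z \<le> int_dist (real q *\<^sub>R y) * real q powr \<tau>"
      using q Z by (intro Min_le) (auto simp: Z_def)
    then show ?thesis using q by (simp add: powr_minus field_simps)
  next
    case False
    have "Min Z * real q powr (- \<tau>) \<le> real q powr (- \<tau>)"
      using Z1 mult_right_mono[of "Min Z" 1 "real q powr (- \<tau>)"] by simp
    then show ?thesis using False by (auto simp: F_def)
  qed
  with Zpos Z1 show ?thesis by (rule that)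
qed

lemma infinite_nat_of_unbounded:
  assumes "\<And>B. \<exists>q\<in>S. B \<le> (q :: nat)"
  shows "infinite S"
  using assms by (meson finite_nat_set_iff_bounded_le infinite_nat_iff_unbounded_le)

lemma eventually_powr_less:
  assumes "c > 0" "a < b" 
  shows "eventually (\<lambda>X::nat. C * real X powr a < c * real X powr b) sequentially"
proof -
  have "((\<lambda>X::nat. C * real X powr (a - b)) \<longlongrightarrow> C * 0) sequentially"
    using assms by (intro tendsto_intros tendsto_neg_powr filterlim_real_sequentially) auto
  then have "eventually (\<lambda>X::nat. C * real X powr (a - b) < c) sequentially"
    using assms by (intro order_tendstoD) auto
  then show ?thesis
    using eventually_gt_at_top[of 0]
  proof eventually_elim
    case (elim X)
    then show ?case by (simp add: powr_diff field_simps)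
  qed
qed

text \<open>
  For a large parameter \<open>X\<close> take \<open>g\<close> of order \<open>X\<^bsup>\<tau>'\<^esup>\<close>, just large enough for the lower bound on the
  multiples below \<open>X\<close>. The approximation in \<open>inhomogeneous_approximation\<close> then has a multiplier of order at most
  \<open>X\<^bsup>n \<tau>'\<^esup>\<close> and an error of order \<open>X\<^bsup>(n-1) \<tau>' - 1\<^esup>\<close>; the relation between \<open>\<tau>\<close> and \<open>\<tau>'\<close> says precisely
  that this beats the exponent \<open>\<tau>\<close>. For \<open>\<tau> < 1/n\<close> it holds once \<open>\<tau>'\<close> is close to \<open>1/n\<close>.
\<close>

lemma mem_approx_set_of_not_well_approximable:
  fixes y \<theta> :: "real^'n"
  assumes not: "y \<notin> approx_set \<tau>' 0" and \<tau>': "\<tau>' > 0" and \<tau>: "\<tau> \<ge> 0"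
    and rel: "\<tau>' * (real CARD('n) - 1 + real CARD('n) * \<tau>) < 1" and n\<tau>': "real CARD('n) * \<tau>' \<ge> 1"
  shows "y \<in> approx_set \<tau> \<theta>"
proof -
  let ?n = "CARD('n)"
  from homogeneous_lower_bound[OF not] obtain c where c: "0 < c" "c \<le> 1"
    and hom: "\<And>q::nat. q > 0 \<Longrightarrow> c * real q powr (- \<tau>') \<le> int_dist (real q *\<^sub>R y)" by blast
  define C\<^sub>1 where "C\<^sub>1 = 2 / c"
  have C1: "C\<^sub>1 \<ge> 1" using c by (simp add: C\<^sub>1_def)
  define C\<^sub>2 where "C\<^sub>2 = 8 * C\<^sub>1 ^ ?n"
  have C2: "C\<^sub>2 > 0" using C1 by (simp add: C\<^sub>2_def)
  define C\<^sub>3 where "C\<^sub>3 = 2 * C\<^sub>1 ^ (?n - 1)"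
  have ev: "eventually (\<lambda>X::nat. C\<^sub>3 * real X powr ((real ?n - 1) * \<tau>' - 1)
      < C\<^sub>2 powr (- \<tau>) * real X powr (- (real ?n * \<tau>' * \<tau>))) sequentially"
    using C2 rel by (intro eventually_powr_less) (auto simp: algebra_simps)
  have "infinite {q::nat. int_dist (real q *\<^sub>R y - \<theta>) < real q powr (- \<tau>)}"
  proof (rule infinite_nat_of_unbounded)
    fix B :: nat
    obtain X :: nat where X: "X \<ge> max B 1" "C\<^sub>3 * real X powr ((real ?n - 1) * \<tau>' - 1)
      < C\<^sub>2 powr (- \<tau>) * real X powr (- (real ?n * \<tau>' * \<tau>))"
      using eventually_happens[OF eventually_conj[OF ev eventually_ge_at_top[of "max B 1"]]] by auto
    have X1: "real X \<ge> 1" "X > 0" using X by auto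
    have Xt: "real X powr \<tau>' \<ge> 1" using X1 \<tau>' by (intro ge_one_powr_ge_zero) auto
    define g where "g = nat \<lceil>real X powr \<tau>' / c\<rceil>"
    have "real X powr \<tau>' / c \<ge> 1" using Xt c by (simp add: field_simps)
    then have g: "real X powr \<tau>' / c \<le> real g" "real g \<le> real X powr \<tau>' / c + 1" "g > 0"
      unfolding g_def by linarith+
    have g_le: "real g \<le> C\<^sub>1 * real X powr \<tau>'"
      using g \<open>real X powr \<tau>' / c \<ge> 1\<close> by (simp add: C\<^sub>1_def)
    have g_ge: "real X powr \<tau>' \<le> real g"
    proof -
      have "real X powr \<tau>' \<le> real X powr \<tau>' / c" using c mult_right_mono[of c 1 "real X powr \<tau>'"] by (simp add: field_simps)
      then show ?thesis using g by linarith
    qed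
    have hom': "1 / real g \<le> int_dist (real q *\<^sub>R y)" if "0 < q" "q < X" for q
    proof -
      have "1 / real g \<le> c * real X powr (- \<tau>')"
        using g c X1 by (simp add: powr_minus field_simps)
      also have "\<dots> \<le> c * real q powr (- \<tau>')"
        using that c \<tau>' by (intro mult_left_mono powr_mono2') auto
      finally show ?thesis using hom[OF that(1)] by linarith
    qed
    \<comment> \<open>The multiplier may be negative or small. Approximating \<open>\<theta> - 2 B' y\<close> instead of \<open>\<theta>\<close> shifts it
      into the range from \<open>B'\<close> to \<open>3 B'\<close>, which produces arbitrarily large multipliers.\<close>
    define B' where "B' = 2 * g ^ ?n"
    obtain q where q: "real_of_int \<bar>q\<bar> \<le> 2 * real g ^ ?n"
      "int_dist (of_int q *\<^sub>R y - (\<theta> - real (2 * B') *\<^sub>R y)) \<le> 2 * real g ^ ?n / (real X * real g)"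
      using inhomogeneous_approximation[OF g(3) X1(2) hom'] by blast
    have qB: "\<bar>q\<bar> \<le> int B'"
    proof -
      have "real_of_int \<bar>q\<bar> \<le> real_of_int (int B')" using q(1) by (simp add: B'_def)
      then show ?thesis by (simp only: of_int_le_iff)
    qed
    define Q where "Q = nat (q + 2 * int B')"
    have Q: "int Q = q + 2 * int B'" "B' \<le> Q" "Q \<le> 3 * B'" using qB by (auto simp: Q_def)
    have gn: "real g ^ ?n \<le> C\<^sub>1 ^ ?n * real X powr (real ?n * \<tau>')"
    proof -
      have "real g ^ ?n \<le> (C\<^sub>1 * real X powr \<tau>') ^ ?n" using g_le by (intro power_mono) auto
      also have "\<dots> = C\<^sub>1 ^ ?n * real X powr (real ?n * \<tau>')"
        using X1 by (simp add: power_mult_distrib powr_powr mult.commute flip: powr_realpow)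
      finally show ?thesis .
    qed
    have "X \<le> Q"
    proof -
      have "real X powr 1 \<le> real X powr (real ?n * \<tau>')" using X1 n\<tau>' by (intro powr_mono) auto
      also have "\<dots> = (real X powr \<tau>') ^ ?n"
        using X1 by (simp add: powr_powr mult.commute flip: powr_realpow)
      also have "\<dots> \<le> real g ^ ?n" using g_ge by (intro power_mono) auto
      finally have "X \<le> g ^ ?n" using X1 by (simp flip: of_nat_power)
      then show ?thesis using Q by (simp add: B'_def)
    qed
    have Qpos: "real Q > 0" using \<open>X \<le> Q\<close> X1 by simp
    have "real Q \<le> 3 * real B'" using Q(3) by (metis of_nat_le_iff of_nat_mult of_nat_numeral)
    also have "\<dots> \<le> C\<^sub>2 * real X powr (real ?n * \<tau>')"
    proof -
      have "real g ^ ?n \<ge> 0" by simp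
      moreover have "3 * real B' = 6 * real g ^ ?n" by (simp add: B'_def)
      ultimately show ?thesis using gn unfolding C\<^sub>2_def by linarith
    qed
    finally have Q_le: "real Q \<le> C\<^sub>2 * real X powr (real ?n * \<tau>')" .
    have "real Q *\<^sub>R y - \<theta> = of_int q *\<^sub>R y - (\<theta> - real (2 * B') *\<^sub>R y)"
    proof -
      have "real Q = of_int q + real (2 * B')" using Q(1) by (metis of_int_add of_int_of_nat_eq of_nat_mult of_nat_numeral)
      then show ?thesis by (simp add: scaleR_add_left)
    qed
    then have "int_dist (real Q *\<^sub>R y - \<theta>) \<le> 2 * real g ^ ?n / (real X * real g)" using q(2) by (simp only:)
    also have "\<dots> = 2 * real g ^ (?n - 1) / real X"
      using g(3) by (simp add: power_diff field_simps power_eq_if)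
    also have "\<dots> \<le> 2 * (C\<^sub>1 * real X powr \<tau>') ^ (?n - 1) / real X"
      using g_le X1 by (intro divide_right_mono mult_left_mono power_mono) auto
    also have "(C\<^sub>1 * real X powr \<tau>') ^ (?n - 1) = C\<^sub>1 ^ (?n - 1) * real X powr ((real ?n - 1) * \<tau>')"
      using X1 by (simp add: power_mult_distrib powr_powr mult.commute of_nat_diff Suc_leI flip: powr_realpow)
    also have "2 * (C\<^sub>1 ^ (?n - 1) * real X powr ((real ?n - 1) * \<tau>')) / real X = C\<^sub>3 * real X powr ((real ?n - 1) * \<tau>' - 1)"
      using X1 by (simp add: C\<^sub>3_def powr_diff)
    also have "\<dots> < C\<^sub>2 powr (- \<tau>) * real X powr (- (real ?n * \<tau>' * \<tau>))" by (rule X(2))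
    also have "\<dots> = (C\<^sub>2 * real X powr (real ?n * \<tau>')) powr (- \<tau>)"
      using C2 by (simp add: powr_mult powr_powr)
    also have "\<dots> \<le> real Q powr (- \<tau>)"
      using Q_le Qpos \<tau> by (intro powr_mono2') auto
    finally have "int_dist (real Q *\<^sub>R y - \<theta>) < real Q powr (- \<tau>)" .
    then show "\<exists>q\<in>{q::nat. int_dist (real q *\<^sub>R y - \<theta>) < real q powr (- \<tau>)}. B \<le> q"
      using \<open>X \<le> Q\<close> X by (intro bexI[of _ Q]) auto
  qed
  then show ?thesis by (simp add: approx_set_def)
qed


section \<open>Transference from rational hyperplanes\<close>

text \<open>
  The fractional parts \<open>t\<close> of the multiples \<open>q y\<close>, \<open>q < Q\<close>, all satisfy \<open>b \<bullet> t = k\<close> up to an error \<open>\<epsilon>\<close>,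
  for one of about \<open>2 n |b|\<close> integers \<open>k\<close>. Given \<open>k\<close>, the coordinate \<open>i0\<close> at which \<open>|b|\<close> is attained is
  determined up to a small error by the others. So it suffices to sort the multiples by \<open>k\<close> and by the
  cells of side \<open>1/G\<close> of the remaining \<open>n - 1\<close> coordinates, which replaces one of the \<open>n\<close> factors \<open>G\<close>
  of the usual pigeonhole argument by a multiple of \<open>|b|\<close>.
\<close>

lemma approximation_near_rational_hyperplane:
  fixes y b :: "real^'n" and G :: nat
  assumes G: "G > 0" and b: "b \<in> int_vecs" "b \<noteq> 0" and b0: "b0 \<in> \<int>"
    and Q: "real Q > (2 * real CARD('n) * infnorm b + 3) * real G ^ (CARD('n) - 1)"
    and \<epsilon>: "real Q * \<bar>b \<bullet> y - b0\<bar> \<le> \<epsilon>" "\<epsilon> \<le> 1"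
  obtains q :: nat where "0 < q" "q < Q" "int_dist (real q *\<^sub>R y) \<le> real CARD('n) / real G + 2 * \<epsilon> / infnorm b"
proof -
  let ?n = "real CARD('n)"
  have h: "infnorm b > 0" using b by (simp add: infnorm_pos_lt)
  have "infnorm b \<in> {\<bar>b $ i\<bar> |i. i \<in> UNIV}"
  proof -
    have "finite {\<bar>b $ i\<bar> |i. i \<in> UNIV}" "{\<bar>b $ i\<bar> |i. i \<in> UNIV} \<noteq> {}" by (auto simp: full_SetCompr_eq)
    then show ?thesis unfolding infnorm_cart using Max_in by (subst cSup_eq_Max)
  qed
  then obtain i0 where i0: "\<bar>b $ i0\<bar> = infnorm b" by auto
  have \<epsilon>0: "\<epsilon> \<ge> 0" using \<epsilon>(1) by (meson abs_ge_zero mult_nonneg_nonneg of_nat_0_le_iff order_trans)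
  define t where "t = (\<lambda>q::nat. (\<chi> i. frac ((real q *\<^sub>R y) $ i)) :: real^'n)"
  define fl where "fl = (\<lambda>q::nat. (\<chi> i. of_int \<lfloor>(real q *\<^sub>R y) $ i\<rfloor>) :: real^'n)"
  have t_fl: "t q = real q *\<^sub>R y - fl q" for q by (simp add: t_def fl_def vec_eq_iff frac_def)
  have fl_int: "fl q \<in> int_vecs" for q by (simp add: fl_def int_vecs_iff)
  have t_range: "0 \<le> t q $ i" "t q $ i < 1" for q i by (auto simp: t_def frac_lt_1)
  define k where "k = (\<lambda>q. \<lfloor>real q * b0 - b \<bullet> fl q\<rfloor>)"
  have k: "of_int (k q) = real q * b0 - b \<bullet> fl q" for q
    using b0 inner_int_vecs[OF b(1) fl_int] by (simp add: k_def)
  have bt: "\<bar>b \<bullet> t q - of_int (k q)\<bar> \<le> \<epsilon>" if "q < Q" for q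
  proof -
    have "b \<bullet> t q - of_int (k q) = real q * (b \<bullet> y - b0)"
      by (simp add: t_fl k inner_diff_right algebra_simps)
    also have "\<bar>\<dots>\<bar> \<le> real Q * \<bar>b \<bullet> y - b0\<bar>"
      using that by (simp add: abs_mult mult_right_mono)
    finally show ?thesis using \<epsilon> by linarith
  qed
  define K where "K = \<lfloor>?n * infnorm b + 1\<rfloor>"
  have K: "K \<ge> 0" "of_int K \<le> ?n * infnorm b + 1" using h by (auto simp: K_def)
  have k_le: "\<bar>k q\<bar> \<le> K" if "q < Q" for q
  proof -
    have "infnorm (t q) \<le> 1" unfolding infnorm_le_iff using t_range by (auto intro: less_imp_le)
    then have "\<bar>b \<bullet> t q\<bar> \<le> ?n * infnorm b"
      using h by (intro order_trans[OF abs_inner_le_infnorm] mult_left_mono) (auto simp: mult_left_le)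
    then have "real_of_int \<bar>k q\<bar> \<le> ?n * infnorm b + 1" using bt[OF that] \<epsilon>(2) by (simp add: abs_le_iff)
    then show ?thesis by (simp only: K_def le_floor_iff)
  qed
  \<comment> \<open>The slot of the coordinate \<open>i0\<close> is used to record the integer \<open>k q\<close>.\<close>
  define key where "key = (\<lambda>q i. if i = i0 then k q else \<lfloor>real G * t q $ i\<rfloor>)"
  define T where "T = PiE (UNIV :: 'n set) (\<lambda>i. if i = i0 then {-K..K} else {0..<int G})"
  have "key q \<in> T" if "q < Q" for q
  proof -
    have "\<lfloor>real G * t q $ i\<rfloor> \<in> {0..<int G}" for i
    proof -
      have "0 \<le> real G * t q $ i" "real G * t q $ i < real G"
        using t_range[of q i] G by auto
      then show ?thesis by (auto simp: floor_less_iff)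
    qed
    then show ?thesis using k_le[OF that] by (auto simp: T_def key_def)
  qed
  then have sub: "key ` {..<Q} \<subseteq> T" by auto
  have finT: "finite T" by (auto simp: T_def intro!: finite_PiE)
  have cardT: "card T = nat (2 * K + 1) * G ^ (CARD('n) - 1)"
  proof -
    have "card T = (\<Prod>i\<in>UNIV. if i = i0 then nat (2 * K + 1) else G)"
      unfolding T_def by (subst card_PiE) (auto intro!: prod.cong)
    also have "\<dots> = nat (2 * K + 1) * (\<Prod>i\<in>UNIV - {i0}. if i = i0 then nat (2 * K + 1) else G)"
      by (subst prod.remove[of _ i0]) auto
    also have "(\<Prod>i\<in>UNIV - {i0}. if i = i0 then nat (2 * K + 1) else G) = (\<Prod>i\<in>UNIV - {i0}. G)"
      by (intro prod.cong) auto
    finally show ?thesis by (simp add: card_Diff_singleton)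
  qed
  have "real (card T) \<le> (2 * ?n * infnorm b + 3) * real G ^ (CARD('n) - 1)"
  proof -
    have "real (nat (2 * K + 1)) \<le> 2 * ?n * infnorm b + 3" using K by simp
    then show ?thesis unfolding cardT of_nat_mult of_nat_power by (intro mult_right_mono) auto
  qed
  then have "card T < card {..<Q}" using Q by simp
  then have "\<not> inj_on key {..<Q}" using card_inj_on_le[OF _ sub finT] by fastforce
  then obtain q' r' where "q' < Q" "r' < Q" "q' \<noteq> r'" "key q' = key r'" by (auto simp: inj_on_def)
  then obtain q r where qr: "r < q" "q < Q" "key q = key r"
    by (metis linorder_neqE_nat)
  have cells: "\<bar>t q $ i - t r $ i\<bar> \<le> 1 / real G" if "i \<noteq> i0" for i
  proof -
    have "\<lfloor>real G * t q $ i\<rfloor> = \<lfloor>real G * t r $ i\<rfloor>" using qr(3) that by (auto simp: key_def dest: fun_cong[of _ _ i])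
    then have "\<bar>real G * t q $ i - real G * t r $ i\<bar> \<le> 1" by linarith
    then have "real G * \<bar>t q $ i - t r $ i\<bar> \<le> 1"
      using G by (simp add: abs_mult flip: right_diff_distrib)
    then show ?thesis using G by (simp add: pos_le_divide_eq mult.commute)
  qed
  have kk: "k q = k r" using qr(3) by (auto simp: key_def dest: fun_cong[of _ _ i0])
  have "infnorm b * \<bar>t q $ i0 - t r $ i0\<bar> \<le> 2 * \<epsilon> + (?n - 1) * (infnorm b / real G)"
  proof -
    have "b \<bullet> (t q - t r) = b $ i0 * (t q $ i0 - t r $ i0) + (\<Sum>i\<in>UNIV - {i0}. b $ i * (t q $ i - t r $ i))"
      by (simp add: inner_vec_def sum.remove[of _ i0])
    then have "\<bar>b $ i0 * (t q $ i0 - t r $ i0)\<bar> \<le> \<bar>b \<bullet> (t q - t r)\<bar> + \<bar>\<Sum>i\<in>UNIV - {i0}. b $ i * (t q $ i - t r $ i)\<bar>"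
      by linarith
    also have "\<bar>b \<bullet> (t q - t r)\<bar> \<le> 2 * \<epsilon>"
      using bt[of q] bt[of r] qr kk by (simp add: inner_diff_right abs_le_iff)
    also have "\<bar>\<Sum>i\<in>UNIV - {i0}. b $ i * (t q $ i - t r $ i)\<bar> \<le> (\<Sum>i\<in>UNIV - {i0}. infnorm b * (1 / real G))"
      using cells h
      by (intro order_trans[OF sum_abs] sum_mono) (auto simp: abs_mult intro!: mult_mono component_le_infnorm_cart simp del: times_divide_eq_right)
    also have "\<dots> = (?n - 1) * (infnorm b / real G)" by (simp add: card_Diff_singleton of_nat_diff Suc_leI)
    finally show ?thesis by (simp add: abs_mult i0)
  qed
  then have "\<bar>t q $ i0 - t r $ i0\<bar> \<le> (2 * \<epsilon> + (?n - 1) * (infnorm b / real G)) / infnorm b"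
    using h by (simp add: pos_le_divide_eq mult.commute)
  also have "\<dots> = 2 * \<epsilon> / infnorm b + (?n - 1) / real G"
    using h by (simp add: add_divide_distrib)
  also have "\<dots> \<le> ?n / real G + 2 * \<epsilon> / infnorm b"
    by (simp add: divide_right_mono)
  finally have c0: "\<bar>t q $ i0 - t r $ i0\<bar> \<le> ?n / real G + 2 * \<epsilon> / infnorm b" .
  have "\<bar>t q $ i - t r $ i\<bar> \<le> ?n / real G + 2 * \<epsilon> / infnorm b" for i
  proof (cases "i = i0")
    case False
    have "1 / real G \<le> ?n / real G" by (intro divide_right_mono) (auto simp: Suc_leI)
    moreover have "2 * \<epsilon> / infnorm b \<ge> 0" using \<epsilon>0 h by simp
    ultimately show ?thesis using cells[OF False] by linarith
  qed (use c0 in simp)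
  then have "infnorm (t q - t r) \<le> ?n / real G + 2 * \<epsilon> / infnorm b"
    by (simp add: infnorm_le_iff)
  moreover have "t q - t r = real (q - r) *\<^sub>R y - (fl q - fl r)"
    using qr by (simp add: t_fl of_nat_diff algebra_simps)
  then have "int_dist (real (q - r) *\<^sub>R y) \<le> infnorm (t q - t r)"
    using int_dist_le[OF int_vecs_diff[OF fl_int fl_int], of "real (q - r) *\<^sub>R y" q r] by simp
  ultimately show ?thesis using qr by (intro that[of "q - r"]) auto
qed

text \<open>
  For a hyperplane of height \<open>h\<close> take \<open>G\<close> of order \<open>h\<^bsup>w/n\<^esup>\<close> and \<open>Q\<close> of order \<open>h G\<^bsup>n-1\<^esup>\<close>. Then both parts of
  the error in the previous lemma are of order \<open>h\<^bsup>-w/n\<^esup>\<close>, which gives every exponent below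
  \<open>w / (n + w (n - 1))\<close>; this exceeds \<open>1/n\<close> when \<open>w > n\<close>.
\<close>

lemma mem_approx_set_of_near_rational_hyperplanes:
  fixes y :: "real^'n"
  assumes w: "w > real CARD('n)" and C: "C > 0"
    and inf: "infinite {b \<in> int_vecs. \<exists>b0\<in>\<int>. \<bar>b \<bullet> y - b0\<bar> \<le> C * infnorm b powr (- w)}"
    and \<tau>: "\<tau> \<ge> 0" "\<tau> * (real CARD('n) + w * (real CARD('n) - 1)) < w"
  shows "y \<in> approx_set \<tau> 0"
proof (cases "\<exists>q::nat. q > 0 \<and> int_dist (real q *\<^sub>R y) = 0")
  case True
  then show ?thesis using mem_approx_set_zero_of_integral_multiple by blast
next
  case False
  have pos: "int_dist (real q *\<^sub>R y) > 0" if "q > 0" for q :: nat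
  proof -
    have "int_dist (real q *\<^sub>R y) \<noteq> 0" using False that by blast
    then show ?thesis using int_dist_nonneg[of "real q *\<^sub>R y"] by linarith
  qed
  let ?n = "real CARD('n)"
  have n1: "?n \<ge> 1" by (simp add: Suc_leI)
  define s where "s = w / ?n"
  have s: "s > 1" "w = s * ?n" using w n1 by (auto simp: s_def field_simps)
  have \<tau>s: "\<tau> * (1 + s * (?n - 1)) < s"
  proof -
    have "(\<tau> * (1 + s * (?n - 1))) * ?n = \<tau> * (?n + w * (?n - 1))" by (simp add: s(2) algebra_simps)
    also have "\<dots> < s * ?n" using \<tau>(2) s(2) by simp
    finally show ?thesis using n1 by simp
  qed
  define S where "S = {b \<in> int_vecs. \<exists>b0\<in>\<int>. \<bar>b \<bullet> y - b0\<bar> \<le> C * infnorm b powr (- w)}"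
  define C5 where "C5 = (2 * ?n + 4) * 2 ^ (CARD('n) - 1)"
  have C5: "C5 > 0" using n1 by (simp add: C5_def)
  define C3 where "C3 = C5 * C"
  have C3: "C3 > 0" using C5 C by (simp add: C3_def)
  define C4 where "C4 = ?n + 2 * C3"
  have key: "\<exists>q::nat. q > 0 \<and> int_dist (real q *\<^sub>R y) \<le> C4 * h powr (- s) \<and> real q \<le> C5 * h powr (1 + s * (?n - 1))"
    if b: "b \<in> S" and h_def: "h = infnorm b" and h1: "h \<ge> 1" and hC: "C3 * h powr (1 - s) \<le> 1" for b h
  proof -
    obtain b0 where b0: "b0 \<in> \<int>" "\<bar>b \<bullet> y - b0\<bar> \<le> C * h powr (- w)" and bi: "b \<in> int_vecs"
      using b by (auto simp: S_def h_def)
    have hs: "h powr s \<ge> 1" using h1 s by (intro ge_one_powr_ge_zero) auto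
    define G where "G = nat \<lceil>h powr s\<rceil>"
    have G: "h powr s \<le> real G" "real G \<le> 2 * h powr s" "G > 0"
      using hs unfolding G_def by linarith+
    define Q where "Q = nat \<lfloor>(2 * ?n * h + 3) * real G ^ (CARD('n) - 1)\<rfloor> + 1"
    have G1: "real G ^ (CARD('n) - 1) \<ge> 1" using G by (intro one_le_power) simp
    have X0: "(2 * ?n * h + 3) * real G ^ (CARD('n) - 1) \<ge> 0" using h1 by simp
    have Q: "real Q > (2 * ?n * h + 3) * real G ^ (CARD('n) - 1)"
      "real Q \<le> (2 * ?n * h + 3) * real G ^ (CARD('n) - 1) + 1"
      using X0 unfolding Q_def by linarith+
    have "real Q \<le> (2 * ?n * h + 4) * real G ^ (CARD('n) - 1)"
      using Q(2) G1 by (simp add: algebra_simps)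
    also have "\<dots> \<le> ((2 * ?n + 4) * h) * (2 * h powr s) ^ (CARD('n) - 1)"
      using h1 G by (intro mult_mono power_mono) (auto simp: algebra_simps)
    also have "\<dots> = C5 * (h powr 1 * h powr (s * (?n - 1)))"
      using h1 by (simp add: C5_def power_mult_distrib powr_powr of_nat_diff Suc_leI flip: powr_realpow)
    also have "\<dots> = C5 * h powr (1 + s * (?n - 1))" by (simp only: powr_add)
    finally have Q_le: "real Q \<le> C5 * h powr (1 + s * (?n - 1))" .
    have \<epsilon>: "real Q * \<bar>b \<bullet> y - b0\<bar> \<le> C3 * h powr (1 - s)"
    proof -
      have "real Q * \<bar>b \<bullet> y - b0\<bar> \<le> (C5 * h powr (1 + s * (?n - 1))) * (C * h powr (- w))"
        using Q_le b0 C5 by (intro mult_mono) auto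
      also have "\<dots> = C3 * h powr (1 + s * (?n - 1) + - w)"
        by (simp only: powr_add C3_def mult_ac)
      also have "1 + s * (?n - 1) + - w = 1 - s" by (simp add: s(2) algebra_simps)
      finally show ?thesis .
    qed
    obtain q where q: "0 < q" "q < Q" "int_dist (real q *\<^sub>R y) \<le> ?n / real G + 2 * (C3 * h powr (1 - s)) / infnorm b"
    proof (rule approximation_near_rational_hyperplane[OF G(3) bi _ b0(1) _ \<epsilon> hC])
      show "b \<noteq> 0" using h1 by (auto simp: h_def infnorm_0)
      show "real Q > (2 * ?n * infnorm b + 3) * real G ^ (CARD('n) - 1)" using Q by (simp add: h_def)
    qed
    have "?n / real G \<le> ?n * h powr (- s)"
      using G h1 n1 by (simp add: powr_minus field_simps)
    moreover have "2 * (C3 * h powr (1 - s)) / infnorm b = 2 * C3 * h powr (- s)"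
      using h1 by (simp add: powr_diff powr_minus field_simps flip: h_def)
    ultimately have "int_dist (real q *\<^sub>R y) \<le> C4 * h powr (- s)"
      using q(3) by (simp add: C4_def algebra_simps)
    moreover have "real q \<le> C5 * h powr (1 + s * (?n - 1))" using q(2) Q_le by linarith
    ultimately show ?thesis using q(1) by blast
  qed
  show ?thesis
  proof (rule ccontr)
    assume notin: "y \<notin> approx_set \<tau> 0"
    define F where "F = {q::nat. int_dist (real q *\<^sub>R y) < real q powr (- \<tau>)}"
    have finF: "finite F" using notin by (simp add: approx_set_def F_def)
    \<comment> \<open>Finitely many multipliers would give distances bounded below by \<open>m\<close>, but the heights, and
      with them the quality of the approximations, are unbounded.\<close>
    define m where "m = Min (insert 1 ((\<lambda>q. int_dist (real q *\<^sub>R y)) ` (F - {0})))"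
    have m: "m > 0" unfolding m_def using finF pos by (subst Min_gr_iff) auto
    have m_le: "m \<le> int_dist (real q *\<^sub>R y)" if "q \<in> F" "q > 0" for q
      unfolding m_def using finF that by (intro Min_le) auto
    have ev1: "eventually (\<lambda>h. C3 * h powr (1 - s) < 1) at_top"
    proof -
      have "((\<lambda>h. C3 * h powr (1 - s)) \<longlongrightarrow> C3 * 0) at_top"
        using s by (intro tendsto_intros tendsto_neg_powr filterlim_ident) auto
      then show ?thesis by (intro order_tendstoD) auto
    qed
    have ev2: "eventually (\<lambda>h. C4 * h powr (- s) < m) at_top"
    proof -
      have "((\<lambda>h. C4 * h powr (- s)) \<longlongrightarrow> C4 * 0) at_top"
        using s by (intro tendsto_intros tendsto_neg_powr filterlim_ident) auto
      then show ?thesis using m by (intro order_tendstoD) auto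
    qed
    have ev3: "eventually (\<lambda>h. C4 * h powr (\<tau> * (1 + s * (?n - 1)) - s) < C5 powr (- \<tau>)) at_top"
    proof -
      have "((\<lambda>h. C4 * h powr (\<tau> * (1 + s * (?n - 1)) - s)) \<longlongrightarrow> C4 * 0) at_top"
        using \<tau>s by (intro tendsto_intros tendsto_neg_powr filterlim_ident) auto
      then show ?thesis using C5 by (intro order_tendstoD) auto
    qed
    obtain h0 where h0: "\<And>h. h \<ge> h0 \<Longrightarrow> C3 * h powr (1 - s) < 1 \<and> C4 * h powr (- s) < m \<and>
        C4 * h powr (\<tau> * (1 + s * (?n - 1)) - s) < C5 powr (- \<tau>)"
      using eventually_conj[OF ev1 eventually_conj[OF ev2 ev3]] unfolding eventually_at_top_linorder by blast
    have "\<exists>b\<in>S. infnorm b \<ge> max h0 1"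
    proof (rule ccontr)
      assume "\<not> (\<exists>b\<in>S. infnorm b \<ge> max h0 1)"
      then have "infnorm b \<le> max h0 1" if "b \<in> S" for b
        using that by (meson linorder_le_cases)
      then have "S \<subseteq> {z \<in> int_vecs. infnorm z \<le> max h0 1}" by (auto simp only: S_def)
      then show False using inf finite_int_vecs_bounded finite_subset unfolding S_def by blast
    qed
    then obtain b where b: "b \<in> S" "infnorm b \<ge> h0" "infnorm b \<ge> 1" by auto
    define h where "h = infnorm b"
    note h = h0[OF b(2), folded h_def]
    have h1: "h \<ge> 1" using b by (simp add: h_def)
    obtain q :: nat where q: "q > 0" "int_dist (real q *\<^sub>R y) \<le> C4 * h powr (- s)" "real q \<le> C5 * h powr (1 + s * (?n - 1))"
      using key[OF b(1) h_def h1] h by (auto simp: less_imp_le)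
    have "C4 * h powr (- s) = C4 * h powr (\<tau> * (1 + s * (?n - 1)) - s) * h powr (- (\<tau> * (1 + s * (?n - 1))))"
      by (simp add: mult.assoc flip: powr_add)
    also have "\<dots> < C5 powr (- \<tau>) * h powr (- (\<tau> * (1 + s * (?n - 1))))"
      using h h1 by (intro mult_strict_right_mono) auto
    also have "\<dots> = (C5 * h powr (1 + s * (?n - 1))) powr (- \<tau>)"
      using C5 by (simp add: powr_mult powr_powr mult.commute)
    also have "\<dots> \<le> real q powr (- \<tau>)"
      using q \<tau> by (intro powr_mono2') auto
    finally have "q \<in> F" using q(2) by (simp add: F_def)
    from m_le[OF this q(1)] q(2) h show False by linarith
  qed
qed

section \<open>The exponent of the affine subspace\<close>

text \<open>
  If \<open>A q\<close> is close to the integer vector \<open>p\<close>, then \<open>x~ (A q - p)\<close> is small for every \<open>x\<close>. Written as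
  a function of the point \<open>(x, x~ A)\<close> this is \<open>b \<bullet> (x, x~ A) - p\<^sub>0\<close> with \<open>b = (-p', q)\<close>, and the height
  of \<open>b\<close> is of the order of \<open>|q|\<close>.
\<close>

lemma affine_chart_near_rational_hyperplanes:
  fixes A :: "real^'m::finite^('d::finite option)"
  assumes w: "w > 0" and inf: "infinite {q \<in> int_vecs. int_dist (A *v q) < infnorm q powr (- w)}"
  obtains C where "C > 0"
    "infinite {b \<in> int_vecs. \<exists>b0\<in>\<int>. \<bar>b \<bullet> affine_chart A x - b0\<bar> \<le> C * infnorm b powr (- w)}"
proof -
  define S where "S = {q \<in> int_vecs. int_dist (A *v q) < infnorm q powr (- w)} - {0}"
  have infS: "infinite S" using inf by (simp add: S_def)
  define K where "K = (\<Sum>i\<in>UNIV. \<Sum>j\<in>UNIV. \<bar>transpose A $ i $ j\<bar>)"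
  have K: "infnorm (A *v q) \<le> K * infnorm q" for q
    using infnorm_vector_matrix_mult_le[of q "transpose A"] by (simp add: K_def)
  have K0: "K \<ge> 0" by (auto simp: K_def intro!: sum_nonneg)
  define p where "p = (\<lambda>q. (\<chi> i. of_int (round ((A *v q) $ i))) :: real^('d option))"
  have p_int: "p q \<in> int_vecs" for q by (simp add: p_def int_vecs_iff)
  have p_dist: "infnorm (A *v q - p q) = int_dist (A *v q)" for q by (simp add: p_def int_dist_round)
  define b where "b = (\<lambda>q. (\<chi> k. case k of Inl i \<Rightarrow> - p q $ Some i | Inr j \<Rightarrow> q $ j) :: real^('d + 'm))"
  define D where "D = real CARD('d option) * infnorm (tilde x) + 1"
  have D: "D > 0" by (auto simp: D_def infnorm_pos_le intro!: add_nonneg_pos)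
  define C where "C = D * (K + 1) powr w"
  have inner: "b q \<bullet> affine_chart A x - p q $ None = tilde x \<bullet> (A *v q - p q)" for q
  proof -
    have "b q \<bullet> affine_chart A x = (\<Sum>i\<in>UNIV. - p q $ Some i * x $ i) + q \<bullet> (tilde x v* A)"
      unfolding inner_vec_def UNIV_Plus_UNIV[symmetric]
      by (subst sum.Plus) (auto simp: b_def affine_chart_def)
    moreover have "q \<bullet> (tilde x v* A) = tilde x \<bullet> (A *v q)"
      by (simp add: inner_commute[of q] dot_lmul_matrix)
    moreover have "tilde x \<bullet> p q = p q $ None + (\<Sum>i\<in>UNIV. x $ i * p q $ Some i)"
      by (simp add: inner_vec_def sum_option tilde_def)
    ultimately show ?thesis
      by (simp add: inner_diff_right sum_negf mult.commute)
  qed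
  have "b q \<in> int_vecs \<and> \<bar>b q \<bullet> affine_chart A x - p q $ None\<bar> \<le> C * infnorm (b q) powr (- w)" if q: "q \<in> S" for q
  proof
    have q': "q \<in> int_vecs" "q \<noteq> 0" "int_dist (A *v q) < infnorm q powr (- w)" using q by (auto simp: S_def)
    have q1: "infnorm q \<ge> 1" using infnorm_int_vec_ge_1 q' by blast
    show "b q \<in> int_vecs"
      using q'(1) p_int[of q] by (auto simp: int_vecs_iff b_def split: sum.splits)
    have b_ge: "infnorm (b q) \<ge> infnorm q"
      unfolding infnorm_le_iff[of q]
    proof
      fix j show "\<bar>q $ j\<bar> \<le> infnorm (b q)" using component_le_infnorm_cart[of "b q" "Inr j"] by (simp add: b_def)
    qed
    have b_le: "infnorm (b q) \<le> (K + 1) * infnorm q"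
      unfolding infnorm_le_iff
    proof
      fix k
      show "\<bar>b q $ k\<bar> \<le> (K + 1) * infnorm q"
      proof (cases k)
        case (Inl i)
        have "infnorm (p q) \<le> infnorm (A *v q) + infnorm (A *v q - p q)"
          using infnorm_diff_le[of "A *v q" "A *v q - p q"] by simp
        also have "\<dots> \<le> K * infnorm q + 1 / 2" using K[of q] int_dist_le_half[of "A *v q"] by (simp add: p_dist)
        also have "\<dots> \<le> (K + 1) * infnorm q" using q1 by (simp add: algebra_simps)
        finally show ?thesis using component_le_infnorm_cart[of "p q" "Some i"] Inl by (simp add: b_def)
      next
        case (Inr j)
        have "infnorm q \<le> (K + 1) * infnorm q" using K0 q1 by (simp add: algebra_simps)
        then show ?thesis using component_le_infnorm_cart[of q j] Inr by (simp add: b_def)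
      qed
    qed
    have "\<bar>b q \<bullet> affine_chart A x - p q $ None\<bar> \<le> real CARD('d option) * (infnorm (tilde x) * infnorm (A *v q - p q))"
      unfolding inner by (rule abs_inner_le_infnorm)
    also have "\<dots> \<le> D * infnorm (A *v q - p q)"
      by (simp add: D_def algebra_simps infnorm_pos_le)
    also have "\<dots> \<le> D * infnorm q powr (- w)" using q' D by (simp add: p_dist)
    also have "\<dots> \<le> D * (infnorm (b q) / (K + 1)) powr (- w)"
    proof -
      have "infnorm (b q) / (K + 1) \<le> infnorm q" using b_le K0 by (simp add: pos_divide_le_eq mult.commute)
      moreover have "infnorm (b q) / (K + 1) > 0" using b_ge q1 K0 by auto
      ultimately show ?thesis using D w by (intro mult_left_mono powr_mono2') auto
    qed
    also have "\<dots> = C * infnorm (b q) powr (- w)"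
      using K0 b_ge q1 by (simp add: C_def powr_divide powr_minus field_simps)
    finally show "\<bar>b q \<bullet> affine_chart A x - p q $ None\<bar> \<le> C * infnorm (b q) powr (- w)" .
  qed
  moreover have "p q $ None \<in> \<int>" for q using p_int[of q] by (simp add: int_vecs_iff)
  ultimately have sub: "b ` S \<subseteq> {b \<in> int_vecs. \<exists>b0\<in>\<int>. \<bar>b \<bullet> affine_chart A x - b0\<bar> \<le> C * infnorm b powr (- w)}"
    by blast
  have "inj b"
  proof (rule injI)
    fix q q' assume "b q = b q'"
    then have "b q $ Inr j = b q' $ Inr j" for j by simp
    then show "q = q'" by (simp add: b_def vec_eq_iff)
  qed
  then have "infinite (b ` S)" using infS by (meson finite_image_iff inj_on_subset subset_UNIV)
  then have "infinite {b \<in> int_vecs. \<exists>b0\<in>\<int>. \<bar>b \<bullet> affine_chart A x - b0\<bar> \<le> C * infnorm b powr (- w)}"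
    using sub infinite_super by blast
  moreover have "C > 0" using D K0 by (simp add: C_def)
  ultimately show ?thesis by (intro that)
qed

lemma emeasure_approx_set_affine_subspace_pos_iff:
  fixes A :: "real^'m::finite^('d::finite option)"
  shows "emeasure (induced_lebesgue TYPE('d) (affine_subspace A)) (approx_set \<tau> \<theta> \<inter> affine_subspace A) > 0
           \<longleftrightarrow> {x. affine_chart A x \<in> approx_set \<tau> \<theta>} \<notin> null_sets lborel"
proof -
  have "affine_chart A -` approx_set \<tau> \<theta> \<inter> space lborel \<in> sets lborel"
    by (rule measurable_sets[OF _ Borel_approx_set])
      (simp add: borel_measurable_continuous_onI continuous_on_affine_chart)
  then have "{x. affine_chart A x \<in> approx_set \<tau> \<theta>} \<in> sets lborel" by (simp add: vimage_def)
  moreover have "ennreal (sqrt (det (transpose (chart_matrix A) ** chart_matrix A))) > 0"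
    using chart_gram_det_pos[of A] by simp
  ultimately show ?thesis
    unfolding emeasure_induced_lebesgue_affine_subspace[OF Borel_approx_set]
    by (auto simp: null_sets_def zero_less_iff_neq_zero)
qed

lemma manifold_exponent_affine_subspace_le:
  fixes A :: "real^'m::finite^('d::finite option)"
  assumes "\<And>\<tau>. b < ereal \<tau> \<Longrightarrow> {x. affine_chart A x \<in> approx_set \<tau> \<theta>} \<in> null_sets lborel"
  shows "manifold_exponent TYPE('d) (affine_subspace A) \<theta> \<le> b"
  unfolding manifold_exponent_def emeasure_approx_set_affine_subspace_pos_iff
proof (rule Sup_least)
  fix z assume "z \<in> ereal ` {\<tau>. {x. affine_chart A x \<in> approx_set \<tau> \<theta>} \<notin> null_sets lborel}"
  then obtain \<tau> where "z = ereal \<tau>" "{x. affine_chart A x \<in> approx_set \<tau> \<theta>} \<notin> null_sets lborel"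
    by blast
  then show "z \<le> b" using assms[of \<tau>] not_less by blast
qed

lemma manifold_exponent_affine_subspace_ge:
  fixes A :: "real^'m::finite^('d::finite option)"
  assumes "{x. affine_chart A x \<in> approx_set \<tau> \<theta>} \<notin> null_sets lborel"
  shows "ereal \<tau> \<le> manifold_exponent TYPE('d) (affine_subspace A) \<theta>"
  unfolding manifold_exponent_def emeasure_approx_set_affine_subspace_pos_iff
  using assms by (auto intro!: Sup_upper)

text \<open>
  Counting by duality with \<open>w\<close> slightly above \<open>max n \<omega>\<close>. Because \<open>w \<ge> n\<close>, the bound
  \<open>(1 - m/w) / d\<close> is at least \<open>1/w\<close>, which puts \<open>\<tau>\<close> in the range where the duality count applies. If
  \<open>\<omega>\<close> is infinite, the number of all integer points of the box is good enough.
\<close>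

lemma null_set_above_omega_bound:
  fixes A :: "real^'m::finite^('d::finite option)"
  defines "d \<equiv> real CARD('d)" and "m \<equiv> real CARD('m)"
  assumes \<tau>: "ereal (1 / d) * (1 - ereal m / max (ereal (d + m)) (dioph_exponent A)) < ereal \<tau>"
  shows "{x. affine_chart A x \<in> approx_set \<tau> \<theta>} \<in> null_sets lborel"
proof -
  have d: "d \<ge> 1" and m: "m \<ge> 1" by (auto simp: d_def m_def Suc_leI)
  have card: "real CARD('d option) = d + 1" by (simp add: d_def card_UNIV_option)
  have nonneg: "dioph_exponent A \<ge> 0" by (rule dioph_exponent_nonneg)
  show ?thesis
  proof (cases "dioph_exponent A = \<infinity>")
    case True
    then have "1 / d < \<tau>" using \<tau> by (simp add: max_def)
    then have "1 < d * \<tau>" using d by (simp add: field_simps)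
    moreover have "\<tau> > 0" using \<open>1 / d < \<tau>\<close> d by (meson less_trans zero_less_divide_1_iff zero_less_one le_less_trans not_less)
    ultimately show ?thesis
      using near_vecs_count_trivial[of _ A \<tau>]
      by (intro null_set_of_near_vecs_count[of \<tau> "d + 1"]) (auto simp: card d_def algebra_simps)
  next
    case False
    with nonneg obtain u where u: "dioph_exponent A = ereal u" by (cases "dioph_exponent A") auto
    define v where "v = max (d + m) u"
    have v: "v \<ge> d + m" "v > 0" using d m by (auto simp: v_def)
    have "max (ereal (d + m)) (dioph_exponent A) = ereal v" by (auto simp: v_def u max_def)
    with \<tau> v have "(1 / d) * (1 - m / v) < \<tau>" by (simp add: one_ereal_def)
    then have *: "1 - m / v < d * \<tau>" using d by (simp add: field_simps)
    \<comment> \<open>The inequality for \<open>v\<close> is strict, so it persists for slightly larger values.\<close>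
    obtain w where w: "w > v" "1 - m / w < d * \<tau>"
    proof (cases "d * \<tau> < 1")
      case True
      have "v < m / (1 - d * \<tau>)" using * True v by (simp add: field_simps)
      then obtain w where "v < w" "w < m / (1 - d * \<tau>)" using dense by blast
      then show ?thesis using True v by (intro that[of w]) (auto simp: field_simps)
    next
      case False
      then show ?thesis using v m by (intro that[of "v + 1"]) (auto intro: less_le_trans[of _ 1])
    qed
    have w0: "w > 0" using w v by linarith
    have less: "dioph_exponent A < ereal w" using w by (auto simp: u v_def)
    have \<tau>w: "\<tau> \<ge> 1 / w"
    proof -
      have "d / w \<le> 1 - m / w" using w v w0 by (simp add: field_simps)
      also have "\<dots> \<le> d * \<tau>" using w by simp
      finally have "d * (1 / w) \<le> d * \<tau>" by simp
      then show ?thesis using d by (simp only: mult_le_cancel_left_pos)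
    qed
    have count: "\<exists>M. \<forall>Q\<ge>1. real (card (near_vecs A (C * Q) (C * Q powr (- \<tau>)))) \<le> M * Q powr (d + 1 - m / w)"
      if "C > 0" for C
      using near_vecs_count_of_exponent[OF less w0 \<tau>w that] by (simp only: card m_def)
    have "\<tau> > 0" using \<tau>w w0 by (meson less_le_trans zero_less_divide_1_iff)
    then show ?thesis
      using w(2) by (intro null_set_of_near_vecs_count[OF _ _ count]) (auto simp: d_def algebra_simps)
  qed
qed

text \<open>
  Packing with \<open>w\<close> slightly above \<open>\<sigma>\<close>. That \<open>\<tau> > -1\<close> comes for free from \<open>\<sigma> \<ge> 0\<close>.
\<close>

lemma null_set_above_sigma_bound:
  fixes A :: "real^'m::finite^('d::finite option)"
  defines "d \<equiv> real CARD('d)" and "m \<equiv> real CARD('m)"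
  assumes \<tau>: "(ereal m * dioph_exponent_dual A - ereal d) / ereal (d + m) < ereal \<tau>"
  shows "{x. affine_chart A x \<in> approx_set \<tau> \<theta>} \<in> null_sets lborel"
proof -
  have d: "d \<ge> 1" and m: "m \<ge> 1" by (auto simp: d_def m_def Suc_leI)
  have nonneg: "dioph_exponent_dual A \<ge> 0" by (simp add: dioph_exponent_dual_def dioph_exponent_nonneg)
  have "dioph_exponent_dual A \<noteq> \<infinity>" using \<tau> d m by auto
  with nonneg obtain s where s: "dioph_exponent_dual A = ereal s" by (cases "dioph_exponent_dual A") auto
  have s0: "s \<ge> 0" using nonneg by (simp add: s)
  have "(m * s - d) / (d + m) < \<tau>" using \<tau> d m by (simp add: s)
  then have *: "m * s - d < (d + m) * \<tau>" using d m by (simp add: field_simps)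
  then have "s < ((d + m) * \<tau> + d) / m" using m by (simp add: field_simps)
  then obtain w where w: "s < w" "w < ((d + m) * \<tau> + d) / m" using dense by blast
  have w0: "w > 0" using w s0 by linarith
  have mw: "m * w - d < (d + m) * \<tau>" using w m by (simp add: field_simps)
  have "dioph_exponent (transpose A) < ereal w" using w s by (simp add: dioph_exponent_dual_def)
  then have count: "\<exists>M. \<forall>Q\<ge>1. real (card (near_vecs A (C * Q) (C * Q powr (- \<tau>)))) \<le> M * Q powr (max 0 (w - \<tau>) * m)"
    if "C > 0" for C
    using near_vecs_count_of_dual_exponent[of A w C \<tau>] w0 that by (simp add: m_def)
  have \<tau>1: "\<tau> > -1"
  proof -
    have "0 \<le> m * w" using m w0 by simp
    then have "0 < (d + m) * \<tau> + (d + m)" using mw m by linarith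
    then have "0 < (d + m) * (\<tau> + 1)" by (simp add: algebra_simps)
    then show ?thesis using d m by (simp add: zero_less_mult_iff)
  qed
  have "max 0 (w - \<tau>) * m < d * (\<tau> + 1)"
  proof (cases "w \<le> \<tau>")
    case True
    then show ?thesis using d \<tau>1 by (simp add: max_def)
  next
    case False
    then show ?thesis using mw by (simp add: max_def algebra_simps)
  qed
  then show ?thesis
    using \<tau>1 by (intro null_set_of_near_vecs_count[OF _ _ count]) (auto simp: d_def)
qed

text \<open>
  By assumption almost every point is not approximable to a given order above \<open>1/n\<close>. If that order is
  close enough to \<open>1/n\<close>, such points are approximable to a given order below \<open>1/n\<close> for every \<open>\<theta>\<close>.
\<close>

lemma manifold_exponent_ge_inverse_dim:
  fixes A :: "real^'m::finite^('d::finite option)"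
  assumes null: "\<And>\<tau>. 1 / real CARD('d + 'm) < \<tau> \<Longrightarrow> {x. affine_chart A x \<in> approx_set \<tau> 0} \<in> null_sets lborel"
  shows "ereal (1 / real CARD('d + 'm)) \<le> manifold_exponent TYPE('d) (affine_subspace A) \<theta>"
proof -
  define n where "n = real CARD('d + 'm)"
  have n: "n \<ge> 1"
  proof -
    have "real CARD('d) \<ge> 1" by (simp add: Suc_leI)
    moreover have "n = real CARD('d) + real CARD('m)" by (simp add: n_def)
    ultimately show ?thesis by linarith
  qed
  have ge: "ereal \<tau> \<le> manifold_exponent TYPE('d) (affine_subspace A) \<theta>" if \<tau>: "0 \<le> \<tau>" "\<tau> < 1 / n" for \<tau>
  proof (rule manifold_exponent_affine_subspace_ge, rule notI)
    assume null_\<theta>: "{x. affine_chart A x \<in> approx_set \<tau> \<theta>} \<in> null_sets lborel"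
    have n\<tau>: "n * \<tau> < 1" using \<tau> n by (simp add: field_simps)
    obtain \<tau>' where \<tau>': "1 / n < \<tau>'" "\<tau>' * (n - 1 + n * \<tau>) < 1"
    proof (cases "n - 1 + n * \<tau> > 0")
      case True
      have "1 / n < 1 / (n - 1 + n * \<tau>)" using True n\<tau> n by (intro divide_strict_left_mono) auto
      then obtain \<tau>' where "1 / n < \<tau>'" "\<tau>' < 1 / (n - 1 + n * \<tau>)" using dense by blast
      then show ?thesis using True by (intro that[of \<tau>']) (auto simp: field_simps)
    next
      case False
      have "n * \<tau> \<ge> 0" using n \<tau> by simp
      with False n have "n - 1 + n * \<tau> = 0" by linarith
      then show ?thesis by (intro that[of "1 / n + 1"]) auto
    qed
    have "affine_chart A x \<in> approx_set \<tau> \<theta>" if "affine_chart A x \<notin> approx_set \<tau>' 0" for x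
    proof (rule mem_approx_set_of_not_well_approximable[OF that _ \<tau>(1)])
      show "\<tau>' > 0" using \<tau>' n by (meson less_trans zero_less_divide_1_iff less_le_trans zero_less_one)
      show "\<tau>' * (real CARD('d + 'm) - 1 + real CARD('d + 'm) * \<tau>) < 1" using \<tau>' by (simp only: n_def)
      show "1 \<le> real CARD('d + 'm) * \<tau>'" using \<tau>'(1) n unfolding n_def[symmetric] by (simp add: field_simps)
    qed
    then have "UNIV = {x. affine_chart A x \<in> approx_set \<tau>' 0} \<union> {x. affine_chart A x \<in> approx_set \<tau> \<theta>}" by auto
    then have "(UNIV :: (real^'d) set) \<in> null_sets lborel"
      using null[OF \<tau>'(1)[unfolded n_def]] null_\<theta> null_sets.Un by metis
    then show False by (simp add: null_sets_def)
  qed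
  show ?thesis
    unfolding n_def[symmetric]
  proof (rule dense_le)
    fix z :: ereal assume z: "z < ereal (1 / n)"
    show "z \<le> manifold_exponent TYPE('d) (affine_subspace A) \<theta>"
    proof (cases z)
      case (real r)
      then have "ereal r \<le> ereal (max r 0)" "max r 0 < 1 / n" using z n by auto
      then show ?thesis using ge[of "max r 0"] real order_trans by (metis max.cobounded2)
    qed (use z in auto)
  qed
qed

text \<open>
  Here the approximation holds at every point of the subspace, not only on a set of positive measure.
\<close>

lemma manifold_exponent_zero_gt_inverse_dim:
  fixes A :: "real^'m::finite^('d::finite option)"
  assumes gt: "ereal (real CARD('d + 'm)) < dioph_exponent A"
  shows "ereal (1 / real CARD('d + 'm)) < manifold_exponent TYPE('d) (affine_subspace A) 0"
proof -
  define n where "n = real CARD('d + 'm)"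
  have n: "n \<ge> 1"
  proof -
    have "real CARD('d) \<ge> 1" by (simp add: Suc_leI)
    moreover have "n = real CARD('d) + real CARD('m)" by (simp add: n_def)
    ultimately show ?thesis by linarith
  qed
  from gt obtain w where w: "n < w" and inf: "infinite {q \<in> int_vecs. int_dist (A *v q) < infnorm q powr (- w)}"
    unfolding dioph_exponent_def less_Sup_iff n_def by auto
  have w0: "w > 0" using w n by linarith
  have pos: "n + w * (n - 1) > 0" using n w0 by (simp add: add_pos_nonneg)
  have "1 / n < w / (n + w * (n - 1))" using w n pos by (simp add: field_simps)
  then obtain \<tau> where \<tau>: "1 / n < \<tau>" "\<tau> < w / (n + w * (n - 1))" using dense by blast
  have "affine_chart A x \<in> approx_set \<tau> 0" for x
  proof -
    obtain C where C: "C > 0" "infinite {b \<in> int_vecs. \<exists>b0\<in>\<int>. \<bar>b \<bullet> affine_chart A x - b0\<bar> \<le> C * infnorm b powr (- w)}"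
      by (rule affine_chart_near_rational_hyperplanes[OF w0 inf])
    show ?thesis
    proof (rule mem_approx_set_of_near_rational_hyperplanes[OF _ C])
      show "real CARD('d + 'm) < w" using w by (simp only: n_def)
      show "0 \<le> \<tau>" using \<tau> n by (meson less_imp_le less_trans zero_less_divide_1_iff less_le_trans zero_less_one)
      show "\<tau> * (real CARD('d + 'm) + w * (real CARD('d + 'm) - 1)) < w"
        using \<tau>(2) pos unfolding n_def[symmetric] by (simp add: pos_less_divide_eq)
    qed
  qed
  then have "{x. affine_chart A x \<in> approx_set \<tau> 0} = UNIV" by auto
  then have "{x. affine_chart A x \<in> approx_set \<tau> 0} \<notin> null_sets lborel" by (simp add: null_sets_def)
  then have "ereal \<tau> \<le> manifold_exponent TYPE('d) (affine_subspace A) 0"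
    by (rule manifold_exponent_affine_subspace_ge)
  then show ?thesis using \<tau>(1) unfolding n_def[symmetric] by (meson ereal_less(2) less_ereal.simps(1) less_le_trans)
qed

theorem theorem1p4:
  fixes A :: "real^'m::finite^('d::finite option)"
    and d m n :: nat and \<omega> \<sigma> :: ereal
  assumes "d = CARD('d)" and "m = CARD('m)" and "n = d + m"
    and "dioph_exponent A = \<omega>" and "dioph_exponent_dual A = \<sigma>"
  shows "(\<forall>\<theta> :: real^('d + 'm).
            manifold_exponent TYPE('d) (affine_subspace A) \<theta>
              \<le> min (ereal (1 / real d) * (1 - ereal (real m) / max (ereal (real n)) \<omega>))
                    ((ereal (real m) * \<sigma> - ereal (real d)) / ereal (real n)))
         \<and> (dioph_exponent A \<le> ereal (real n) \<longleftrightarrow>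
              (\<forall>\<theta> :: real^('d + 'm).
                 manifold_exponent TYPE('d) (affine_subspace A) \<theta> = ereal (1 / real n)))"
proof -
  have n: "real n = real d + real m" "n = CARD('d + 'm)" using assms by auto
  have dm: "real d \<ge> 1" "real m \<ge> 1" using assms by (auto simp: Suc_leI)
  have bound_\<omega>: "{x. affine_chart A x \<in> approx_set \<tau> \<theta>} \<in> null_sets lborel"
    if "ereal (1 / real d) * (1 - ereal (real m) / max (ereal (real n)) \<omega>) < ereal \<tau>" for \<tau> \<theta>
    using null_set_above_omega_bound[of A \<tau> \<theta>] that assms by simp
  have upper_\<omega>: "manifold_exponent TYPE('d) (affine_subspace A) \<theta>
      \<le> ereal (1 / real d) * (1 - ereal (real m) / max (ereal (real n)) \<omega>)" for \<theta>
    using bound_\<omega> by (rule manifold_exponent_affine_subspace_le)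
  have upper_\<sigma>: "manifold_exponent TYPE('d) (affine_subspace A) \<theta>
      \<le> (ereal (real m) * \<sigma> - ereal (real d)) / ereal (real n)" for \<theta>
    using null_set_above_sigma_bound[of A _ \<theta>] assms
    by (intro manifold_exponent_affine_subspace_le) simp
  have "dioph_exponent A \<le> ereal (real n) \<longleftrightarrow>
      (\<forall>\<theta> :: real^('d + 'm). manifold_exponent TYPE('d) (affine_subspace A) \<theta> = ereal (1 / real n))"
  proof
    assume "dioph_exponent A \<le> ereal (real n)"
    then have "max (ereal (real n)) \<omega> = ereal (real n)" using assms by (simp add: max_absorb1)
    moreover have "(1 / real d) * (1 - real m / real n) = 1 / real n"
      using dm by (simp add: n(1) field_simps)
    ultimately have eq: "ereal (1 / real d) * (1 - ereal (real m) / max (ereal (real n)) \<omega>) = ereal (1 / real n)"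
      using dm n(1) by (simp add: one_ereal_def)
    show "\<forall>\<theta> :: real^('d + 'm). manifold_exponent TYPE('d) (affine_subspace A) \<theta> = ereal (1 / real n)"
    proof (intro allI antisym)
      fix \<theta> :: "real^('d + 'm)"
      show "manifold_exponent TYPE('d) (affine_subspace A) \<theta> \<le> ereal (1 / real n)"
        using upper_\<omega>[of \<theta>] by (simp only: eq)
      show "ereal (1 / real n) \<le> manifold_exponent TYPE('d) (affine_subspace A) \<theta>"
        unfolding n(2)
      proof (rule manifold_exponent_ge_inverse_dim)
        fix \<tau> assume "1 / real CARD('d + 'm) < \<tau>"
        then have "ereal (1 / real n) < ereal \<tau>" by (simp only: n(2) less_ereal.simps)
        then show "{x. affine_chart A x \<in> approx_set \<tau> 0} \<in> null_sets lborel"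
          using bound_\<omega>[of \<tau> 0] by (simp only: eq simp_thms)
      qed
    qed
  next
    assume "\<forall>\<theta> :: real^('d + 'm). manifold_exponent TYPE('d) (affine_subspace A) \<theta> = ereal (1 / real n)"
    then have "\<not> ereal (1 / real n) < manifold_exponent TYPE('d) (affine_subspace A) 0" by simp
    then show "dioph_exponent A \<le> ereal (real n)"
      using manifold_exponent_zero_gt_inverse_dim[of A] unfolding n(2) by (meson not_less)
  qed
  then show ?thesis using upper_\<omega> upper_\<sigma> by simp
qed

end
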